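(* Fix a horizon $\bar T>0$, let $f$ be Lipschitz on $(0,\bar T)$, $v_I\in L^\infty(\mathbb{R}_+,\omega)$, and suppose that assumptions (A1), (A2), (A3) of the context hold. Let $\underline\mu$ be any fixed number with $0<\underline\mu<\int_0^\infty\rho_I(a)\,da$, and let $(\rho_w,w)$ be the solution on $(0,\bar T)$ of the simple cut-off problem (C) of the context with cut-off value $\underline\mu$; write $\mu_{0,w}(t)=\int_0^\infty\rho_w(t,a)\,da$. Let $\gamma_2>0$ be a constant such that $$\int_0^\infty \zeta(w(t,a))\,|w(t,a)|\,\rho_w(t,a)\,da\le \frac{\gamma_2}{\underline\mu}\qquad\text{for all } t\in[0,\bar T],$$ and set $$\gamma_3:=\zeta_{\rm Lip}\left(\varepsilon\|\partial_t f\|_{L^\infty(0,\bar T)}+\gamma_2\right),\qquad \bar\zeta:=\zeta(0)+\frac{\int_0^\infty\zeta(v_I(a))\rho_I(a)\,da}{\int_0^\infty\rho_I(a)\,da},\qquad T:=\frac{\varepsilon}{\gamma_3}\left(\beta_{\min}\,\underline\mu-(\beta_{\min}+\bar\zeta)\,\underline\mu^2\right).$$ Then $\mu_{0,w}(t)>\underline\mu$ for every $t\in(0,\min(T,\bar T))$ (an empty assertion if $T\le 0$). Consequently, on this time interval $(\rho_w,w)$ is also the unique local solution of the fully coupled system (S) of the context.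
   Context: $\mathbb{R}_+=[0,\infty)$; $\varepsilon>0$ is fixed; $\omega(a)=1/(1+a)$. For $T>0$, $X_T$ is the set of $u\in L^\infty_{loc}((0,T)\times\mathbb{R}_+)$ with $\|u\|_{X_T}:=\sup_{t\in(0,T)}\|u(t,\cdot)\,\omega\|_{L^\infty(\mathbb{R}_+)}<\infty$; $L^\infty(\mathbb{R}_+,\omega)$ is the set of $v$ with $v\omega\in L^\infty(\mathbb{R}_+)$. (A1) $\zeta:\mathbb{R}\to\mathbb{R}$ is Lipschitz, $\zeta(u)\ge\zeta_{\min}>0$ and $|\zeta'(u)|\le\zeta_{\rm Lip}$ for all $u$, with a constant $\zeta_{\rm Lip}>0$; $f$ is a real-valued Lipschitz function of time. (A2) $\rho_I\in L^\infty(\mathbb{R}_+)$, $\rho_I\ge0$ a.e., $0<\int_0^\infty\rho_I\,da<1$, and $0<\int_0^\infty a^p\rho_I(a)\,da<\infty$ for $p=1,2$. (A3) $\beta$ is a continuous function of $t\ge 0$ with $0<\beta_{\min}\le\beta(t)\le\beta_{\max}$. For a pair $(\rho,w)$ write $\mu_0(t)=\int_0^\infty\rho(t,a)\,da$. Given a function $g(t)$ (possibly depending on $(\rho,w)$), consider $$\varepsilon\partial_t\rho+\partial_a\rho+\zeta(w)\rho=0,\quad \rho(t,0)=\beta(t)(1-\mu_0(t)),\quad \rho(0,a)=\rho_I(a),$$ $$\varepsilon\partial_t w+\partial_a w=g(t),\quad w(t,0)=0,\quad w(0,a)=v_I(a),\qquad t>0,\ a>0.$$ Solutions are understood in the sense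 of characteristics: with $z(t,a)=\zeta(w(t,a))$, $\rho(t,a)=\beta(t-\varepsilon a)(1-\mu_0(t-\varepsilon a))\exp(-\int_0^a z(t-\varepsilon(a-s),s)\,ds)$ if $a<t/\varepsilon$, $\rho(t,a)=\rho_I(a-t/\varepsilon)\exp(-\frac1\varepsilon\int_0^t z(s,a+(s-t)/\varepsilon)\,ds)$ if $a\ge t/\varepsilon$; $w(t,a)=\frac1\varepsilon\int_{t-\varepsilon a}^t g(s)\,ds$ if $a<t/\varepsilon$, $w(t,a)=v_I(a-t/\varepsilon)+\frac1\varepsilon\int_0^t g(s)\,ds$ if $a\ge t/\varepsilon$. Solutions on $(0,T)$ are sought with $\rho\in C([0,T];L^1(\mathbb{R}_+))$, $w\in X_T$. Simple cut-off problem (C): $g=\frac{1}{\max(\mu_0(t),\underline\mu)}\left(\varepsilon\partial_t f+\int_0^\infty\zeta(w)\,w\,\rho\,da\right)$. Fully coupled system (S): $g=\frac{1}{\mu_0(t)}\left(\varepsilon\partial_t f+\int_0^\infty\zeta(w)\,w\,\rho\,da\right)$. *)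

theory Defs
  imports "HOL-Probability.Essential_Supremum"
begin

text \<open>Elements of the spaces \<open>L\<^sup>1\<close> and \<open>L\<^sup>\<infinity>\<close> are represented by Borel functions with respect to
  Lebesgue measure (every class has such a representative); identities between them hold almost
  everywhere. A function of time and age is curried, time first.\<close>

abbreviation borel_on :: "'a::euclidean_space set \<Rightarrow> 'a measure"
  where "borel_on A \<equiv> restrict_space lborel A"

abbreviation half_line :: "real measure"
  where "half_line \<equiv> borel_on {0..}"

definition Linf_norm :: "'a measure \<Rightarrow> ('a \<Rightarrow> real) \<Rightarrow> ereal"
  where "Linf_norm M v = esssup M (\<lambda>x. ereal \<bar>v x\<bar>)"

definition Linf :: "'a measure \<Rightarrow> ('a \<Rightarrow> real) set"
  where "Linf M = {v \<in> borel_measurable M. Linf_norm M v < \<infinity>}"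

definition Linf_loc :: "'a::euclidean_space set \<Rightarrow> ('a \<Rightarrow> real) set"
  where "Linf_loc A = {v \<in> borel_measurable (borel_on A).
    \<forall>K. compact K \<and> K \<subseteq> A \<longrightarrow> v \<in> Linf (borel_on K)}"

definition weight :: "real \<Rightarrow> real"  (\<open>\<omega>\<close>)
  where "\<omega> a = 1 / (1 + a)"

definition Linf_weighted :: "(real \<Rightarrow> real) set"
  where "Linf_weighted = {v. (\<lambda>a. v a * \<omega> a) \<in> Linf half_line}"

definition X_norm :: "real \<Rightarrow> (real \<Rightarrow> real \<Rightarrow> real) \<Rightarrow> ereal"
  where "X_norm T u = (SUP t\<in>{0<..<T}. Linf_norm half_line (\<lambda>a. u t a * \<omega> a))"

definition X_space :: "real \<Rightarrow> (real \<Rightarrow> real \<Rightarrow> real) set"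
  where "X_space T = {u. case_prod u \<in> Linf_loc ({0<..<T} \<times> {0..}) \<and> X_norm T u < \<infinity>}"

text \<open>The space \<open>C([0,T]; L\<^sup>1(\<real>\<^sub>+))\<close>.\<close>

definition C_L1 :: "real \<Rightarrow> (real \<Rightarrow> real \<Rightarrow> real) set"
  where "C_L1 T = {\<rho>. (\<forall>t\<in>{0..T}. integrable half_line (\<rho> t)) \<and>
    (\<forall>t\<in>{0..T}. ((\<lambda>s. \<integral>a. \<bar>\<rho> s a - \<rho> t a\<bar> \<partial>half_line) \<longlongrightarrow> 0) (at t within {0..T}))}"

text \<open>The off-rate \<open>\<zeta>\<close> is only assumed to be Lipschitz, so its derivative is
  taken in the almost everywhere sense.\<close>

definition assumption_A1 :: "(real \<Rightarrow> real) \<Rightarrow> real \<Rightarrow> real \<Rightarrow> bool"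
  where "assumption_A1 \<zeta> \<zeta>min \<zeta>Lip \<longleftrightarrow>
    (\<exists>L. L-lipschitz_on UNIV \<zeta>) \<and>
    0 < \<zeta>min \<and> (\<forall>u. \<zeta>min \<le> \<zeta> u) \<and>
    0 < \<zeta>Lip \<and> (AE u in lborel. \<zeta> differentiable (at u) \<and> \<bar>deriv \<zeta> u\<bar> \<le> \<zeta>Lip)"

definition assumption_A2 :: "(real \<Rightarrow> real) \<Rightarrow> bool"
  where "assumption_A2 \<rho>I \<longleftrightarrow>
    \<rho>I \<in> Linf half_line \<and> (AE a in half_line. 0 \<le> \<rho>I a) \<and>
    integrable half_line \<rho>I \<and>
    0 < (\<integral>a. \<rho>I a \<partial>half_line) \<and> (\<integral>a. \<rho>I a \<partial>half_line) < 1 \<and>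
    (\<forall>p\<in>{1, 2::nat}. integrable half_line (\<lambda>a. a ^ p * \<rho>I a) \<and>
      0 < (\<integral>a. a ^ p * \<rho>I a \<partial>half_line))"

definition assumption_A3 :: "(real \<Rightarrow> real) \<Rightarrow> real \<Rightarrow> real \<Rightarrow> bool"
  where "assumption_A3 \<beta> \<beta>min \<beta>max \<longleftrightarrow>
    continuous_on {0..} \<beta> \<and> 0 < \<beta>min \<and> (\<forall>t\<ge>0. \<beta>min \<le> \<beta> t \<and> \<beta> t \<le> \<beta>max)"

definition mu0 :: "(real \<Rightarrow> real \<Rightarrow> real) \<Rightarrow> real \<Rightarrow> real"
  where "mu0 \<rho> t = (\<integral>a. \<rho> t a \<partial>half_line)"

text \<open>Solutions on \<open>(0,T)\<close> in the sense of characteristics, for a given right-hand side \<open>g\<close>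
  of the \<open>w\<close>-equation. The integrability of \<open>g\<close> makes the formula for \<open>w\<close> meaningful.\<close>

definition characteristic_solution ::
    "real \<Rightarrow> (real \<Rightarrow> real) \<Rightarrow> (real \<Rightarrow> real) \<Rightarrow> (real \<Rightarrow> real) \<Rightarrow> (real \<Rightarrow> real) \<Rightarrow> real \<Rightarrow>
     (real \<Rightarrow> real) \<Rightarrow> (real \<Rightarrow> real \<Rightarrow> real) \<Rightarrow> (real \<Rightarrow> real \<Rightarrow> real) \<Rightarrow> bool"
  where "characteristic_solution \<epsilon> \<zeta> \<beta> \<rho>I vI T g \<rho> w \<longleftrightarrow>
    \<rho> \<in> C_L1 T \<and> w \<in> X_space T \<and> integrable (borel_on {0<..<T}) g \<and>
    (\<forall>t\<in>{0..T}. AE a in half_line.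
      \<rho> t a =
        (if a < t / \<epsilon>
         then \<beta> (t - \<epsilon> * a) * (1 - mu0 \<rho> (t - \<epsilon> * a)) *
              exp (- (LBINT s:{0..a}. \<zeta> (w (t - \<epsilon> * (a - s)) s)))
         else \<rho>I (a - t / \<epsilon>) *
              exp (- (1 / \<epsilon> * (LBINT s:{0..t}. \<zeta> (w s (a + (s - t) / \<epsilon>)))))) \<and>
      w t a =
        (if a < t / \<epsilon>
         then 1 / \<epsilon> * (LBINT s:{t - \<epsilon> * a..t}. g s)
         else vI (a - t / \<epsilon>) + 1 / \<epsilon> * (LBINT s:{0..t}. g s)))"

text \<open>For Lipschitz \<open>f\<close>, the value of \<open>deriv f\<close> is unspecified only on the null set where \<open>f\<close> is
  not differentiable; it enters only through integrals and essential suprema.\<close>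

definition coupling_force ::
    "real \<Rightarrow> (real \<Rightarrow> real) \<Rightarrow> (real \<Rightarrow> real) \<Rightarrow> (real \<Rightarrow> real \<Rightarrow> real) \<Rightarrow> (real \<Rightarrow> real \<Rightarrow> real) \<Rightarrow>
     real \<Rightarrow> real"
  where "coupling_force \<epsilon> \<zeta> f \<rho> w t =
    \<epsilon> * deriv f t + (\<integral>a. \<zeta> (w t a) * w t a * \<rho> t a \<partial>half_line)"

text \<open>In both problems the age integral in the coupling term is required to
  converge, and in the fully coupled problem the denominator must not vanish, so that the
  conventions for divergent integrals and for division by zero play no role.\<close>

definition solves_cutoff ::
    "real \<Rightarrow> (real \<Rightarrow> real) \<Rightarrow> (real \<Rightarrow> real) \<Rightarrow> (real \<Rightarrow> real) \<Rightarrow> (real \<Rightarrow> real) \<Rightarrow> (real \<Rightarrow> real) \<Rightarrow>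
     real \<Rightarrow> real \<Rightarrow> (real \<Rightarrow> real \<Rightarrow> real) \<Rightarrow> (real \<Rightarrow> real \<Rightarrow> real) \<Rightarrow> bool"
  where "solves_cutoff \<epsilon> \<zeta> \<beta> f \<rho>I vI \<mu>low T \<rho> w \<longleftrightarrow>
    (\<forall>t\<in>{0..T}. integrable half_line (\<lambda>a. \<zeta> (w t a) * w t a * \<rho> t a)) \<and>
    characteristic_solution \<epsilon> \<zeta> \<beta> \<rho>I vI T
      (\<lambda>t. 1 / max (mu0 \<rho> t) \<mu>low * coupling_force \<epsilon> \<zeta> f \<rho> w t) \<rho> w"

definition solves_coupled ::
    "real \<Rightarrow> (real \<Rightarrow> real) \<Rightarrow> (real \<Rightarrow> real) \<Rightarrow> (real \<Rightarrow> real) \<Rightarrow> (real \<Rightarrow> real) \<Rightarrow> (real \<Rightarrow> real) \<Rightarrow>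
     real \<Rightarrow> (real \<Rightarrow> real \<Rightarrow> real) \<Rightarrow> (real \<Rightarrow> real \<Rightarrow> real) \<Rightarrow> bool"
  where "solves_coupled \<epsilon> \<zeta> \<beta> f \<rho>I vI T \<rho> w \<longleftrightarrow>
    (\<forall>t\<in>{0..T}. integrable half_line (\<lambda>a. \<zeta> (w t a) * w t a * \<rho> t a)) \<and>
    (\<forall>t\<in>{0<..<T}. mu0 \<rho> t \<noteq> 0) \<and>
    characteristic_solution \<epsilon> \<zeta> \<beta> \<rho>I vI T
      (\<lambda>t. 1 / mu0 \<rho> t * coupling_force \<epsilon> \<zeta> f \<rho> w t) \<rho> w"

definition unique_solution_coupled ::
    "real \<Rightarrow> (real \<Rightarrow> real) \<Rightarrow> (real \<Rightarrow> real) \<Rightarrow> (real \<Rightarrow> real) \<Rightarrow> (real \<Rightarrow> real) \<Rightarrow> (real \<Rightarrow> real) \<Rightarrow>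
     real \<Rightarrow> (real \<Rightarrow> real \<Rightarrow> real) \<Rightarrow> (real \<Rightarrow> real \<Rightarrow> real) \<Rightarrow> bool"
  where "unique_solution_coupled \<epsilon> \<zeta> \<beta> f \<rho>I vI T \<rho> w \<longleftrightarrow>
    solves_coupled \<epsilon> \<zeta> \<beta> f \<rho>I vI T \<rho> w \<and>
    (\<forall>\<rho>' w'. solves_coupled \<epsilon> \<zeta> \<beta> f \<rho>I vI T \<rho>' w' \<longrightarrow>
      (\<forall>t\<in>{0..T}. AE a in half_line. \<rho>' t a = \<rho> t a \<and> w' t a = w t a))"

end

theory Submission
  imports Defs
begin

text \<open>Along the characteristic with label \<open>\<tau> = t - \<epsilon> a\<close> the elongation is \<open>w = H(\<tau>) + G(t)\<close>, where
  \<open>G(t) = (1/\<epsilon>) \<integral>\<^sub>0\<^sup>t g\<close>; the density \<open>\<rho>\<close> is a label density times a survival probability, so everything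
  is expressed through integrals over the labels \<open>\<tau> \<le> t\<close>.

  Mass bound. The cut-off gives \<open>|g| \<le> \<gamma>\<^sub>3 / (\<zeta>Lip \<mu>\<^sup>2)\<close>, so the rate \<open>\<zeta>(w)\<close> drifts along characteristics at
  speed at most \<open>K = \<gamma>\<^sub>3 / (\<epsilon> \<mu>\<^sup>2)\<close>. Fast-detaching initial bonds disappear first, hence the average rate
  \<open>\<integral> \<zeta>(w) \<rho> / \<mu>\<^sub>0\<close> is at most \<open>\<zeta>bar + K t\<close>. At a first time with \<open>\<mu>\<^sub>0 = \<mu>\<close> the balance
  \<open>\<epsilon> \<mu>\<^sub>0' = \<beta> (1 - \<mu>\<^sub>0) - \<integral> \<zeta>(w) \<rho>\<close> would still be positive as long as \<open>t < T\<close>, a contradiction.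

  Uniqueness. If \<open>|G - G'|\<close> and \<open>|\<mu>\<^sub>0 - \<mu>\<^sub>0'|\<close> are at most \<open>N exp(k t)\<close>, then they are at most
  \<open>(c/k) N exp(k t)\<close> with \<open>c\<close> independent of \<open>k\<close>; two moments of \<open>\<rho>\<^sub>I\<close> are needed because
  \<open>\<zeta>(w) w\<close> grows quadratically in the age.\<close>

section \<open>Real analysis\<close>

text \<open>Labels freeze the transport: in the age variable the population moves, while for a fixed
  label only the survival factor and the common shift \<open>G\<close> depend on time. The obstacle
  is that the formulas hold at each time for almost every age, whereas a survival factor needs
  \<open>w\<close> along a whole characteristic; Fubini bridges the two.

  Only continuity of the mass in time is used, so the balance is never differentiated: it is
  replaced by inequalities over one short time step that ends at a first crossing.

  The horizon is the balance condition rewritten: \<open>(\<zeta>bar + K * t) * \<mu>low <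
  \<beta>min * (1 - \<mu>low)\<close>, multiplied by \<mu>low, says exactly t < T, because
  \<open>K * \<mu>low\<^sup>2 = \<gamma>3 / \<epsilon>\<close>.\<close>

lemma set_integrable_const_Icc: "set_integrable lborel {a..b::real} (\<lambda>_. c :: real)"
  unfolding set_integrable_def
  by (simp, intro impI disjI2 integrable_real_indicator) (auto simp: emeasure_lborel_Icc_eq)

text \<open>Turns the almost everywhere bound of (A1) into the Lipschitz constant \<zeta>Lip that
  enters \<gamma>3. The difference quotients \<open>F n\<close> of \<open>h\<close> are derivatives
  of the difference quotients \<open>Q n\<close> of a primitive \<open>P\<close>, so their integrals
  tend to \<open>h b - h a\<close>; dominated convergence with bound \<open>L\<close> passes to the
  limit in the integrals of their absolute values.\<close>

lemma lipschitz_on_AE_deriv_bound: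
  fixes h :: "real \<Rightarrow> real"
  assumes lip: "L-lipschitz_on UNIV h" and "0 \<le> K"
    and ae: "AE u in lborel. h differentiable (at u) \<and> \<bar>deriv h u\<bar> \<le> K"
  shows "K-lipschitz_on UNIV h"
proof -
  have cont: "continuous_on A h" for A
    using lipschitz_on_continuous_on[OF lip] continuous_on_subset by blast
  have Lnn: "0 \<le> L" using lip by (rule lipschitz_on_nonneg)
  have main: "\<bar>h b - h a\<bar> \<le> K * (b - a)" if "a \<le> b" for a b
  proof -
    \<comment> \<open>The margins keep all of \<open>{a..b+1}\<close> interior, so that
      \<open>P\<close> has two-sided derivatives at \<open>x\<close> and at
      \<open>x + d n\<close>.\<close>
    obtain P where P: "\<And>x. x \<in> {a-1..b+2} \<Longrightarrow> (P has_vector_derivative h x) (at x within {a-1..b+2})"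
      using antiderivative_continuous[OF cont] by metis
    have P': "(P has_real_derivative h x) (at x)" if "x \<in> {a..b+1}" for x
    proof -
      have "at x within {a-1..b+2} = at x"
        by (rule at_within_interior) (use that in auto)
      then show ?thesis
        using P[of x] that by (auto simp: has_real_derivative_iff_has_vector_derivative)
    qed
    define d :: "nat \<Rightarrow> real" where "d n = inverse (real (Suc n))" for n
    have d: "0 < d n" "d n \<le> 1" for n
      by (auto simp: d_def field_simps)
    have d0: "d \<longlonglongrightarrow> 0"
      unfolding d_def by (rule LIMSEQ_inverse_real_of_nat)
    have quot: "(\<lambda>n. (p (x + d n) - p x) / d n) \<longlonglongrightarrow> D"
      if "(p has_real_derivative D) (at x)" for p :: "real \<Rightarrow> real" and x D
    proof -
      have "(\<lambda>e. (p (x + e) - p x) / e) \<midarrow>0\<rightarrow> D"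
        using that by (simp add: DERIV_def)
      moreover have "filterlim d (at 0) sequentially"
        using d0 d by (auto simp: filterlim_at intro!: always_eventually) (metis less_irrefl)
      ultimately show ?thesis
        by (rule filterlim_compose)
    qed
    define F where "F n x = (h (x + d n) - h x) / d n" for n x
    define Q where "Q n x = (P (x + d n) - P x) / d n" for n x
    have "(F n has_integral Q n b - Q n a) {a..b}" for n
    proof (rule fundamental_theorem_of_calculus[OF that])
      fix x assume x: "x \<in> {a..b}"
      have "((\<lambda>x. P (x + d n)) has_real_derivative h (x + d n)) (at x)"
        using DERIV_shift[of P "h (x + d n)" x "d n"] P'[of "x + d n"] x d[of n] by auto
      then have "(Q n has_real_derivative F n x) (at x)"
        unfolding Q_def F_def using P'[of x] x d[of n]
        by (auto intro!: derivative_eq_intros)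
      then show "(Q n has_vector_derivative F n x) (at x within {a..b})"
        by (simp add: has_real_derivative_iff_has_vector_derivative has_vector_derivative_at_within)
    qed
    moreover have Fcont: "continuous_on UNIV (F n)" for n
      unfolding F_def using d[of n]
      by (intro continuous_intros continuous_on_compose2[OF cont[of UNIV]]) auto
    have Fint: "set_integrable lborel {a..b} (F n)" for n
      unfolding set_integrable_def
      by (rule borel_integrable_compact) (auto intro: continuous_on_subset[OF Fcont])
    ultimately have I: "(LBINT x:{a..b}. F n x) = Q n b - Q n a" for n
      using set_borel_integral_eq_integral[OF Fint] by (metis integral_unique)
    have "(\<lambda>n. Q n b - Q n a) \<longlonglongrightarrow> h b - h a"
      unfolding Q_def by (intro tendsto_diff quot P') (use that in auto)
    moreover have "norm (Q n b - Q n a) \<le> (LBINT x:{a..b}. \<bar>F n x\<bar>)" for n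
      unfolding I[symmetric] set_lebesgue_integral_def
      using integral_norm_bound[of lborel "\<lambda>x. indicator {a..b} x *\<^sub>R F n x"]
      by (simp add: abs_mult)
    moreover define D where "D x = lim (\<lambda>n. F n x)" for x
    have Fm [measurable]: "F n \<in> borel_measurable borel" for n
      by (rule borel_measurable_continuous_onI[OF Fcont])
    have Dm [measurable]: "D \<in> borel_measurable borel"
      unfolding D_def by measurable
    have FD: "AE x in lborel. (\<lambda>n. F n x) \<longlonglongrightarrow> D x \<and> \<bar>D x\<bar> \<le> K"
      using ae
    proof eventually_elim
      case (elim x)
      then have "(h has_real_derivative deriv h x) (at x)"
        using DERIV_deriv_iff_real_differentiable by blast
      then have "(\<lambda>n. F n x) \<longlonglongrightarrow> deriv h x"
        unfolding F_def by (rule quot)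
      then show ?case
        using elim by (auto simp: D_def limI)
    qed
    have bint: "integrable lborel (\<lambda>x. indicator {a..b} x * c)" for c :: real
      using set_integrable_const_Icc[of a b c] by (simp add: set_integrable_def)
    have "(\<lambda>n. LBINT x:{a..b}. \<bar>F n x\<bar>) \<longlonglongrightarrow> (LBINT x:{a..b}. \<bar>D x\<bar>)"
      unfolding set_lebesgue_integral_def
    proof (rule integral_dominated_convergence[where w="\<lambda>x. indicator {a..b} x * L"])
      show "AE x in lborel. (\<lambda>n. indicator {a..b} x *\<^sub>R \<bar>F n x\<bar>) \<longlonglongrightarrow> indicator {a..b} x *\<^sub>R \<bar>D x\<bar>"
        using FD by eventually_elim (auto intro!: tendsto_intros)
      have "\<bar>F n x\<bar> \<le> L" for n x
        using lipschitz_onD[OF lip, of "x + d n" x] d[of n]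
        by (auto simp: F_def dist_real_def field_simps)
      then show "AE x in lborel. norm (indicator {a..b} x *\<^sub>R \<bar>F n x\<bar>) \<le> indicator {a..b} x * L" for n
        by (auto simp: indicator_def)
    qed (use bint in measurable)
    ultimately have "\<bar>h b - h a\<bar> \<le> (LBINT x:{a..b}. \<bar>D x\<bar>)"
      by (intro LIMSEQ_le[OF tendsto_rabs]) auto
    also have "\<dots> \<le> (\<integral>x. indicator {a..b} x * K \<partial>lborel)"
      unfolding set_lebesgue_integral_def
    proof (rule integral_mono_AE)
      show le: "AE x in lborel. indicator {a..b} x *\<^sub>R \<bar>D x\<bar> \<le> indicator {a..b} x * K"
        using FD by eventually_elim (auto simp: indicator_def)
      show "integrable lborel (\<lambda>x. indicator {a..b} x *\<^sub>R \<bar>D x\<bar>)"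
      proof (rule Bochner_Integration.integrable_bound[OF bint[of K]])
        show "AE x in lborel. norm (indicator {a..b} x *\<^sub>R \<bar>D x\<bar>) \<le> norm (indicator {a..b} x * K)"
          using FD by eventually_elim (auto simp: indicator_def)
      qed measurable
    qed (rule bint)
    also have "\<dots> = K * (b - a)"
      using that by simp
    finally show ?thesis .
  qed
  show ?thesis
  proof (rule lipschitz_onI)
    show "dist (h x) (h y) \<le> K * dist x y" for x y
      using main[of x y] main[of y x] by (cases "x \<le> y") (auto simp: dist_real_def)
  qed fact
qed

lemma lipschitz_on_bounded_deriv:
  fixes f :: "real \<Rightarrow> real"
  assumes lip: "L-lipschitz_on S f" and "open S"
  shows "\<exists>B. \<forall>t\<in>S. \<bar>deriv f t\<bar> \<le> B"
proof -
  txt \<open>Where \<open>f\<close> is not differentiable, \<open>deriv f\<close> takes one and the same unspecified value.\<close>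
  define c where "c = (SOME D::real. False)"
  have "\<bar>deriv f t\<bar> \<le> max L \<bar>c\<bar>" if t: "t \<in> S" for t
  proof (cases "\<exists>D. (f has_real_derivative D) (at t)")
    case False
    then have "deriv f t = c"
      unfolding deriv_def c_def by simp
    then show ?thesis by simp
  next
    case True
    then have D: "(f has_real_derivative deriv f t) (at t)"
      using DERIV_imp_deriv by blast
    have "((\<lambda>y. \<bar>(f y - f t) / (y - t)\<bar>) \<longlongrightarrow> \<bar>deriv f t\<bar>) (at t)"
      using D by (intro tendsto_rabs) (simp add: has_field_derivative_iff)
    moreover have "\<forall>\<^sub>F y in at t. \<bar>(f y - f t) / (y - t)\<bar> \<le> L"
    proof -
      have "\<forall>\<^sub>F y in at t. y \<in> S \<and> y \<noteq> t"
        using assms(2) t by (auto intro!: eventually_conj eventually_at_in_open' eventually_neq_at_within)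
      then show ?thesis
      proof eventually_elim
        case (elim y)
        then show ?case
          using lipschitz_onD[OF lip, of y t] t by (auto simp: dist_real_def field_simps)
      qed
    qed
    ultimately have "\<bar>deriv f t\<bar> \<le> L"
      by (rule tendsto_upperbound) simp
    then show ?thesis by simp
  qed
  then show ?thesis by blast
qed

text \<open>The bound \<open>B\<close> excludes the value infinity, which
  \<open>real_of_ereal\<close> would send to 0; positive measure keeps the essential supremum
  nonnegative.\<close>

lemma Linf_norm_bounded:
  assumes [measurable]: "v \<in> borel_measurable M" and B: "\<And>x. x \<in> space M \<Longrightarrow> \<bar>v x\<bar> \<le> B"
    and nz: "emeasure M (space M) \<noteq> 0"
  shows "AE x in M. \<bar>v x\<bar> \<le> real_of_ereal (Linf_norm M v)" "0 \<le> real_of_ereal (Linf_norm M v)"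
proof -
  have "0 = esssup M (\<lambda>x. 0::ereal)"
    using esssup_const[OF nz, of "0::ereal"] by simp
  also have "\<dots> \<le> Linf_norm M v"
    unfolding Linf_norm_def by (rule esssup_mono) auto
  finally have 0: "0 \<le> Linf_norm M v" .
  then show "0 \<le> real_of_ereal (Linf_norm M v)"
    by (rule real_of_ereal_pos)
  have "Linf_norm M v \<le> ereal B"
    unfolding Linf_norm_def by (rule esssup_I) (auto simp: B)
  then obtain r where r: "Linf_norm M v = ereal r"
    using 0 by (cases "Linf_norm M v") auto
  show "AE x in M. \<bar>v x\<bar> \<le> real_of_ereal (Linf_norm M v)"
    using esssup_AE[of "\<lambda>x. ereal \<bar>v x\<bar>" M]
    unfolding Linf_norm_def[symmetric] r by simp
qed

lemma Linf_AE_bounded: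
  assumes "v \<in> Linf M"
  obtains B where "0 \<le> B" "AE x in M. \<bar>v x\<bar> \<le> B"
proof -
  have *: "Linf_norm M v < \<infinity>" using assms by (simp add: Linf_def)
  then obtain B where B: "0 \<le> B" "Linf_norm M v \<le> ereal B"
  proof (cases "Linf_norm M v")
    case (real r)
    then show thesis using that[of "max 0 r"] by simp
  qed (use * that[of 0] in simp_all)
  have "AE x in M. ereal \<bar>v x\<bar> \<le> Linf_norm M v"
    unfolding Linf_norm_def by (rule esssup_AE)
  then have "AE x in M. \<bar>v x\<bar> \<le> B"
  proof eventually_elim
    case (elim x)
    then show ?case using order_trans[OF elim B(2)] by simp
  qed
  with B(1) show thesis by (rule that)
qed

lemma first_crossing:
  fixes m :: "real \<Rightarrow> real"
  assumes cont: "continuous_on {0..t} m" and "c < m 0" and "0 \<le> t" "m t \<le> c"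
  obtains t0 where "0 < t0" "t0 \<le> t" "m t0 = c" "\<And>s. 0 \<le> s \<Longrightarrow> s < t0 \<Longrightarrow> c < m s"
proof -
  define S where "S = {s \<in> {0..t}. m s \<le> c}"
  have "closed S"
    unfolding S_def by (rule continuous_on_closed_Collect_le[OF cont]) auto
  moreover have "bounded S"
    by (rule bounded_subset[of "{0..t}"]) (auto simp: S_def)
  ultimately have "compact S"
    by (simp add: compact_eq_bounded_closed)
  moreover have "t \<in> S"
    using assms by (simp add: S_def)
  ultimately obtain t0 where t0: "t0 \<in> S" "\<And>s. s \<in> S \<Longrightarrow> t0 \<le> s"
    using compact_attains_inf[of S] by blast
  have pos: "0 < t0"
    using t0(1) assms(2) by (cases "t0 = 0") (auto simp: S_def)
  have before: "c < m s" if "0 \<le> s" "s < t0" for s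
  proof (rule ccontr)
    assume "\<not> c < m s"
    then have "s \<in> S" using that t0(1) unfolding S_def by auto
    then show False using t0(2)[of s] that by simp
  qed
  have "c \<le> m t0"
  proof (rule tendsto_lowerbound)
    have "(m \<longlongrightarrow> m t0) (at t0 within {0..t})"
      using cont t0(1) by (auto simp: continuous_on_def S_def)
    then have "(m \<longlongrightarrow> m t0) (at t0 within {0..t0})"
      by (rule tendsto_within_subset) (use t0(1) in \<open>auto simp: S_def\<close>)
    then show "(m \<longlongrightarrow> m t0) (at_left t0)"
      by (simp add: at_within_Icc_at_left[OF pos])
    show "\<forall>\<^sub>F s in at_left t0. c \<le> m s"
      using eventually_at_left_real[OF pos] by eventually_elim (auto intro!: less_imp_le before)
  qed simp
  then show thesis
    using that[OF pos _ _ before] t0(1) by (auto simp: S_def)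
qed

text \<open>Gronwall's argument in a weighted norm: the supremum \<open>N\<close> of
  \<open>\<delta> s * exp (- (k * s))\<close> is attained, and the hypothesis shrinks it by the
  factor \<open>C / k\<close>. As \<open>C\<close> does not depend on \<open>k\<close>, the choice
  \<open>k = 2 * \<bar>C\<bar> + 1\<close> makes this factor at most 1/2, so
  \<open>N = 0\<close>.\<close>

lemma exponential_contraction_zero:
  fixes \<delta> :: "real \<Rightarrow> real"
  assumes cont: "continuous_on {0..T} \<delta>" and nn: "\<And>t. t \<in> {0..T} \<Longrightarrow> 0 \<le> \<delta> t"
    and step: "\<And>k N t. 1 \<le> k \<Longrightarrow> 0 \<le> N \<Longrightarrow> (\<And>s. s \<in> {0..T} \<Longrightarrow> \<delta> s \<le> N * exp (k * s)) \<Longrightarrow>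
      t \<in> {0..T} \<Longrightarrow> \<delta> t \<le> C / k * N * exp (k * t)"
    and t: "t \<in> {0..T}"
  shows "\<delta> t = 0"
proof -
  define k where "k = 2 * \<bar>C\<bar> + 1"
  have k: "1 \<le> k" "C / k \<le> 1 / 2"
    by (auto simp: k_def field_simps)
  have "continuous_on {0..T} (\<lambda>s. \<delta> s * exp (- (k * s)))"
    by (intro continuous_intros cont)
  then obtain s where s: "s \<in> {0..T}"
    and max: "\<And>r. r \<in> {0..T} \<Longrightarrow> \<delta> r * exp (- (k * r)) \<le> \<delta> s * exp (- (k * s))"
    using continuous_attains_sup[of "{0..T}" "\<lambda>s. \<delta> s * exp (- (k * s))"] t by (auto simp del: mult_minus_right)
  define N where "N = \<delta> s * exp (- (k * s))"
  have N: "0 \<le> N" using nn[OF s] by (simp add: N_def)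
  have bound: "\<delta> r \<le> N * exp (k * r)" if "r \<in> {0..T}" for r
    using max[OF that] unfolding N_def[symmetric] by (simp add: exp_minus field_simps)
  have "\<delta> s \<le> C / k * N * exp (k * s)"
    by (rule step[OF k(1) N bound s])
  then have "N \<le> C / k * N"
    unfolding N_def by (simp add: exp_minus field_simps)
  also have "\<dots> \<le> 1 / 2 * N"
    using k(2) N by (rule mult_right_mono)
  finally have "N = 0" using N by simp
  then show ?thesis using bound[OF t] nn[OF t] by simp
qed

section \<open>Labels of characteristics\<close>

text \<open>\<open>P\<close> need not be measurable, so the transformation is applied to a Borel
  null set containing the exceptional set.\<close>

lemma AE_lborel_affine:
  fixes P :: "real \<Rightarrow> bool"
  assumes "c \<noteq> 0" "AE x in lborel. P x"
  shows "AE x in lborel. P (b + c * x)"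
proof -
  obtain N where N: "{x \<in> space lborel. \<not> P x} \<subseteq> N" "emeasure lborel N = 0" "N \<in> sets lborel"
    using AE_E[OF assms(2)] by blast
  have "AE x in lborel. x \<notin> N"
    using N(2,3) by (intro AE_not_in) (auto simp: null_sets_def)
  then have "AE x in lborel. b + c * x \<notin> N"
    using N(3) by (intro AE_borel_affine[OF assms(1)]) auto
  then show ?thesis
    by eventually_elim (use N(1) in auto)
qed

lemma AE_half_line_label:
  assumes e: "0 < \<epsilon>"
  shows "(AE a in half_line. P a) \<longleftrightarrow> (AE \<tau> in lborel. \<tau> \<le> t \<longrightarrow> P ((t - \<tau>) / \<epsilon>))"
proof
  assume "AE a in half_line. P a"
  then have "AE a in lborel. 0 \<le> a \<longrightarrow> P a"
    by (simp add: AE_restrict_space_iff)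
  from AE_lborel_affine[OF _ this, of "-1 / \<epsilon>" "t / \<epsilon>"] e
  show "AE \<tau> in lborel. \<tau> \<le> t \<longrightarrow> P ((t - \<tau>) / \<epsilon>)"
    by (simp add: diff_divide_distrib divide_le_cancel)
next
  assume "AE \<tau> in lborel. \<tau> \<le> t \<longrightarrow> P ((t - \<tau>) / \<epsilon>)"
  from AE_lborel_affine[OF _ this, of "- \<epsilon>" "t"] e
  show "AE a in half_line. P a"
    by (simp add: AE_restrict_space_iff zero_le_mult_iff)
qed

lemma integral_half_line_label:
  fixes F :: "real \<Rightarrow> real"
  assumes e: "0 < \<epsilon>"
  shows "integrable half_line F \<longleftrightarrow> set_integrable lborel {..t} (\<lambda>\<tau>. F ((t - \<tau>) / \<epsilon>))" (is ?I)
    and "(\<integral>a. F a \<partial>half_line) = 1 / \<epsilon> * (LBINT \<tau>:{..t}. F ((t - \<tau>) / \<epsilon>))"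
proof -
  have eq: "indicator {0..} (t / \<epsilon> + - 1 / \<epsilon> * \<tau>) *\<^sub>R F (t / \<epsilon> + - 1 / \<epsilon> * \<tau>)
      = indicator {..t} \<tau> *\<^sub>R F ((t - \<tau>) / \<epsilon>)" for \<tau>
    using e by (auto simp: indicator_def diff_divide_distrib) (simp_all add: field_simps)
  show ?I
    using lborel_integrable_real_affine_iff[of "-1 / \<epsilon>" "\<lambda>a. indicator {0..} a *\<^sub>R F a" "t / \<epsilon>"] e
    unfolding eq set_integrable_def by (simp add: integrable_restrict_space)
  show "(\<integral>a. F a \<partial>half_line) = 1 / \<epsilon> * (LBINT \<tau>:{..t}. F ((t - \<tau>) / \<epsilon>))"
    using lborel_integral_real_affine[of "-1 / \<epsilon>" "\<lambda>a. indicator {0..} a *\<^sub>R F a" "t / \<epsilon>"] e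
    unfolding eq set_lebesgue_integral_def by (simp add: integral_restrict_space)
qed

text \<open>Intersecting with \<open>{..t}\<close> gives a function on the whole line, constant
  before 0 and after \<open>T\<close>, so that continuity and boundedness need no restriction on
  \<open>t\<close>.\<close>

definition primitive :: "real \<Rightarrow> real \<Rightarrow> (real \<Rightarrow> real) \<Rightarrow> real \<Rightarrow> real"
  where "primitive \<epsilon> T g t = 1 / \<epsilon> * (LBINT s:{0<..<T} \<inter> {..t}. g s)"

section \<open>Continuity, bounds and increments of the primitive of the force\<close>

context
  fixes \<epsilon> T :: real and g :: "real \<Rightarrow> real"
  assumes e: "0 < \<epsilon>" and g: "integrable (borel_on {0<..<T}) g"
begin

lemma primitive_integrable: "set_integrable lborel {0<..<T} g"
  using g by (simp add: set_integrable_def integrable_restrict_space)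

lemma primitive_continuous: "continuous_on UNIV (primitive \<epsilon> T g)"
proof -
  have int: "integrable lborel (\<lambda>s. indicator {0<..<T} s * g s)"
    using primitive_integrable by (simp add: set_integrable_def)
  have "(\<lambda>n. primitive \<epsilon> T g (x n)) \<longlonglongrightarrow> primitive \<epsilon> T g t" if x: "x \<longlonglongrightarrow> t" for x t
    unfolding primitive_def set_lebesgue_integral_def
  proof (intro tendsto_mult_left integral_dominated_convergence)
    show "integrable lborel (\<lambda>s. \<bar>indicator {0<..<T} s * g s\<bar>)"
      using int by simp
    have eq: "indicator ({0<..<T} \<inter> {..t}) s *\<^sub>R g s = indicator {..t} s * (indicator {0<..<T} s * g s)" for s t
      by (auto simp: indicator_def)
    show "(\<lambda>s. indicator ({0<..<T} \<inter> {..t}) s *\<^sub>R g s) \<in> borel_measurable lborel" for t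
      unfolding eq using int by measurable
    show "(\<lambda>s. indicator ({0<..<T} \<inter> {..x n}) s *\<^sub>R g s) \<in> borel_measurable lborel" for n
      unfolding eq using int by measurable
    show "AE s in lborel. (\<lambda>n. indicator ({0<..<T} \<inter> {..x n}) s *\<^sub>R g s)
        \<longlonglongrightarrow> indicator ({0<..<T} \<inter> {..t}) s *\<^sub>R g s"
      using AE_lborel_singleton[of t]
    proof eventually_elim
      case (elim s)
      have "\<forall>\<^sub>F n in sequentially. (indicator {..x n} s :: real) = indicator {..t} s"
      proof (cases "s < t")
        case True
        from order_tendstoD(1)[OF x True] show ?thesis
          by eventually_elim (use True in auto)
      next
        case False
        with elim have "t < s" by simp
        from order_tendstoD(2)[OF x this] show ?thesis
          by eventually_elim (use \<open>t < s\<close> in auto)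
      qed
      then have "\<forall>\<^sub>F n in sequentially. indicator ({0<..<T} \<inter> {..x n}) s *\<^sub>R g s
          = indicator ({0<..<T} \<inter> {..t}) s *\<^sub>R g s"
        unfolding eq by eventually_elim simp
      then show ?case
        by (rule tendsto_eventually)
    qed
    show "AE s in lborel. norm (indicator ({0<..<T} \<inter> {..x n}) s *\<^sub>R g s) \<le> \<bar>indicator {0<..<T} s * g s\<bar>" for n
      by (auto simp: indicator_def)
  qed
  then show ?thesis
    by (auto simp: continuous_on_sequentially comp_def)
qed

lemma primitive_0: "primitive \<epsilon> T g 0 = 0"
proof -
  have "{0<..<T} \<inter> {..0} = {}" by auto
  then show ?thesis by (simp add: primitive_def set_lebesgue_integral_def)
qed

lemma primitive_bounded: "\<exists>B\<ge>0. \<forall>t. \<bar>primitive \<epsilon> T g t\<bar> \<le> B"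
proof -
  have "\<bar>primitive \<epsilon> T g t\<bar> \<le> 1 / \<epsilon> * (LBINT s:{0<..<T}. \<bar>g s\<bar>)" for t
  proof -
    have "set_integrable lborel ({0<..<T} \<inter> {..t}) g"
      by (rule set_integrable_subset[OF primitive_integrable]) auto
    then have "\<bar>LBINT s:{0<..<T} \<inter> {..t}. g s\<bar> \<le> (LBINT s:{0<..<T} \<inter> {..t}. \<bar>g s\<bar>)"
      unfolding set_lebesgue_integral_def set_integrable_def
      by (intro order_trans[OF integral_abs_bound]) (simp add: abs_mult)
    also have "\<dots> \<le> (LBINT s:{0<..<T}. \<bar>g s\<bar>)"
      unfolding set_lebesgue_integral_def
    proof (rule integral_mono)
      show "integrable lborel (\<lambda>s. indicator ({0<..<T} \<inter> {..t}) s *\<^sub>R \<bar>g s\<bar>)"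
        using set_integrable_abs[OF \<open>set_integrable lborel ({0<..<T} \<inter> {..t}) g\<close>]
        by (simp add: set_integrable_def)
      show "integrable lborel (\<lambda>s. indicator {0<..<T} s *\<^sub>R \<bar>g s\<bar>)"
        using set_integrable_abs[OF primitive_integrable] by (simp add: set_integrable_def)
    qed (auto simp: indicator_def)
    finally show ?thesis
      using e by (simp add: primitive_def abs_mult divide_right_mono)
  qed
  then show ?thesis
    by (intro exI[of _ "1 / \<epsilon> * (LBINT s:{0<..<T}. \<bar>g s\<bar>)"]) (use order_trans[OF abs_ge_zero] in blast)
qed

lemma primitive_diff:
  assumes "0 \<le> s" "s \<le> t" "t \<le> T"
  shows "primitive \<epsilon> T g t - primitive \<epsilon> T g s = 1 / \<epsilon> * (LBINT r:{s..t}. g r)"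
    and "set_integrable lborel {s..t} g"
proof -
  have I: "set_integrable lborel ({0<..<T} \<inter> A) g" if "A \<in> sets borel" for A
    by (rule set_integrable_subset[OF primitive_integrable]) (use that in auto)
  have eq: "{0<..<T} \<inter> {..t} = ({0<..<T} \<inter> {..s}) \<union> ({0<..<T} \<inter> {s<..t})"
    using assms by auto
  have "(LBINT s:{0<..<T} \<inter> {..t}. g s) = (LBINT s:{0<..<T} \<inter> {..s}. g s) + (LBINT s:{0<..<T} \<inter> {s<..t}. g s)"
    unfolding eq by (rule set_integral_Un) (auto intro!: I)
  \<comment> \<open>The two domains differ at most in \<open>s\<close> and, if \<open>t = T\<close>,
    in \<open>T\<close>.\<close>
  also have "(LBINT s:{0<..<T} \<inter> {s<..t}. g s) = (LBINT s:{s..t}. g s)"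
    by (rule set_integral_discrete_difference[where X="{s,t,T}"]) (use assms in auto)
  finally show "primitive \<epsilon> T g t - primitive \<epsilon> T g s = 1 / \<epsilon> * (LBINT r:{s..t}. g r)"
    by (simp add: primitive_def algebra_simps)
  have "set_integrable lborel ({0<..<T} \<inter> {s<..t}) g \<longleftrightarrow> set_integrable lborel {s..t} g"
    by (rule set_integrable_discrete_difference[where X="{s,t,T}"]) (use assms in auto)
  then show "set_integrable lborel {s..t} g"
    using I by auto
qed

lemma primitive_lipschitz:
  assumes M: "AE s in borel_on {0<..<T}. \<bar>g s\<bar> \<le> M" and st: "s \<in> {0..T}" "t \<in> {0..T}"
  shows "\<bar>primitive \<epsilon> T g t - primitive \<epsilon> T g s\<bar> \<le> M / \<epsilon> * \<bar>t - s\<bar>"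
proof -
  have *: "\<bar>primitive \<epsilon> T g t - primitive \<epsilon> T g s\<bar> \<le> M / \<epsilon> * (t - s)" if "0 \<le> s" "s \<le> t" "t \<le> T" for s t
  proof -
    note d = primitive_diff[OF that]
    have "\<bar>LBINT r:{s..t}. g r\<bar> \<le> (LBINT r:{s..t}. \<bar>g r\<bar>)"
      unfolding set_lebesgue_integral_def
      by (intro order_trans[OF integral_abs_bound]) (simp add: abs_mult)
    also have "\<dots> \<le> (LBINT r:{s..t}. M)"
    proof (rule set_integral_mono_AE)
      have "AE r in lborel. 0 < r \<and> r < T \<longrightarrow> \<bar>g r\<bar> \<le> M"
        using M by (simp add: AE_restrict_space_iff)
      then show "AE r\<in>{s..t} in lborel. \<bar>g r\<bar> \<le> M"
        using AE_lborel_singleton[of 0] AE_lborel_singleton[of T]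
        by eventually_elim (use that in auto)
      show "set_integrable lborel {s..t} (\<lambda>r. \<bar>g r\<bar>)"
        using d(2) by (rule set_integrable_abs)
    qed (rule set_integrable_const_Icc)
    also have "\<dots> = M * (t - s)"
      using that by (simp add: set_lebesgue_integral_def)
    finally show ?thesis
      using e by (simp add: d(1) abs_mult divide_right_mono)
  qed
  show ?thesis
    using *[of s t] *[of t s] st by (cases "s \<le> t") (auto simp: abs_minus_commute)
qed

end

text \<open>The formula for \<open>u\<close> fails at each time on a null set of labels that varies
  with the time, and the union of these sets need not be null. Fubini exchanges the quantifiers:
  along almost every label the formula holds at almost all times, which is all that an integral
  along the characteristic sees.\<close>

lemma along_characteristics:
  fixes u :: "real \<Rightarrow> real \<Rightarrow> real"
  assumes e: "0 < \<epsilon>"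
    and u: "case_prod u \<in> borel_measurable (borel_on ({0<..<T} \<times> {0..}))"
    and [measurable]: "H \<in> borel_measurable borel" "G \<in> borel_measurable borel"
    and eq: "\<And>t. t \<in> {0<..<T} \<Longrightarrow> AE \<tau> in lborel. \<tau> \<le> t \<longrightarrow> u t ((t - \<tau>) / \<epsilon>) = H \<tau> + G t"
  shows "AE \<tau> in lborel. AE r in lborel. max \<tau> 0 < r \<and> r < T \<longrightarrow> u r ((r - \<tau>) / \<epsilon>) = H \<tau> + G r"
proof -
  \<comment> \<open>Extension by 0 off the strip gives a function jointly measurable on the plane,
    as the exchange requires.\<close>
  define u0 where "u0 x = indicator ({0<..<T} \<times> {0..}) x * case_prod u x" for x
  have [measurable]: "u0 \<in> borel_measurable (borel \<Otimes>\<^sub>M borel)"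
    using u unfolding u0_def borel_prod
    by (subst (asm) borel_measurable_restrict_space_iff) (auto simp: mult.commute intro: borel_Times)
  define P where "P r \<tau> \<longleftrightarrow> 0 < r \<and> r < T \<and> \<tau> \<le> r \<longrightarrow> u0 (r, (r - \<tau>) / \<epsilon>) = H \<tau> + G r" for r \<tau>
  have "AE r in lborel. AE \<tau> in lborel. P r \<tau>"
  proof (rule AE_I2)
    fix r :: real
    show "AE \<tau> in lborel. P r \<tau>"
    proof (cases "r \<in> {0<..<T}")
      case True
      show ?thesis using eq[OF True]
        by eventually_elim (use e in \<open>auto simp: P_def u0_def\<close>)
    qed (auto simp: P_def)
  qed
  moreover have "{x \<in> space (lborel \<Otimes>\<^sub>M lborel). P (fst x) (snd x)} \<in> sets (lborel \<Otimes>\<^sub>M lborel)"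
    unfolding P_def by measurable
  ultimately have "AE \<tau> in lborel. AE r in lborel. P r \<tau>"
    using lborel_pair.AE_commute[of P] by simp
  then show ?thesis
    by eventually_elim (elim eventually_mono, use e in \<open>auto simp: P_def u0_def\<close>)
qed


text \<open>The characteristic through \<open>(t, a)\<close> carries the label \<open>\<tau> = t - \<epsilon> * a\<close>: for \<open>\<tau> > 0\<close> it is the
  birth time, for \<open>\<tau> \<le> 0\<close> the initial age is \<open>- \<tau> / \<epsilon>\<close>. With \<open>G\<close> the primitive of the force, a solution
  reads \<open>w = H \<tau> + G t\<close> and \<open>\<rho> = R \<tau> * survival \<tau> t\<close> for the offset \<open>H\<close> and density \<open>R\<close> below.\<close>

definition label_offset :: "real \<Rightarrow> real \<Rightarrow> (real \<Rightarrow> real) \<Rightarrow> (real \<Rightarrow> real) \<Rightarrow> real \<Rightarrow> real"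
  where "label_offset \<epsilon> T g vI \<tau> = (if 0 < \<tau> then - primitive \<epsilon> T g \<tau> else vI (- \<tau> / \<epsilon>))"

text \<open>The mass is controlled only on \<open>{0..T}\<close>; setting the births to 0 after
  \<open>T\<close> keeps the density measurable on the whole line.\<close>

definition label_density ::
    "real \<Rightarrow> real \<Rightarrow> (real \<Rightarrow> real) \<Rightarrow> (real \<Rightarrow> real) \<Rightarrow> (real \<Rightarrow> real) \<Rightarrow> real \<Rightarrow> real"
  where "label_density \<epsilon> T \<beta> \<rho>I m \<tau> =
    (if 0 < \<tau> then if \<tau> \<le> T then \<beta> \<tau> * (1 - m \<tau>) else 0 else \<rho>I (- \<tau> / \<epsilon>))"

definition survival ::
    "real \<Rightarrow> (real \<Rightarrow> real) \<Rightarrow> (real \<Rightarrow> real) \<Rightarrow> (real \<Rightarrow> real) \<Rightarrow> real \<Rightarrow> real \<Rightarrow> real"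
  where "survival \<epsilon> \<zeta> H G \<tau> t = exp (- (1 / \<epsilon> * (LBINT r:{max \<tau> 0..t}. \<zeta> (H \<tau> + G r))))"

section \<open>Continuity and measurability of the label data\<close>

lemma mu0_continuous_on:
  assumes "\<rho> \<in> C_L1 T"
  shows "continuous_on {0..T} (mu0 \<rho>)"
  unfolding continuous_on_def
proof
  fix t assume t: "t \<in> {0..T}"
  have int: "integrable half_line (\<rho> s)" if "s \<in> {0..T}" for s
    using assms that by (auto simp: C_L1_def)
  have "((\<lambda>s. \<integral>a. \<bar>\<rho> s a - \<rho> t a\<bar> \<partial>half_line) \<longlongrightarrow> 0) (at t within {0..T})"
    using assms t by (auto simp: C_L1_def)
  then have "((\<lambda>s. mu0 \<rho> s - mu0 \<rho> t) \<longlongrightarrow> 0) (at t within {0..T})"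
  proof (rule Lim_null_comparison[rotated])
    have "\<forall>\<^sub>F s in at t within {0..T}. s \<in> {0..T}"
      by (auto simp: eventually_at_topological)
    then show "\<forall>\<^sub>F s in at t within {0..T}. norm (mu0 \<rho> s - mu0 \<rho> t) \<le> (\<integral>a. \<bar>\<rho> s a - \<rho> t a\<bar> \<partial>half_line)"
    proof eventually_elim
      case (elim s)
      have "mu0 \<rho> s - mu0 \<rho> t = (\<integral>a. \<rho> s a - \<rho> t a \<partial>half_line)"
        unfolding mu0_def using int[OF elim] int[OF t] by simp
      then show ?case by simp
    qed
  qed
  then show "(mu0 \<rho> \<longlongrightarrow> mu0 \<rho> t) (at t within {0..T})"
    by (simp add: LIM_zero_iff)
qed

lemma borel_measurable_half_line_reflect:
  fixes v :: "real \<Rightarrow> real"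
  assumes e: "0 < \<epsilon>" and v: "v \<in> borel_measurable half_line"
  shows "(\<lambda>\<tau>. indicator {..0} \<tau> * v (- \<tau> / \<epsilon>)) \<in> borel_measurable borel"
proof -
  have [measurable]: "(\<lambda>a. indicator {0..} a * v a) \<in> borel_measurable borel"
    using v by (subst (asm) borel_measurable_restrict_space_iff) (auto simp: mult.commute)
  have "(\<lambda>\<tau>. indicator {0..} (- \<tau> / \<epsilon>) * v (- \<tau> / \<epsilon>)) \<in> borel_measurable borel"
    by (rule measurable_compose[of "\<lambda>\<tau>. - \<tau> / \<epsilon>" borel borel "\<lambda>a. indicator {0..} a * v a"]) auto
  also have "(\<lambda>\<tau>. indicator {0..} (- \<tau> / \<epsilon>) * v (- \<tau> / \<epsilon>)) = (\<lambda>\<tau>. indicator {..0} \<tau> * v (- \<tau> / \<epsilon>))"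
    using e by (auto simp: indicator_def divide_le_0_iff)
  finally show ?thesis .
qed

lemma Linf_weighted_growth:
  assumes "v \<in> Linf_weighted"
  shows "v \<in> borel_measurable half_line"
    and "\<exists>B\<ge>0. AE a in half_line. \<bar>v a\<bar> \<le> B * (1 + a)"
proof -
  have v: "(\<lambda>a. v a * \<omega> a) \<in> Linf half_line"
    using assms by (simp add: Linf_weighted_def)
  have "(\<lambda>a. (v a * \<omega> a) * (1 + a)) \<in> borel_measurable half_line"
  proof (rule borel_measurable_times)
    show "(\<lambda>a. v a * \<omega> a) \<in> borel_measurable half_line"
      using v by (simp add: Linf_def)
    show "(\<lambda>a. 1 + a) \<in> borel_measurable half_line"
      by (rule measurable_restrict_space1) simp
  qed
  also have "?this \<longleftrightarrow> v \<in> borel_measurable half_line"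
    by (rule measurable_cong) (auto simp: weight_def)
  finally show "v \<in> borel_measurable half_line" .
  obtain B where B: "0 \<le> B" "AE a in half_line. \<bar>v a * \<omega> a\<bar> \<le> B"
    using Linf_AE_bounded[OF v] by blast
  from B(2) have "AE a in half_line. \<bar>v a\<bar> \<le> B * (1 + a)"
    using AE_space
    by eventually_elim (auto simp: weight_def abs_mult field_simps)
  with B(1) show "\<exists>B\<ge>0. AE a in half_line. \<bar>v a\<bar> \<le> B * (1 + a)" by blast
qed

lemma label_offset_measurable:
  assumes "0 < \<epsilon>" "integrable (borel_on {0<..<T}) g" "vI \<in> borel_measurable half_line"
  shows "label_offset \<epsilon> T g vI \<in> borel_measurable borel"
proof -
  have [measurable]: "primitive \<epsilon> T g \<in> borel_measurable borel"
    using primitive_continuous[OF assms(1,2)] by (rule borel_measurable_continuous_onI)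
  have [measurable]: "(\<lambda>\<tau>. indicator {..0} \<tau> * vI (- \<tau> / \<epsilon>)) \<in> borel_measurable borel"
    by (rule borel_measurable_half_line_reflect) (use assms in auto)
  have "label_offset \<epsilon> T g vI = (\<lambda>\<tau>. indicator {0<..} \<tau> * (- primitive \<epsilon> T g \<tau>) + indicator {..0} \<tau> * vI (- \<tau> / \<epsilon>))"
    by (auto simp: label_offset_def fun_eq_iff)
  also have "\<dots> \<in> borel_measurable borel"
    by measurable
  finally show ?thesis .
qed

lemma label_density_measurable:
  assumes "0 < \<epsilon>" "\<rho>I \<in> borel_measurable half_line" "continuous_on {0..T} m" "continuous_on {0..} \<beta>"
  shows "label_density \<epsilon> T \<beta> \<rho>I m \<in> borel_measurable borel"
proof -
  have [measurable]: "(\<lambda>\<tau>. indicator {..0} \<tau> * \<rho>I (- \<tau> / \<epsilon>)) \<in> borel_measurable borel"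
    by (rule borel_measurable_half_line_reflect) (use assms in auto)
  have "continuous_on {0..T} (\<lambda>\<tau>. \<beta> \<tau> * (1 - m \<tau>))"
    by (intro continuous_intros assms(3) continuous_on_subset[OF assms(4)]) auto
  then have [measurable]: "(\<lambda>\<tau>. indicator {0..T} \<tau> *\<^sub>R (\<beta> \<tau> * (1 - m \<tau>))) \<in> borel_measurable borel"
    by (intro borel_measurable_continuous_on_indicator) auto
  have "label_density \<epsilon> T \<beta> \<rho>I m = (\<lambda>\<tau>. indicator {0<..} \<tau> * (indicator {0..T} \<tau> *\<^sub>R (\<beta> \<tau> * (1 - m \<tau>)))
      + indicator {..0} \<tau> * \<rho>I (- \<tau> / \<epsilon>))"
    by (auto simp: label_density_def fun_eq_iff)
  also have "\<dots> \<in> borel_measurable borel"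
    by measurable
  finally show ?thesis .
qed

text \<open>Both the measurability of \<open>w\<close> and its formula are available only at times
  strictly between 0 and \<open>T\<close>, so the endpoints are discarded first and \<open>w\<close>
  is extended by 0 to \<open>u\<close>; then the integrands agree almost everywhere.\<close>

lemma characteristic_exponent:
  fixes \<zeta> :: "real \<Rightarrow> real" and \<tau> h T t :: real
  assumes e: "0 < \<epsilon>" and \<zeta>: "continuous_on UNIV \<zeta>"
    and w: "case_prod w \<in> borel_measurable (borel_on ({0<..<T} \<times> {0..}))"
    and G [measurable]: "G \<in> borel_measurable borel"
    and ae: "AE r in lborel. max \<tau> 0 < r \<and> r < T \<longrightarrow> w r ((r - \<tau>) / \<epsilon>) = h + G r"
    and t: "t \<le> T"
  shows "(LBINT r:{max \<tau> 0..t}. \<zeta> (w r ((r - \<tau>) / \<epsilon>))) = (LBINT r:{max \<tau> 0..t}. \<zeta> (h + G r))"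
proof -
  have [measurable]: "\<zeta> \<in> borel_measurable borel"
    using \<zeta> by (rule borel_measurable_continuous_onI)
  have endpoints: "(LBINT r:{max \<tau> 0..t}. f r) = (LBINT r:{max \<tau> 0<..<t}. f r)" for f :: "real \<Rightarrow> real"
    by (rule set_integral_discrete_difference[where X="{max \<tau> 0, t}"]) auto
  define u where "u x = indicator ({0<..<T} \<times> {0..}) x * case_prod w x" for x
  have [measurable]: "u \<in> borel_measurable (borel \<Otimes>\<^sub>M borel)"
    using w unfolding u_def borel_prod
    by (subst (asm) borel_measurable_restrict_space_iff) (auto simp: mult.commute intro: borel_Times)
  have "indicator {max \<tau> 0<..<t} r *\<^sub>R \<zeta> (w r ((r - \<tau>) / \<epsilon>))
      = indicator {max \<tau> 0<..<t} r *\<^sub>R \<zeta> (u (r, (r - \<tau>) / \<epsilon>))" for r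
    using e t by (auto simp: u_def indicator_def)
  then have "(LBINT r:{max \<tau> 0<..<t}. \<zeta> (w r ((r - \<tau>) / \<epsilon>))) = (LBINT r:{max \<tau> 0<..<t}. \<zeta> (u (r, (r - \<tau>) / \<epsilon>)))"
    by (simp only: set_lebesgue_integral_def)
  also have "\<dots> = (LBINT r:{max \<tau> 0<..<t}. \<zeta> (h + G r))"
    unfolding set_lebesgue_integral_def
  proof (rule integral_cong_AE)
    show "AE r in lborel. indicator {max \<tau> 0<..<t} r *\<^sub>R \<zeta> (u (r, (r - \<tau>) / \<epsilon>))
        = indicator {max \<tau> 0<..<t} r *\<^sub>R \<zeta> (h + G r)"
      using ae by eventually_elim (use e t in \<open>auto simp: u_def indicator_def\<close>)
  qed measurable
  finally show ?thesis by (simp add: endpoints)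
qed

text \<open>Read at a single time, the definition already gives \<open>w\<close> as
  \<open>H \<tau> + G t\<close>, but \<rho> only with an exponent that contains \<open>w\<close>
  along the characteristic. Since the first formula holds at every time,
  \<open>along_characteristics\<close> permits its insertion into the exponent.\<close>

lemma characteristic_solution_label:
  fixes \<zeta> :: "real \<Rightarrow> real"
  assumes e: "0 < \<epsilon>" and \<zeta>: "continuous_on UNIV \<zeta>" and vI: "vI \<in> Linf_weighted"
    and sol: "characteristic_solution \<epsilon> \<zeta> \<beta> \<rho>I vI T g \<rho> w" and t: "t \<in> {0..T}"
  defines "G \<equiv> primitive \<epsilon> T g" and "H \<equiv> label_offset \<epsilon> T g vI"
    and "R \<equiv> label_density \<epsilon> T \<beta> \<rho>I (mu0 \<rho>)"
  shows "AE \<tau> in lborel. \<tau> \<le> t \<longrightarrow>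
    \<rho> t ((t - \<tau>) / \<epsilon>) = R \<tau> * survival \<epsilon> \<zeta> H G \<tau> t \<and> w t ((t - \<tau>) / \<epsilon>) = H \<tau> + G t"
proof -
  have g: "integrable (borel_on {0<..<T}) g"
    and w: "case_prod w \<in> borel_measurable (borel_on ({0<..<T} \<times> {0..}))"
    using sol by (auto simp: characteristic_solution_def X_space_def Linf_loc_def)
  have [measurable]: "G \<in> borel_measurable borel"
    unfolding G_def using primitive_continuous[OF e g] by (rule borel_measurable_continuous_onI)
  have [measurable]: "H \<in> borel_measurable borel"
    unfolding H_def by (rule label_offset_measurable[OF e g Linf_weighted_growth(1)[OF vI]])
  \<comment> \<open>The exponent in both cases of the definition; each becomes
    \<open>1 / \<epsilon>\<close> times the integral of the rate from \<open>max \<tau> 0\<close> to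
    \<open>t\<close>.\<close>
  define z where "z t a = (if a < t / \<epsilon> then LBINT s:{0..a}. \<zeta> (w (t - \<epsilon> * (a - s)) s)
     else 1 / \<epsilon> * (LBINT s:{0..t}. \<zeta> (w s (a + (s - t) / \<epsilon>))))" for t a
  have labels: "AE \<tau> in lborel. \<tau> \<le> t \<longrightarrow>
      \<rho> t ((t - \<tau>) / \<epsilon>) = R \<tau> * exp (- z t ((t - \<tau>) / \<epsilon>)) \<and> w t ((t - \<tau>) / \<epsilon>) = H \<tau> + G t"
    if t: "t \<in> {0..T}" for t
  proof -
    have "AE \<tau> in lborel. \<tau> \<le> t \<longrightarrow> (let a = (t - \<tau>) / \<epsilon> in
        \<rho> t a = (if a < t / \<epsilon> then \<beta> (t - \<epsilon> * a) * (1 - mu0 \<rho> (t - \<epsilon> * a)) * exp (- z t a)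
          else \<rho>I (a - t / \<epsilon>) * exp (- z t a)) \<and>
        w t a = (if a < t / \<epsilon> then 1 / \<epsilon> * (LBINT s:{t - \<epsilon> * a..t}. g s)
          else vI (a - t / \<epsilon>) + 1 / \<epsilon> * (LBINT s:{0..t}. g s)))"
    proof -
      have "AE a in half_line.
        \<rho> t a = (if a < t / \<epsilon> then \<beta> (t - \<epsilon> * a) * (1 - mu0 \<rho> (t - \<epsilon> * a)) * exp (- z t a)
          else \<rho>I (a - t / \<epsilon>) * exp (- z t a)) \<and>
        w t a = (if a < t / \<epsilon> then 1 / \<epsilon> * (LBINT s:{t - \<epsilon> * a..t}. g s)
          else vI (a - t / \<epsilon>) + 1 / \<epsilon> * (LBINT s:{0..t}. g s))"
        using sol t by (auto simp: characteristic_solution_def z_def cong: if_cong)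
      then show ?thesis
        unfolding Let_def by (subst (asm) AE_half_line_label[OF e, of _ t])
    qed
    then show ?thesis
    proof eventually_elim
      case (elim \<tau>)
      have a: "(t - \<tau>) / \<epsilon> < t / \<epsilon> \<longleftrightarrow> 0 < \<tau>" "t - \<epsilon> * ((t - \<tau>) / \<epsilon>) = \<tau>"
          "(t - \<tau>) / \<epsilon> - t / \<epsilon> = - \<tau> / \<epsilon>"
        using e by (auto simp: divide_less_cancel field_simps)
      have "1 / \<epsilon> * (LBINT s:{\<tau>..t}. g s) = G t - G \<tau>" if "0 < \<tau>" "\<tau> \<le> t"
        unfolding G_def using primitive_diff(1)[OF e g, of \<tau> t] that t by auto
      moreover have "1 / \<epsilon> * (LBINT s:{0..t}. g s) = G t"
        unfolding G_def using primitive_diff(1)[OF e g, of 0 t] t primitive_0[OF e g] by auto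
      ultimately show ?case
        using elim t unfolding Let_def a by (auto simp: R_def H_def label_density_def label_offset_def G_def)
    qed
  qed
  have "AE \<tau> in lborel. AE r in lborel. max \<tau> 0 < r \<and> r < T \<longrightarrow> w r ((r - \<tau>) / \<epsilon>) = H \<tau> + G r"
  proof (rule along_characteristics[OF e w])
    fix t assume "t \<in> {0<..<T}"
    then have "t \<in> {0..T}" by auto
    from labels[OF this] show "AE \<tau> in lborel. \<tau> \<le> t \<longrightarrow> w t ((t - \<tau>) / \<epsilon>) = H \<tau> + G t"
      by eventually_elim auto
  qed measurable
  then show ?thesis
    using labels[OF t]
  proof eventually_elim
    case (elim \<tau>)
    have "z t ((t - \<tau>) / \<epsilon>) = 1 / \<epsilon> * (LBINT r:{max \<tau> 0..t}. \<zeta> (H \<tau> + G r))" if "\<tau> \<le> t"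
    proof -
      have "z t ((t - \<tau>) / \<epsilon>) = 1 / \<epsilon> * (LBINT r:{max \<tau> 0..t}. \<zeta> (w r ((r - \<tau>) / \<epsilon>)))"
      proof (cases "0 < \<tau>")
        case True
        then have "(t - \<tau>) / \<epsilon> < t / \<epsilon>"
          using e by (simp add: divide_less_cancel)
        then have "z t ((t - \<tau>) / \<epsilon>) = (LBINT s:{0..(t - \<tau>) / \<epsilon>}. \<zeta> (w (\<tau> + \<epsilon> * s) s))"
        proof -
          have "t - \<epsilon> * ((t - \<tau>) / \<epsilon> - s) = \<tau> + \<epsilon> * s" for s
            using e by (simp add: field_simps)
          with \<open>(t - \<tau>) / \<epsilon> < t / \<epsilon>\<close> show ?thesis by (simp add: z_def)
        qed
        \<comment> \<open>Substitution \<open>s = (r - \<tau>) / \<epsilon>\<close>, from age to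
          time.\<close>
        also have "\<dots> = 1 / \<epsilon> * (LBINT r:{\<tau>..t}. \<zeta> (w r ((r - \<tau>) / \<epsilon>)))"
        proof -
          have "indicator {0..(t - \<tau>) / \<epsilon>} (- \<tau> / \<epsilon> + 1 / \<epsilon> * r) = (indicator {\<tau>..t} r :: real)" for r
            using e by (auto simp: indicator_def field_simps)
          moreover have "\<tau> + \<epsilon> * (r / \<epsilon> - \<tau> / \<epsilon>) = r" for r
            using e by (simp add: field_simps)
          ultimately show ?thesis
            using e lborel_integral_real_affine[of "1 / \<epsilon>" "\<lambda>s. indicator {0..(t - \<tau>) / \<epsilon>} s *\<^sub>R \<zeta> (w (\<tau> + \<epsilon> * s) s)" "- \<tau> / \<epsilon>"]
            by (simp add: set_lebesgue_integral_def distrib_left diff_divide_distrib)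
        qed
        finally show ?thesis using True by simp
      next
        case False
        then have "\<not> (t - \<tau>) / \<epsilon> < t / \<epsilon>" "max \<tau> 0 = 0"
          using e by (auto simp: divide_less_cancel)
        then show ?thesis
          by (simp add: z_def add_divide_distrib[symmetric])
      qed
      also have "(LBINT r:{max \<tau> 0..t}. \<zeta> (w r ((r - \<tau>) / \<epsilon>))) = (LBINT r:{max \<tau> 0..t}. \<zeta> (H \<tau> + G r))"
        by (rule characteristic_exponent[OF e \<zeta> w _ elim(1)]) (use t in auto)
      finally show ?thesis .
    qed
    then show ?case using elim(2) by (simp add: survival_def)
  qed
qed

section \<open>Lower bound for the mass\<close>

lemma set_integral_Icc_le:
  fixes f :: "real \<Rightarrow> real"
  assumes "set_integrable lborel {a..b} f" "a \<le> b" "\<And>r. r \<in> {a..b} \<Longrightarrow> f r \<le> c"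
  shows "(LBINT r:{a..b}. f r) \<le> c * (b - a)"
proof -
  have "(LBINT r:{a..b}. f r) \<le> (LBINT r:{a..b}. c)"
    using assms by (intro set_integral_mono set_integrable_const_Icc) auto
  also have "\<dots> = c * (b - a)"
    using assms(2) by (simp add: set_lebesgue_integral_def)
  finally show ?thesis .
qed

lemma set_integral_Icc_ge:
  fixes f :: "real \<Rightarrow> real"
  assumes "set_integrable lborel {a..b} f" "a \<le> b" "\<And>r. r \<in> {a..b} \<Longrightarrow> c \<le> f r"
  shows "c * (b - a) \<le> (LBINT r:{a..b}. f r)"
proof -
  have "(LBINT r:{a..b}. c) \<le> (LBINT r:{a..b}. f r)"
    using assms by (intro set_integral_mono set_integrable_const_Icc) auto
  moreover have "(LBINT r:{a..b}. c) = c * (b - a)"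
    using assms(2) by (simp add: set_lebesgue_integral_def)
  ultimately show ?thesis by simp
qed

text \<open>What the mass bound and the uniqueness proof use of a solution. One constant
  \<open>C\<close> bounds both \<open>G\<close> and the linear growth of \<open>H\<close>.
  Nonnegativity of \<open>R\<close> is assumed on initial labels only: on later ones it amounts to
  \<open>m \<le> 1\<close>, which is derived from \<open>m_0\<close> and the equation.\<close>

locale renewal =
  fixes \<epsilon> T \<zeta>min L C \<beta>min \<beta>max :: real and \<zeta> \<beta> G H R m :: "real \<Rightarrow> real"
  assumes \<epsilon>_pos: "0 < \<epsilon>" and T_pos: "0 < T"
    and \<zeta>_lipschitz: "L-lipschitz_on UNIV \<zeta>" and \<zeta>min_pos: "0 < \<zeta>min" and \<zeta>_ge: "\<And>u. \<zeta>min \<le> \<zeta> u"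
    and G_continuous: "continuous_on UNIV G" and G_0: "G 0 = 0" and G_bound: "\<And>t. \<bar>G t\<bar> \<le> C"
    and H_measurable [measurable]: "H \<in> borel_measurable borel"
    and H_growth: "AE \<tau> in lborel. \<tau> \<le> T \<longrightarrow> \<bar>H \<tau>\<bar> \<le> C * (1 + \<bar>\<tau>\<bar>)"
    and H_new: "\<And>\<tau>. 0 < \<tau> \<Longrightarrow> H \<tau> = - G \<tau>"
    and R_measurable [measurable]: "R \<in> borel_measurable borel"
    and R_moment: "set_integrable lborel {..T} (\<lambda>\<tau>. (1 + \<bar>\<tau>\<bar>)\<^sup>2 * R \<tau>)"
    and R_initial: "AE \<tau> in lborel. \<tau> \<le> 0 \<longrightarrow> 0 \<le> R \<tau>"
    and R_new: "\<And>\<tau>. 0 < \<tau> \<Longrightarrow> \<tau> \<le> T \<Longrightarrow> R \<tau> = \<beta> \<tau> * (1 - m \<tau>)"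
    and \<beta>min_pos: "0 < \<beta>min" and \<beta>_bounds: "\<And>t. 0 \<le> t \<Longrightarrow> \<beta>min \<le> \<beta> t \<and> \<beta> t \<le> \<beta>max"
    and m_continuous: "continuous_on {0..T} m" and m_0: "m 0 < 1"
    and m_eq: "\<And>t. t \<in> {0..T} \<Longrightarrow> m t = 1 / \<epsilon> * (LBINT \<tau>:{..t}. R \<tau> * survival \<epsilon> \<zeta> H G \<tau> t)"
begin

abbreviation E :: "real \<Rightarrow> real \<Rightarrow> real"
  where "E \<equiv> survival \<epsilon> \<zeta> H G"

abbreviation rate :: "real \<Rightarrow> real \<Rightarrow> real"
  where "rate \<tau> t \<equiv> \<zeta> (H \<tau> + G t)"

text \<open>The total detachment rate, the age integral of \<zeta>(w) \<rho>: the loss term in the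
  balance of the mass.\<close>

definition flux :: "real \<Rightarrow> real"
  where "flux t = 1 / \<epsilon> * (LBINT \<tau>:{..t}. R \<tau> * (E \<tau> t * rate \<tau> t))"

section \<open>Elementary bounds and integrability in the label variable\<close>

lemma L_nonneg: "0 \<le> L"
  using \<zeta>_lipschitz by (rule lipschitz_on_nonneg)

lemma C_nonneg: "0 \<le> C"
  using G_bound[of 0] by linarith

lemma \<beta>max_pos: "0 < \<beta>max"
  using \<beta>min_pos \<beta>_bounds[of 0] by linarith

lemma \<zeta>_continuous: "continuous_on A \<zeta>"
  using lipschitz_on_continuous_on[OF \<zeta>_lipschitz] continuous_on_subset by blast

lemma \<zeta>_pos: "0 < \<zeta> u"
  using \<zeta>min_pos \<zeta>_ge[of u] by linarith

lemma \<zeta>_diff: "\<bar>\<zeta> u - \<zeta> v\<bar> \<le> L * \<bar>u - v\<bar>"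
  using lipschitz_onD[OF \<zeta>_lipschitz, of u v] by (simp add: dist_real_def)

lemma \<zeta>_measurable [measurable]: "\<zeta> \<in> borel_measurable borel"
  using \<zeta>_continuous by (rule borel_measurable_continuous_onI)

lemma G_measurable [measurable]: "G \<in> borel_measurable borel"
  using G_continuous by (rule borel_measurable_continuous_onI)

lemma rate_integrable: "set_integrable lborel {a..b} (rate \<tau>)"
  unfolding set_integrable_def
  by (rule borel_integrable_compact)
    (auto intro!: continuous_intros continuous_on_compose2[OF \<zeta>_continuous[of UNIV]] continuous_on_subset[OF G_continuous])

lemma E_pos: "0 < E \<tau> t"
  by (simp add: survival_def)

lemma E_le_1: "E \<tau> t \<le> 1"
proof -
  have "0 \<le> (LBINT r:{max \<tau> 0..t}. rate \<tau> r)"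
    unfolding set_lebesgue_integral_def
    by (intro integral_nonneg_AE) (auto simp: less_imp_le[OF \<zeta>_pos])
  then show ?thesis
    using \<epsilon>_pos by (simp add: survival_def)
qed

lemma E_split:
  assumes "max \<tau> 0 \<le> s" "s \<le> t"
  shows "E \<tau> t = E \<tau> s * exp (- (1 / \<epsilon> * (LBINT r:{s..t}. rate \<tau> r)))"
proof -
  have "(LBINT r:{max \<tau> 0..t}. rate \<tau> r) = (LBINT r:{max \<tau> 0..s}. rate \<tau> r) + (LBINT r:{s<..t}. rate \<tau> r)"
  proof -
    have *: "{max \<tau> 0..t} = {max \<tau> 0..s} \<union> {s<..t}" using assms by auto
    show ?thesis
      unfolding * by (rule set_integral_Un) (auto intro: rate_integrable set_integrable_subset[OF rate_integrable[of s t]])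
  qed
  also have "(LBINT r:{s<..t}. rate \<tau> r) = (LBINT r:{s..t}. rate \<tau> r)"
    by (rule set_integral_discrete_difference[where X="{s}"]) auto
  finally show ?thesis
    by (simp add: survival_def distrib_left flip: exp_add)
qed

lemma E_measurable_pair [measurable]: "(\<lambda>x. E (fst x) (snd x)) \<in> borel_measurable (borel \<Otimes>\<^sub>M borel)"
proof -
  have *: "(\<lambda>x. LBINT r:{max (fst x) 0..snd x}. rate (fst x) r)
      = (\<lambda>x. \<integral>r. (if max (fst x) 0 \<le> r \<and> r \<le> snd x then rate (fst x) r else 0) \<partial>lborel)"
    by (auto simp: set_lebesgue_integral_def fun_eq_iff intro!: Bochner_Integration.integral_cong)
  have "(\<lambda>x. LBINT r:{max (fst x) 0..snd x}. rate (fst x) r) \<in> borel_measurable (borel \<Otimes>\<^sub>M borel)"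
    unfolding * by measurable
  then show ?thesis
    unfolding survival_def by measurable
qed

lemma E_measurable [measurable]: "(\<lambda>\<tau>. E \<tau> t) \<in> borel_measurable borel"
  using measurable_compose[OF measurable_Pair[OF measurable_ident measurable_const[of t]] E_measurable_pair]
  by simp

lemma moment_integrable:
  assumes [measurable]: "f \<in> borel_measurable borel"
    and f: "AE \<tau> in lborel. \<tau> \<le> T \<longrightarrow> \<bar>f \<tau>\<bar> \<le> B * (1 + \<bar>\<tau>\<bar>)\<^sup>2"
    and A: "A \<in> sets borel" "A \<subseteq> {..T}"
  shows "set_integrable lborel A (\<lambda>\<tau>. R \<tau> * f \<tau>)"
proof -
  have "set_integrable lborel A (\<lambda>\<tau>. B * ((1 + \<bar>\<tau>\<bar>)\<^sup>2 * R \<tau>))"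
    by (intro set_integrable_mult_right set_integrable_subset[OF R_moment]) (use A in auto)
  then show ?thesis
  proof (rule set_integrable_bound)
    show "set_borel_measurable lborel A (\<lambda>\<tau>. R \<tau> * f \<tau>)"
      using A(1) unfolding set_borel_measurable_def by measurable
    show "AE \<tau>\<in>A in lborel. norm (R \<tau> * f \<tau>) \<le> norm (B * ((1 + \<bar>\<tau>\<bar>)\<^sup>2 * R \<tau>))"
      using f
    proof eventually_elim
      case (elim \<tau>)
      show ?case
      proof
        assume "\<tau> \<in> A"
        then have "\<bar>f \<tau>\<bar> \<le> \<bar>B\<bar> * (1 + \<bar>\<tau>\<bar>)\<^sup>2"
          using elim A(2) mult_right_mono[of B "\<bar>B\<bar>" "(1 + \<bar>\<tau>\<bar>)\<^sup>2"] by fastforce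
        then show "norm (R \<tau> * f \<tau>) \<le> norm (B * ((1 + \<bar>\<tau>\<bar>)\<^sup>2 * R \<tau>))"
          using mult_left_mono[of "\<bar>f \<tau>\<bar>" "\<bar>B\<bar> * (1 + \<bar>\<tau>\<bar>)\<^sup>2" "\<bar>R \<tau>\<bar>"] by (simp add: abs_mult ac_simps)
      qed
    qed
  qed
qed

lemma rate_bound: "rate \<tau> t \<le> \<zeta> 0 + L * C + L * \<bar>H \<tau>\<bar>"
proof -
  have "rate \<tau> t \<le> \<zeta> 0 + L * \<bar>H \<tau> + G t\<bar>"
    using \<zeta>_diff[of "H \<tau> + G t" 0] by simp
  also have "\<dots> \<le> \<zeta> 0 + L * (\<bar>H \<tau>\<bar> + C)"
    using G_bound[of t] L_nonneg by (intro add_left_mono mult_left_mono) auto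
  finally show ?thesis by (simp add: algebra_simps)
qed

lemma rate_growth:
  "AE \<tau> in lborel. \<tau> \<le> T \<longrightarrow> rate \<tau> t \<le> (\<zeta> 0 + 2 * L * C) * (1 + \<bar>\<tau>\<bar>)"
  using H_growth
proof eventually_elim
  case (elim \<tau>)
  show ?case
  proof
    assume "\<tau> \<le> T"
    then have "L * \<bar>H \<tau>\<bar> \<le> L * (C * (1 + \<bar>\<tau>\<bar>))"
      using elim L_nonneg by (intro mult_left_mono) auto
    moreover have "\<zeta> 0 + L * C \<le> (\<zeta> 0 + L * C) * (1 + \<bar>\<tau>\<bar>)"
      using L_nonneg C_nonneg \<zeta>_pos[of 0] by (simp add: distrib_left)
    ultimately show "rate \<tau> t \<le> (\<zeta> 0 + 2 * L * C) * (1 + \<bar>\<tau>\<bar>)"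
      using rate_bound[of \<tau> t] by (simp add: algebra_simps)
  qed
qed

lemma one_le_weight: "1 \<le> (1 + \<bar>\<tau>\<bar>)\<^sup>2" and le_weight: "1 + \<bar>\<tau>\<bar> \<le> (1 + \<bar>\<tau>\<bar>)\<^sup>2" for \<tau> :: real
  by (auto simp: power2_eq_square algebra_simps)

lemma E_growth: "AE \<tau> in lborel. \<tau> \<le> T \<longrightarrow> \<bar>E \<tau> t\<bar> \<le> 1 * (1 + \<bar>\<tau>\<bar>)\<^sup>2"
  using order_trans[OF E_le_1 one_le_weight] E_pos by (simp add: less_imp_le)

lemma rate_growth_square:
  "AE \<tau> in lborel. \<tau> \<le> T \<longrightarrow> \<bar>rate \<tau> t\<bar> \<le> (\<zeta> 0 + 2 * L * C) * (1 + \<bar>\<tau>\<bar>)\<^sup>2"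
  using rate_growth[of t]
proof eventually_elim
  case (elim \<tau>)
  have "(\<zeta> 0 + 2 * L * C) * (1 + \<bar>\<tau>\<bar>) \<le> (\<zeta> 0 + 2 * L * C) * (1 + \<bar>\<tau>\<bar>)\<^sup>2"
    using L_nonneg C_nonneg \<zeta>_pos[of 0] le_weight by (intro mult_left_mono) auto
  then show ?case using elim \<zeta>_pos[of "H \<tau> + G t"] by auto
qed

lemma E_rate_growth:
  "AE \<tau> in lborel. \<tau> \<le> T \<longrightarrow> \<bar>E \<tau> s * rate \<tau> t\<bar> \<le> (\<zeta> 0 + 2 * L * C) * (1 + \<bar>\<tau>\<bar>)\<^sup>2"
  using rate_growth_square[of t]
proof eventually_elim
  case (elim \<tau>)
  have "\<bar>E \<tau> s * rate \<tau> t\<bar> \<le> 1 * \<bar>rate \<tau> t\<bar>"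
    unfolding abs_mult using E_pos[of \<tau> s] E_le_1[of \<tau> s] by (intro mult_right_mono) auto
  then show ?case using elim by auto
qed

lemmas R_E_integrable = moment_integrable[OF E_measurable E_growth]
lemmas R_E_rate_integrable = moment_integrable[OF _ E_rate_growth]

lemma R_integrable: "A \<in> sets borel \<Longrightarrow> A \<subseteq> {..T} \<Longrightarrow> set_integrable lborel A R"
  using moment_integrable[of "\<lambda>_. 1" 1 A] one_le_weight by simp

lemma set_integral_split_label:
  fixes f :: "real \<Rightarrow> real"
  assumes "set_integrable lborel {..t} f" "s \<le> t"
  shows "(LBINT \<tau>:{..t}. f \<tau>) = (LBINT \<tau>:{..s}. f \<tau>) + (LBINT \<tau>:{s<..t}. f \<tau>)"
proof -
  have *: "{..t} = {..s} \<union> {s<..t}" using assms(2) by auto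
  show ?thesis
    unfolding * by (rule set_integral_Un) (auto intro!: set_integrable_subset[OF assms(1)] assms(2))
qed

lemma R_nonneg_until:
  assumes "\<And>\<tau>. 0 < \<tau> \<Longrightarrow> \<tau> \<le> t \<Longrightarrow> m \<tau> \<le> 1" "t \<le> T"
  shows "AE \<tau> in lborel. \<tau> \<le> t \<longrightarrow> 0 \<le> R \<tau>"
  using R_initial
proof eventually_elim
  case (elim \<tau>)
  show ?case
  proof (cases "0 < \<tau>")
    case True
    then show ?thesis
      using assms R_new[of \<tau>] \<beta>_bounds[of \<tau>] \<beta>min_pos by auto
  qed (use elim in auto)
qed

text \<open>Existing bonds decay at least at rate \<zeta>min, and newborn ones are counted in full.
  The sign of \<open>R\<close> is a hypothesis because the estimate itself serves to establish that
  sign, up to a first time with \<open>m = 1\<close>.\<close>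

lemma step_upper:
  assumes R: "AE \<tau> in lborel. \<tau> \<le> t \<longrightarrow> 0 \<le> R \<tau>" and st: "0 \<le> s" "s \<le> t" "t \<le> T"
  shows "m t \<le> exp (- (\<zeta>min * (t - s) / \<epsilon>)) * m s + 1 / \<epsilon> * (LBINT \<tau>:{s<..t}. R \<tau>)"
proof -
  let ?c = "exp (- (\<zeta>min * (t - s) / \<epsilon>))"
  have sT: "{..s} \<subseteq> {..T}" "{s<..t} \<subseteq> {..T}" "{..t} \<subseteq> {..T}" using st by auto
  have split: "(LBINT \<tau>:{..t}. R \<tau> * E \<tau> t) = (LBINT \<tau>:{..s}. R \<tau> * E \<tau> t) + (LBINT \<tau>:{s<..t}. R \<tau> * E \<tau> t)"
    by (intro set_integral_split_label R_E_integrable sT st) auto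
  have old: "(LBINT \<tau>:{..s}. R \<tau> * E \<tau> t) \<le> (LBINT \<tau>:{..s}. ?c * (R \<tau> * E \<tau> s))"
  proof (rule set_integral_mono_AE)
    show "AE \<tau>\<in>{..s} in lborel. R \<tau> * E \<tau> t \<le> ?c * (R \<tau> * E \<tau> s)"
      using R
    proof eventually_elim
      case (elim \<tau>)
      show ?case
      proof
        assume \<tau>: "\<tau> \<in> {..s}"
        have "\<zeta>min * (t - s) \<le> (LBINT r:{s..t}. rate \<tau> r)"
          by (rule set_integral_Icc_ge[OF rate_integrable]) (use st \<zeta>_ge in auto)
        then have "exp (- (1 / \<epsilon> * (LBINT r:{s..t}. rate \<tau> r))) \<le> ?c"
          using \<epsilon>_pos by (simp add: divide_right_mono)
        then have "E \<tau> t \<le> ?c * E \<tau> s"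
          using E_pos[of \<tau> s] E_split[of \<tau> s t] \<tau> st by (simp add: mult.commute)
        then show "R \<tau> * E \<tau> t \<le> ?c * (R \<tau> * E \<tau> s)"
          using elim \<tau> st mult_left_mono[of "E \<tau> t" "?c * E \<tau> s" "R \<tau>"] by (simp add: ac_simps)
      qed
    qed
  qed (intro set_integrable_mult_right R_E_integrable sT; simp)+
  have new: "(LBINT \<tau>:{s<..t}. R \<tau> * E \<tau> t) \<le> (LBINT \<tau>:{s<..t}. R \<tau>)"
  proof (rule set_integral_mono_AE)
    show "AE \<tau>\<in>{s<..t} in lborel. R \<tau> * E \<tau> t \<le> R \<tau>"
      using R by eventually_elim (auto intro!: mult_right_le_one_le E_le_1 less_imp_le[OF E_pos])
  qed (intro R_E_integrable R_integrable sT; simp)+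
  have "1 / \<epsilon> * (LBINT \<tau>:{..t}. R \<tau> * E \<tau> t)
      \<le> 1 / \<epsilon> * (?c * (LBINT \<tau>:{..s}. R \<tau> * E \<tau> s) + (LBINT \<tau>:{s<..t}. R \<tau>))"
    using \<epsilon>_pos split old new by (intro mult_left_mono) (auto simp only: set_integral_mult_right, auto)
  then show ?thesis
    using st by (simp add: m_eq distrib_left)
qed

text \<open>Just before a first time with \<open>m = 1\<close> the births
  \<open>\<beta> * (1 - m)\<close> are too few to compensate detachment at rate \<zeta>min, so the
  value 1 is never reached.\<close>

lemma m_less_1:
  assumes t: "t \<in> {0..T}"
  shows "m t < 1"
proof (rule ccontr)
  assume "\<not> m t < 1"
  then have "- m t \<le> - 1" by simp
  moreover have "continuous_on {0..t} (\<lambda>t. - m t)"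
    using t by (intro continuous_intros continuous_on_subset[OF m_continuous]) auto
  ultimately obtain t0 where t0: "0 < t0" "t0 \<le> t" "- m t0 = - 1"
    and before: "\<And>s. 0 \<le> s \<Longrightarrow> s < t0 \<Longrightarrow> - 1 < - m s"
    using first_crossing[of t "\<lambda>t. - m t" "- 1"] m_0 t by auto
  have le1: "m \<tau> \<le> 1" if "0 \<le> \<tau>" "\<tau> \<le> t0" for \<tau>
    using before[of \<tau>] t0 that by (cases "\<tau> = t0") auto
  \<comment> \<open>Limits the births to half the guaranteed loss:
    \<open>\<beta>max * \<eta> = \<zeta>min / 2\<close>.\<close>
  define \<eta> where "\<eta> = \<zeta>min / (2 * \<beta>max)"
  have "0 < \<eta>" using \<zeta>min_pos \<beta>max_pos by (simp add: \<eta>_def)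
  moreover have "t0 \<in> {0..T}" using t t0 by simp
  ultimately obtain d where d: "0 < d" "\<And>\<tau>. \<tau> \<in> {0..T} \<Longrightarrow> \<bar>\<tau> - t0\<bar> < d \<Longrightarrow> \<bar>m \<tau> - m t0\<bar> < \<eta>"
    using m_continuous unfolding continuous_on_iff dist_real_def by blast
  \<comment> \<open>The step stays in the continuity window, starts no earlier than 0 and makes
    \<open>\<zeta>min * h / \<epsilon>\<close> at most 1/2.\<close>
  define h where "h = min (min (d / 2) t0) (\<epsilon> / (2 * \<zeta>min))"
  have h: "0 < h" "h < d" "h \<le> t0" "h \<le> \<epsilon> / (2 * \<zeta>min)"
    using d(1) t0(1) \<epsilon>_pos \<zeta>min_pos by (auto simp: h_def)
  define s where "s = t0 - h"
  have s: "0 \<le> s" "s < t0" "t0 - s = h" using h by (auto simp: s_def)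
  have "(LBINT \<tau>:{s<..t0}. R \<tau>) \<le> (LBINT \<tau>:{s..t0}. \<beta>max * \<eta>)"
  proof -
    have "(LBINT \<tau>:{s<..t0}. R \<tau>) \<le> (LBINT \<tau>:{s<..t0}. \<beta>max * \<eta>)"
    proof (rule set_integral_mono)
      show "set_integrable lborel {s<..t0} R"
        by (rule R_integrable) (use t0 t in auto)
      show "set_integrable lborel {s<..t0} (\<lambda>_. \<beta>max * \<eta>)"
        by (rule set_integrable_subset[OF set_integrable_const_Icc[of s t0]]) auto
      fix \<tau> assume \<tau>: "\<tau> \<in> {s<..t0}"
      then have "1 - m \<tau> \<le> \<eta>" "m \<tau> \<le> 1"
        using d(2)[of \<tau>] le1[of \<tau>] s h(2) t0 t by auto
      then show "R \<tau> \<le> \<beta>max * \<eta>"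
        using \<tau> s t0 t R_new[of \<tau>] \<beta>_bounds[of \<tau>] \<beta>max_pos by (auto intro!: mult_mono)
    qed
    also have "\<dots> = (LBINT \<tau>:{s..t0}. \<beta>max * \<eta>)"
      by (rule set_integral_discrete_difference[where X="{s}"]) auto
    finally show ?thesis .
  qed
  also have "\<dots> = \<beta>max * \<eta> * h"
    using s by (simp add: set_lebesgue_integral_def)
  also have "\<beta>max * \<eta> = \<zeta>min / 2"
    using \<beta>max_pos by (simp add: \<eta>_def)
  finally have I: "1 / \<epsilon> * (LBINT \<tau>:{s<..t0}. R \<tau>) \<le> \<zeta>min * h / \<epsilon> / 2"
    using \<epsilon>_pos by (simp add: field_simps)
  define x where "x = \<zeta>min * h / \<epsilon>"
  have x: "0 < x" "x \<le> 1 / 2"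
    using h \<epsilon>_pos \<zeta>min_pos by (auto simp: x_def field_simps)
  have "AE \<tau> in lborel. \<tau> \<le> t0 \<longrightarrow> 0 \<le> R \<tau>"
    by (rule R_nonneg_until) (use le1 t0 t in auto)
  from step_upper[OF this s(1)] s t0 t
  have "m t0 \<le> exp (- x) * m s + 1 / \<epsilon> * (LBINT \<tau>:{s<..t0}. R \<tau>)"
    by (simp add: x_def)
  also have "\<dots> \<le> exp (- x) * 1 + x / 2"
    using I le1[of s] s by (intro add_mono mult_left_mono) (auto simp: x_def)
  also have "exp (- x) \<le> 1 / (1 + x)"
    using exp_ge_add_one_self[of x] x by (simp add: exp_minus field_simps)
  \<comment> \<open>This amounts to \<open>x \<le> x * x\<close>, impossible for
    \<open>0 < x\<close> and \<open>x \<le> 1 / 2\<close>.\<close>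
  finally have "1 \<le> 1 / (1 + x) + x / 2"
    using t0(3) by simp
  then have "1 + x \<le> 1 + x / 2 * (1 + x)"
    using x by (simp add: field_simps)
  then have "x * x \<ge> x" by (simp add: field_simps)
  then show False using x by simp
qed

lemma R_nonneg: "AE \<tau> in lborel. \<tau> \<le> T \<longrightarrow> 0 \<le> R \<tau>"
  by (rule R_nonneg_until) (use m_less_1 in \<open>auto intro: less_imp_le\<close>)

lemma m_nonneg:
  assumes "t \<in> {0..T}" shows "0 \<le> m t"
proof -
  have "0 \<le> (LBINT \<tau>:{..t}. R \<tau> * E \<tau> t)"
    unfolding set_lebesgue_integral_def
  proof (rule integral_nonneg_AE)
    show "AE \<tau> in lborel. 0 \<le> indicator {..t} \<tau> *\<^sub>R (R \<tau> * E \<tau> t)"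
      using R_nonneg by eventually_elim (use assms in \<open>auto simp: indicator_def less_imp_le[OF E_pos]\<close>)
  qed
  then show ?thesis
    using \<epsilon>_pos by (simp add: m_eq[OF assms])
qed

section \<open>Rates whose drift in time is bounded\<close>

context
  fixes K
  assumes rate_lipschitz: "\<And>\<tau> r s. r \<in> {0..T} \<Longrightarrow> s \<in> {0..T} \<Longrightarrow> \<bar>rate \<tau> r - rate \<tau> s\<bar> \<le> K * \<bar>r - s\<bar>"
begin

lemma K_nonneg: "0 \<le> K"
proof -
  have "0 \<le> K * \<bar>T - 0\<bar>"
    using T_pos by (intro order_trans[OF abs_ge_zero rate_lipschitz]) auto
  then show ?thesis using T_pos by (simp add: zero_le_mult_iff)
qed

text \<open>An Euler step made rigorous by \<open>1 - x \<le> exp (- x)\<close>. During the step a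
  rate exceeds its starting value by at most \<open>K * (t - s)\<close>. The starting value is the
  rate at time \<open>s\<close> for existing labels and \<open>\<zeta> 0\<close> for newborn ones,
  whose elongation starts at 0.\<close>

lemma step_lower:
  assumes st: "0 \<le> s" "s \<le> t" "t \<le> T"
  shows "m s - (t - s) / \<epsilon> * (flux s + K * (t - s) * m s)
      + 1 / \<epsilon> * (1 - (t - s) / \<epsilon> * (\<zeta> 0 + K * (t - s))) * (LBINT \<tau>:{s<..t}. R \<tau>) \<le> m t"
proof -
  let ?h = "t - s" and ?c = "1 - (t - s) / \<epsilon> * (\<zeta> 0 + K * (t - s))"
  have sT: "{..s} \<subseteq> {..T}" "{s<..t} \<subseteq> {..T}" "{..t} \<subseteq> {..T}" using st by auto
  have exp_ge: "1 - 1 / \<epsilon> * (c * l) \<le> exp (- (1 / \<epsilon> * I))" if "I \<le> c * l" for c l I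
  proof -
    have "1 - 1 / \<epsilon> * (c * l) \<le> 1 + - (1 / \<epsilon> * I)"
      using that \<epsilon>_pos by (simp add: divide_right_mono)
    also have "\<dots> \<le> exp (- (1 / \<epsilon> * I))"
      by (rule exp_ge_add_one_self)
    finally show ?thesis .
  qed
  have old: "(LBINT \<tau>:{..s}. R \<tau> * E \<tau> s - ?h / \<epsilon> * (R \<tau> * (E \<tau> s * rate \<tau> s) + K * ?h * (R \<tau> * E \<tau> s)))
      \<le> (LBINT \<tau>:{..s}. R \<tau> * E \<tau> t)"
  proof (rule set_integral_mono_AE)
    show "AE \<tau>\<in>{..s} in lborel. R \<tau> * E \<tau> s - ?h / \<epsilon> * (R \<tau> * (E \<tau> s * rate \<tau> s) + K * ?h * (R \<tau> * E \<tau> s))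
        \<le> R \<tau> * E \<tau> t"
      using R_nonneg
    proof eventually_elim
      case (elim \<tau>)
      show ?case
      proof
        assume \<tau>: "\<tau> \<in> {..s}"
        have "(LBINT r:{s..t}. rate \<tau> r) \<le> (rate \<tau> s + K * ?h) * ?h"
        proof (rule set_integral_Icc_le[OF rate_integrable st(2)])
          fix r assume r: "r \<in> {s..t}"
          have "K * \<bar>r - s\<bar> \<le> K * ?h" using r K_nonneg by (intro mult_left_mono) auto
          then show "rate \<tau> r \<le> rate \<tau> s + K * ?h"
            using rate_lipschitz[of r s \<tau>] r st by auto
        qed
        from exp_ge[OF this] have "E \<tau> s * (1 - 1 / \<epsilon> * ((rate \<tau> s + K * ?h) * ?h)) \<le> E \<tau> t"
          using E_split[of \<tau> s t] \<tau> st E_pos[of \<tau> s] by (simp add: mult_left_mono)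
        then have "R \<tau> * (E \<tau> s * (1 - 1 / \<epsilon> * ((rate \<tau> s + K * ?h) * ?h))) \<le> R \<tau> * E \<tau> t"
          using elim \<tau> st by (intro mult_left_mono) auto
        moreover have "r * (e * (1 - 1 / \<epsilon> * ((z + K * h) * h))) = r * e - h / \<epsilon> * (r * (e * z) + K * h * (r * e))"
          for r e z h
          using \<epsilon>_pos by (simp add: field_simps)
        ultimately show "R \<tau> * E \<tau> s - ?h / \<epsilon> * (R \<tau> * (E \<tau> s * rate \<tau> s) + K * ?h * (R \<tau> * E \<tau> s)) \<le> R \<tau> * E \<tau> t"
          by simp
      qed
    qed
  qed (intro set_integral_diff(1) set_integral_add(1) set_integrable_mult_right R_E_integrable R_E_rate_integrable sT; simp)+
  have new: "(LBINT \<tau>:{s<..t}. ?c * R \<tau>) \<le> (LBINT \<tau>:{s<..t}. R \<tau> * E \<tau> t)"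
  proof (rule set_integral_mono_AE)
    show "AE \<tau>\<in>{s<..t} in lborel. ?c * R \<tau> \<le> R \<tau> * E \<tau> t"
      using R_nonneg
    proof eventually_elim
      case (elim \<tau>)
      show ?case
      proof
        assume \<tau>: "\<tau> \<in> {s<..t}"
        have "(LBINT r:{\<tau>..t}. rate \<tau> r) \<le> (\<zeta> 0 + K * ?h) * (t - \<tau>)"
        proof (rule set_integral_Icc_le[OF rate_integrable])
          fix r assume r: "r \<in> {\<tau>..t}"
          have "K * \<bar>r - \<tau>\<bar> \<le> K * ?h" using r \<tau> K_nonneg by (intro mult_left_mono) auto
          moreover have "rate \<tau> \<tau> = \<zeta> 0" using H_new[of \<tau>] \<tau> st by simp
          ultimately show "rate \<tau> r \<le> \<zeta> 0 + K * ?h"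
            using rate_lipschitz[of r \<tau> \<tau>] r \<tau> st by auto
        qed (use \<tau> in auto)
        also have "\<dots> \<le> (\<zeta> 0 + K * ?h) * ?h"
          using \<tau> st K_nonneg \<zeta>_pos[of 0] by (intro mult_left_mono) auto
        finally have "1 - 1 / \<epsilon> * ((\<zeta> 0 + K * ?h) * ?h) \<le> exp (- (1 / \<epsilon> * (LBINT r:{\<tau>..t}. rate \<tau> r)))"
          by (rule exp_ge)
        then have "?c \<le> E \<tau> t"
          using \<tau> st by (simp add: survival_def ac_simps)
        then show "?c * R \<tau> \<le> R \<tau> * E \<tau> t"
          using elim \<tau> st mult_left_mono[of ?c "E \<tau> t" "R \<tau>"] by (simp add: mult.commute)
      qed
    qed
  qed (intro set_integrable_mult_right R_E_integrable R_integrable sT; simp)+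
  have "(LBINT \<tau>:{..t}. R \<tau> * E \<tau> t) = (LBINT \<tau>:{..s}. R \<tau> * E \<tau> t) + (LBINT \<tau>:{s<..t}. R \<tau> * E \<tau> t)"
    by (intro set_integral_split_label R_E_integrable sT st) auto
  then have sum_le: "(LBINT \<tau>:{..s}. R \<tau> * E \<tau> s - ?h / \<epsilon> * (R \<tau> * (E \<tau> s * rate \<tau> s) + K * ?h * (R \<tau> * E \<tau> s)))
      + (LBINT \<tau>:{s<..t}. ?c * R \<tau>) \<le> (LBINT \<tau>:{..t}. R \<tau> * E \<tau> t)"
    using old new by linarith
  have i: "set_integrable lborel {..s} (\<lambda>\<tau>. R \<tau> * E \<tau> s)"
    "set_integrable lborel {..s} (\<lambda>\<tau>. R \<tau> * (E \<tau> s * rate \<tau> s))"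
    by (intro R_E_integrable R_E_rate_integrable sT; simp)+
  then have "(LBINT \<tau>:{..s}. R \<tau> * E \<tau> s - ?h / \<epsilon> * (R \<tau> * (E \<tau> s * rate \<tau> s) + K * ?h * (R \<tau> * E \<tau> s)))
      = (LBINT \<tau>:{..s}. R \<tau> * E \<tau> s) - ?h / \<epsilon> * ((LBINT \<tau>:{..s}. R \<tau> * (E \<tau> s * rate \<tau> s))
        + K * ?h * (LBINT \<tau>:{..s}. R \<tau> * E \<tau> s))"
    by (simp only: set_integral_diff(2) set_integral_add set_integrable_mult_right set_integral_mult_right)
  with sum_le have "(LBINT \<tau>:{..s}. R \<tau> * E \<tau> s) - ?h / \<epsilon> * ((LBINT \<tau>:{..s}. R \<tau> * (E \<tau> s * rate \<tau> s))
      + K * ?h * (LBINT \<tau>:{..s}. R \<tau> * E \<tau> s)) + ?c * (LBINT \<tau>:{s<..t}. R \<tau>) \<le> (LBINT \<tau>:{..t}. R \<tau> * E \<tau> t)"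
    by (simp only: set_integral_mult_right)
  then have "1 / \<epsilon> * ((LBINT \<tau>:{..s}. R \<tau> * E \<tau> s) - ?h / \<epsilon> * ((LBINT \<tau>:{..s}. R \<tau> * (E \<tau> s * rate \<tau> s))
      + K * ?h * (LBINT \<tau>:{..s}. R \<tau> * E \<tau> s)) + ?c * (LBINT \<tau>:{s<..t}. R \<tau>))
      \<le> 1 / \<epsilon> * (LBINT \<tau>:{..t}. R \<tau> * E \<tau> t)"
    using \<epsilon>_pos by (intro mult_left_mono) auto
  moreover have "1 / \<epsilon> * (a - k * (b + l * a) + c * d) = 1 / \<epsilon> * a - k * (1 / \<epsilon> * b + l * (1 / \<epsilon> * a)) + 1 / \<epsilon> * c * d"
    for a b c d k l
    by (simp add: algebra_simps diff_divide_distrib add_divide_distrib)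
  ultimately show ?thesis
    using st by (simp only: m_eq[of s] m_eq[of t] flux_def atLeastAtMost_iff simp_thms order.trans[OF st(1,2)] order.trans[OF st(2,3)])
qed

lemma flux_le:
  assumes t: "t \<in> {0..T}" and q: "0 \<le> q"
    and initial: "(LBINT \<tau>:{..0}. R \<tau> * \<zeta> (H \<tau>)) = q * (LBINT \<tau>:{..0}. R \<tau>)"
  shows "flux t \<le> (\<zeta> 0 + q + K * t) * m t"
proof -
  \<comment> \<open>One bound has to cover both cohorts, \<open>q + K * t\<close> for initial labels
    and \<open>\<zeta> 0 + K * t\<close> for new ones; adding the two constants gives the \<zeta>bar
    of the theorem.\<close>
  let ?Q = "\<zeta> 0 + q + K * t"
  have sT: "{..0} \<subseteq> {..T}" "{0<..t} \<subseteq> {..T}" "{..t} \<subseteq> {..T}" using t T_pos by auto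
  txt \<open>On the initial cohort the rates at time \<open>t\<close> are averaged with weights that decay the faster
    the larger the rates are, so up to the drift \<open>K * t\<close> the average cannot exceed the one at time
    \<open>0\<close>. The comparison with the survival probability \<open>c\<close> of a label of average rate makes this pointwise.\<close>
  define c where "c = exp (- (1 / \<epsilon> * (LBINT r:{0..t}. q + K * r)))"
  have int_drift: "set_integrable lborel {0..t} (\<lambda>r. q + K * r)"
    unfolding set_integrable_def by (rule borel_integrable_compact) (auto intro!: continuous_intros)
  have "(LBINT \<tau>:{..0}. R \<tau> * (E \<tau> t * rate \<tau> t) - (q + K * t) * (R \<tau> * E \<tau> t))
      \<le> (LBINT \<tau>:{..0}. c * (R \<tau> * \<zeta> (H \<tau>) - q * R \<tau>))"
  proof (rule set_integral_mono_AE)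
    show "AE \<tau>\<in>{..0} in lborel. R \<tau> * (E \<tau> t * rate \<tau> t) - (q + K * t) * (R \<tau> * E \<tau> t)
        \<le> c * (R \<tau> * \<zeta> (H \<tau>) - q * R \<tau>)"
      using R_nonneg
    proof eventually_elim
      case (elim \<tau>)
      show ?case
      proof
        assume \<tau>: "\<tau> \<in> {..0}"
        \<comment> \<open>\<open>x\<close> is the rate at time 0 and \<open>y\<close> the rate at
          time \<open>t\<close> less the largest possible drift, so \<open>y \<le> x\<close>. If
          \<open>q < y\<close>, the rates at all \<open>r\<close> are at least
          \<open>q + K * r\<close>, whence \<open>E \<tau> t \<le> c\<close>; if
          \<open>x \<le> q\<close>, they are at most \<open>q + K * r\<close>, whence
          \<open>c \<le> E \<tau> t\<close>; in between the two sides are separated by 0.\<close>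
        define x where "x = \<zeta> (H \<tau>)"
        define y where "y = rate \<tau> t - K * t"
        have yx: "y \<le> x"
          using rate_lipschitz[of t 0 \<tau>] t G_0 by (auto simp: x_def y_def)
        have Et: "E \<tau> t = exp (- (1 / \<epsilon> * (LBINT r:{0..t}. rate \<tau> r)))"
          using \<tau> by (simp add: survival_def max_def)
        have "E \<tau> t * (y - q) \<le> c * (x - q)"
        proof (cases "q < y")
          case True
          have "(LBINT r:{0..t}. q + K * r) \<le> (LBINT r:{0..t}. rate \<tau> r)"
          proof (rule set_integral_mono[OF int_drift rate_integrable])
            fix r assume r: "r \<in> {0..t}"
            then show "q + K * r \<le> rate \<tau> r"
              using rate_lipschitz[of t r \<tau>] t True by (auto simp: y_def algebra_simps)
          qed
          then have "E \<tau> t \<le> c"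
            using \<epsilon>_pos by (simp add: Et c_def divide_right_mono)
          then have "E \<tau> t * (y - q) \<le> c * (y - q)"
            using True by (intro mult_right_mono) auto
          also have "\<dots> \<le> c * (x - q)"
            using yx by (intro mult_left_mono) (auto simp: c_def)
          finally show ?thesis .
        next
          case y: False
          show ?thesis
          proof (cases "q < x")
            case True
            have "E \<tau> t * (y - q) \<le> 0" "0 \<le> c * (x - q)"
              using y True E_pos[of \<tau> t] by (auto simp: mult_le_0_iff c_def)
            then show ?thesis by linarith
          next
            case x: False
            have "(LBINT r:{0..t}. rate \<tau> r) \<le> (LBINT r:{0..t}. q + K * r)"
            proof (rule set_integral_mono[OF rate_integrable int_drift])
              fix r assume r: "r \<in> {0..t}"
              then show "rate \<tau> r \<le> q + K * r"
                using rate_lipschitz[of r 0 \<tau>] t x G_0 by (auto simp: x_def)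
            qed
            then have "c \<le> E \<tau> t"
              using \<epsilon>_pos by (simp add: Et c_def divide_right_mono)
            then have "E \<tau> t * (y - q) \<le> c * (y - q)"
              using y by (intro mult_right_mono_neg) auto
            also have "\<dots> \<le> c * (x - q)"
              using yx by (intro mult_left_mono) (auto simp: c_def)
            finally show ?thesis .
          qed
        qed
        then have "R \<tau> * (E \<tau> t * (y - q)) \<le> R \<tau> * (c * (x - q))"
          using elim \<tau> T_pos by (intro mult_left_mono) auto
        then show "R \<tau> * (E \<tau> t * rate \<tau> t) - (q + K * t) * (R \<tau> * E \<tau> t)
            \<le> c * (R \<tau> * \<zeta> (H \<tau>) - q * R \<tau>)"
          by (simp add: x_def y_def algebra_simps)
      qed
    qed
    show "set_integrable lborel {..0} (\<lambda>\<tau>. c * (R \<tau> * \<zeta> (H \<tau>) - q * R \<tau>))"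
    proof (intro set_integrable_mult_right set_integral_diff(1) R_integrable sT)
      show "set_integrable lborel {..0} (\<lambda>\<tau>. R \<tau> * \<zeta> (H \<tau>))"
        by (rule moment_integrable[OF _ _ _ sT(1)]) (use rate_growth_square[of 0] G_0 in auto)
    qed simp
  qed (intro set_integral_diff(1) set_integrable_mult_right R_E_integrable R_E_rate_integrable sT; simp)
  \<comment> \<open>\<open>q\<close> is the mean of the initial rates, so the deviations from it
    cancel against the density.\<close>
  also have "\<dots> = 0"
  proof -
    have "set_integrable lborel {..0} (\<lambda>\<tau>. R \<tau> * \<zeta> (H \<tau>))"
      by (rule moment_integrable[OF _ _ _ sT(1)]) (use rate_growth_square[of 0] G_0 in auto)
    then show ?thesis
      using initial R_integrable[OF _ sT(1)] by (simp add: set_integral_diff(2))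
  qed
  also have "(LBINT \<tau>:{..0}. R \<tau> * (E \<tau> t * rate \<tau> t) - (q + K * t) * (R \<tau> * E \<tau> t))
      = (LBINT \<tau>:{..0}. R \<tau> * (E \<tau> t * rate \<tau> t)) - (q + K * t) * (LBINT \<tau>:{..0}. R \<tau> * E \<tau> t)"
    by (subst set_integral_diff(2))
      (auto intro!: set_integrable_mult_right R_E_integrable R_E_rate_integrable sT)
  finally have "(LBINT \<tau>:{..0}. R \<tau> * (E \<tau> t * rate \<tau> t)) \<le> (q + K * t) * (LBINT \<tau>:{..0}. R \<tau> * E \<tau> t)"
    by simp
  also have "\<dots> \<le> ?Q * (LBINT \<tau>:{..0}. R \<tau> * E \<tau> t)"
  proof (rule mult_right_mono)
    show "0 \<le> (LBINT \<tau>:{..0}. R \<tau> * E \<tau> t)"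
      unfolding set_lebesgue_integral_def
    proof (rule integral_nonneg_AE)
      show "AE \<tau> in lborel. 0 \<le> indicator {..0} \<tau> *\<^sub>R (R \<tau> * E \<tau> t)"
        using R_initial by eventually_elim (auto simp: indicator_def less_imp_le[OF E_pos])
    qed
  qed (use \<zeta>_pos[of 0] in auto)
  finally have old: "(LBINT \<tau>:{..0}. R \<tau> * (E \<tau> t * rate \<tau> t)) \<le> ?Q * (LBINT \<tau>:{..0}. R \<tau> * E \<tau> t)" .
  have "(LBINT \<tau>:{0<..t}. R \<tau> * (E \<tau> t * rate \<tau> t)) \<le> (LBINT \<tau>:{0<..t}. ?Q * (R \<tau> * E \<tau> t))"
  proof (rule set_integral_mono_AE)
    show "AE \<tau>\<in>{0<..t} in lborel. R \<tau> * (E \<tau> t * rate \<tau> t) \<le> ?Q * (R \<tau> * E \<tau> t)"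
      using R_nonneg
    proof eventually_elim
      case (elim \<tau>)
      show ?case
      proof
        assume \<tau>: "\<tau> \<in> {0<..t}"
        then have "\<bar>rate \<tau> t - \<zeta> 0\<bar> \<le> K * (t - \<tau>)"
          using rate_lipschitz[of t \<tau> \<tau>] H_new[of \<tau>] t by auto
        moreover have "K * (t - \<tau>) \<le> K * t"
          using \<tau> K_nonneg by (intro mult_left_mono) auto
        ultimately have "rate \<tau> t \<le> ?Q" using q by linarith
        then have "(R \<tau> * E \<tau> t) * rate \<tau> t \<le> (R \<tau> * E \<tau> t) * ?Q"
          using elim \<tau> t E_pos[of \<tau> t] by (intro mult_left_mono) auto
        then show "R \<tau> * (E \<tau> t * rate \<tau> t) \<le> ?Q * (R \<tau> * E \<tau> t)"
          by (simp add: ac_simps)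
      qed
    qed
  qed (intro set_integrable_mult_right R_E_integrable R_E_rate_integrable sT; simp)+
  then have new: "(LBINT \<tau>:{0<..t}. R \<tau> * (E \<tau> t * rate \<tau> t)) \<le> ?Q * (LBINT \<tau>:{0<..t}. R \<tau> * E \<tau> t)"
    by (simp only: set_integral_mult_right)
  have "(LBINT \<tau>:{..t}. R \<tau> * (E \<tau> t * rate \<tau> t)) =
      (LBINT \<tau>:{..0}. R \<tau> * (E \<tau> t * rate \<tau> t)) + (LBINT \<tau>:{0<..t}. R \<tau> * (E \<tau> t * rate \<tau> t))"
    by (intro set_integral_split_label R_E_rate_integrable sT) (use t in auto)
  moreover have "(LBINT \<tau>:{..t}. R \<tau> * E \<tau> t) = (LBINT \<tau>:{..0}. R \<tau> * E \<tau> t) + (LBINT \<tau>:{0<..t}. R \<tau> * E \<tau> t)"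
    by (intro set_integral_split_label R_E_integrable sT) (use t in auto)
  ultimately have "(LBINT \<tau>:{..t}. R \<tau> * (E \<tau> t * rate \<tau> t)) \<le> ?Q * (LBINT \<tau>:{..t}. R \<tau> * E \<tau> t)"
    using old new by (simp add: distrib_left)
  then have "1 / \<epsilon> * (LBINT \<tau>:{..t}. R \<tau> * (E \<tau> t * rate \<tau> t)) \<le> 1 / \<epsilon> * (?Q * (LBINT \<tau>:{..t}. R \<tau> * E \<tau> t))"
    using \<epsilon>_pos by (intro mult_left_mono) auto
  then show ?thesis
    by (simp add: flux_def m_eq[OF t])
qed

text \<open>At a first time with \<open>m = l\<close> the gain \<open>\<beta>min * (1 - l)\<close>
  still exceeds the loss \<open>Q * l\<close>. By continuity this holds with a margin shortly
  before, and \<open>step_lower\<close> from there, where \<open>m\<close> is above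
  \<open>l\<close>, makes \<open>m\<close> end above \<open>l\<close> as well.\<close>

lemma m_greater:
  assumes t: "t \<in> {0..T}" and q: "0 \<le> q"
    and initial: "(LBINT \<tau>:{..0}. R \<tau> * \<zeta> (H \<tau>)) = q * (LBINT \<tau>:{..0}. R \<tau>)"
    and l: "0 < l" "l < m 0" and pos: "(\<zeta> 0 + q + K * t) * l < \<beta>min * (1 - l)"
  shows "l < m t"
proof (rule ccontr)
  assume "\<not> l < m t"
  moreover have "continuous_on {0..t} m"
    using t by (intro continuous_on_subset[OF m_continuous]) auto
  ultimately obtain t0 where t0: "0 < t0" "t0 \<le> t" "m t0 = l"
    and before: "\<And>s. 0 \<le> s \<Longrightarrow> s < t0 \<Longrightarrow> l < m s"
    using first_crossing[of t m l] l t by auto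
  define Q where "Q = \<zeta> 0 + q + K * t0"
  have Qpos: "0 < Q"
    using \<zeta>_pos[of 0] q K_nonneg t0(1) by (auto simp: Q_def intro!: add_pos_nonneg)
  have "Q * l \<le> (\<zeta> 0 + q + K * t) * l"
    using l K_nonneg t0 by (auto simp: Q_def intro!: mult_right_mono mult_left_mono)
  with pos have \<kappa>: "0 < \<beta>min * (1 - l) - Q * l" by simp
  have l1: "l < 1" using l m_0 by simp
  \<comment> \<open>The second entry uses up at most half of the gap
    \<open>\<beta>min * (1 - l) - Q * l\<close>, which leaves \<open>\<kappa>1\<close> positive; the
    first keeps \<open>1 - l - \<eta>\<close> positive.\<close>
  define \<eta> where "\<eta> = min ((1 - l) / 2) ((\<beta>min * (1 - l) - Q * l) / (2 * (\<beta>min + Q)))"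
  have \<eta>: "0 < \<eta>" "\<eta> < 1 - l"
  proof -
    show "0 < \<eta>" using l1 \<kappa> \<beta>min_pos Qpos by (auto simp: \<eta>_def)
    have "\<eta> \<le> (1 - l) / 2" unfolding \<eta>_def by (rule min.cobounded1)
    also have "\<dots> < 1 - l" using l1 by simp
    finally show "\<eta> < 1 - l" .
  qed
  have "\<eta> * (2 * (\<beta>min + Q)) \<le> \<beta>min * (1 - l) - Q * l"
    using \<beta>min_pos Qpos by (simp add: pos_le_divide_eq[symmetric] \<eta>_def)
  define \<kappa>1 where "\<kappa>1 = \<beta>min * (1 - l - \<eta>) - Q * (l + \<eta>)"
  have \<kappa>1: "0 < \<kappa>1"
    using \<kappa> \<open>\<eta> * (2 * (\<beta>min + Q)) \<le> _\<close> by (simp add: \<kappa>1_def algebra_simps)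
  have "t0 \<in> {0..T}" using t t0 by simp
  then obtain d where d: "0 < d" "\<And>\<tau>. \<tau> \<in> {0..T} \<Longrightarrow> \<bar>\<tau> - t0\<bar> < d \<Longrightarrow> \<bar>m \<tau> - m t0\<bar> < \<eta>"
    using m_continuous \<eta>(1) unfolding continuous_on_iff dist_real_def by blast
  define B where "B = (\<zeta> 0 + K) / \<epsilon>"
  have B: "0 < B" using \<zeta>_pos[of 0] K_nonneg \<epsilon>_pos by (simp add: B_def)
  \<comment> \<open>\<open>1 / B\<close> makes the lower bound \<open>c\<close> for the survival of
    newborn bonds nonnegative; the last entry limits the births lost through \<open>1 - c\<close> to
    half of \<open>\<kappa>1\<close>. The others give \<open>K * h \<le> K\<close>, the continuity
    window and a start no earlier than 0.\<close>
  define h where "h = min (min 1 (min (d / 2) t0)) (min (1 / B) (\<kappa>1 / (2 * B * \<beta>min)))"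
  have h: "0 < h" "h \<le> 1" "h < d" "h \<le> t0" "h \<le> 1 / B" "h \<le> \<kappa>1 / (2 * B * \<beta>min)"
    using d(1) t0(1) B \<kappa>1 \<beta>min_pos by (auto simp: h_def)
  define s where "s = t0 - h"
  have s: "0 \<le> s" "s \<le> t0" "s < t0" "t0 - s = h" using h by (auto simp: s_def)
  define c where "c = 1 - h / \<epsilon> * (\<zeta> 0 + K * h)"
  have "h / \<epsilon> * (\<zeta> 0 + K * h) \<le> h / \<epsilon> * (\<zeta> 0 + K)"
    using h \<epsilon>_pos K_nonneg by (intro mult_left_mono add_left_mono) (auto simp: mult_left_le)
  also have "\<dots> = h * B" by (simp add: B_def)
  finally have cB: "1 - c \<le> h * B" by (simp add: c_def)
  have hB: "h * B \<le> 1" "h * B * \<beta>min < \<kappa>1"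
    using h(5,6) B \<beta>min_pos \<kappa>1 by (auto simp: field_simps)
  have c: "0 \<le> c" using cB hB by simp
  have near: "m \<tau> \<le> l + \<eta>" if "\<tau> \<in> {s..t0}" for \<tau>
    using d(2)[of \<tau>] that h s t0 t by auto
  have "(LBINT \<tau>:{s..t0}. \<beta>min * (1 - l - \<eta>)) \<le> (LBINT \<tau>:{s<..t0}. R \<tau>)"
  proof -
    have "(LBINT \<tau>:{s..t0}. \<beta>min * (1 - l - \<eta>)) = (LBINT \<tau>:{s<..t0}. \<beta>min * (1 - l - \<eta>))"
      by (rule set_integral_discrete_difference[where X="{s}"]) auto
    also have "\<dots> \<le> (LBINT \<tau>:{s<..t0}. R \<tau>)"
    proof (rule set_integral_mono)
      show "set_integrable lborel {s<..t0} R"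
        by (rule R_integrable) (use t0 t in auto)
      show "set_integrable lborel {s<..t0} (\<lambda>_. \<beta>min * (1 - l - \<eta>))"
        by (rule set_integrable_subset[OF set_integrable_const_Icc[of s t0]]) auto
      fix \<tau> assume \<tau>: "\<tau> \<in> {s<..t0}"
      then show "\<beta>min * (1 - l - \<eta>) \<le> R \<tau>"
        using near[of \<tau>] s t0 t R_new[of \<tau>] \<beta>_bounds[of \<tau>] \<beta>min_pos \<eta> by (auto intro!: mult_mono)
    qed
    finally show ?thesis .
  qed
  then have new: "\<beta>min * (1 - l - \<eta>) * h \<le> (LBINT \<tau>:{s<..t0}. R \<tau>)"
    using s by (simp add: set_lebesgue_integral_def ac_simps)
  \<comment> \<open>The drift \<open>K * s\<close> before the step and \<open>K * h\<close> during
    it add up to \<open>K * t0\<close>, so exactly \<open>Q\<close> appears.\<close>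
  have "flux s + K * h * m s \<le> (\<zeta> 0 + q + K * s) * m s + K * h * m s"
    using flux_le[OF _ q initial, of s] s t0 t by simp
  also have "\<dots> = Q * m s"
    by (simp add: Q_def s_def algebra_simps)
  also have "\<dots> \<le> Q * (l + \<eta>)"
    using near[of s] s Qpos by (intro mult_left_mono) auto
  finally have old: "h / \<epsilon> * (flux s + K * h * m s) \<le> h / \<epsilon> * (Q * (l + \<eta>))"
    using h \<epsilon>_pos by (intro mult_left_mono) auto
  have new': "1 / \<epsilon> * c * (\<beta>min * (1 - l - \<eta>) * h) \<le> 1 / \<epsilon> * c * (LBINT \<tau>:{s<..t0}. R \<tau>)"
    using new c \<epsilon>_pos by (intro mult_left_mono) auto
  have "m s - h / \<epsilon> * (flux s + K * h * m s) + 1 / \<epsilon> * c * (LBINT \<tau>:{s<..t0}. R \<tau>) \<le> l"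
    using step_lower[of s t0] s t0 t by (simp add: c_def)
  with before[of s] s old new' have "1 / \<epsilon> * c * (\<beta>min * (1 - l - \<eta>) * h) < h / \<epsilon> * (Q * (l + \<eta>))"
    by linarith
  then have "h / \<epsilon> * (c * (\<beta>min * (1 - l - \<eta>))) < h / \<epsilon> * (Q * (l + \<eta>))"
    by (simp add: ac_simps)
  then have "c * (\<beta>min * (1 - l - \<eta>)) < Q * (l + \<eta>)"
    using h \<epsilon>_pos by (simp only: mult_less_cancel_left_pos divide_pos_pos)
  then have "\<kappa>1 < (1 - c) * (\<beta>min * (1 - l - \<eta>))"
    by (simp add: \<kappa>1_def algebra_simps)
  also have "\<dots> \<le> (h * B) * (\<beta>min * 1)"
    using cB \<eta> l \<beta>min_pos h B by (intro mult_mono) auto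
  also have "\<dots> < \<kappa>1" using hB by simp
  finally show False .
qed

end

section \<open>Quadratic moments and the coupling term\<close>

definition moment :: real
  where "moment = (LBINT \<tau>:{..T}. (1 + \<bar>\<tau>\<bar>)\<^sup>2 * R \<tau>)"

text \<open>The age integral of \<zeta>(w) w \<rho> in label form: the force before the term with
  the derivative of f is added and the mass divides.\<close>

definition coupling :: "real \<Rightarrow> real"
  where "coupling t = 1 / \<epsilon> * (LBINT \<tau>:{..t}. R \<tau> * (E \<tau> t * (rate \<tau> t * (H \<tau> + G t))))"

lemma moment_nonneg: "0 \<le> moment"
  unfolding moment_def set_lebesgue_integral_def
proof (rule integral_nonneg_AE)
  show "AE \<tau> in lborel. 0 \<le> indicator {..T} \<tau> *\<^sub>R ((1 + \<bar>\<tau>\<bar>)\<^sup>2 * R \<tau>)"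
    using R_nonneg by eventually_elim (auto simp: indicator_def)
qed

lemma E_times_growth:
  assumes f: "AE \<tau> in lborel. \<tau> \<le> T \<longrightarrow> \<bar>f \<tau>\<bar> \<le> B * (1 + \<bar>\<tau>\<bar>)\<^sup>2"
  shows "AE \<tau> in lborel. \<tau> \<le> T \<longrightarrow> \<bar>E \<tau> t * f \<tau>\<bar> \<le> B * (1 + \<bar>\<tau>\<bar>)\<^sup>2"
  using f
proof eventually_elim
  case (elim \<tau>)
  have "\<bar>E \<tau> t * f \<tau>\<bar> \<le> 1 * \<bar>f \<tau>\<bar>"
    unfolding abs_mult using E_pos[of \<tau> t] E_le_1[of \<tau> t] by (intro mult_right_mono) auto
  then show ?case using elim by auto
qed

lemma R_E_times_integrable:
  assumes [measurable]: "f \<in> borel_measurable borel"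
    and f: "AE \<tau> in lborel. \<tau> \<le> T \<longrightarrow> \<bar>f \<tau>\<bar> \<le> B * (1 + \<bar>\<tau>\<bar>)\<^sup>2" and "t \<le> T"
  shows "set_integrable lborel {..t} (\<lambda>\<tau>. R \<tau> * (E \<tau> t * f \<tau>))"
  by (rule moment_integrable[OF _ E_times_growth[OF f]]) (use \<open>t \<le> T\<close> in auto)

lemma R_E_times_bound:
  assumes f_measurable: "f \<in> borel_measurable borel"
    and f: "AE \<tau> in lborel. \<tau> \<le> T \<longrightarrow> \<bar>f \<tau>\<bar> \<le> B * (1 + \<bar>\<tau>\<bar>)\<^sup>2" and "t \<le> T"
  shows "\<bar>LBINT \<tau>:{..t}. R \<tau> * (E \<tau> t * f \<tau>)\<bar> \<le> B * moment"
proof -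
  have "\<bar>LBINT \<tau>:{..t}. R \<tau> * (E \<tau> t * f \<tau>)\<bar> \<le> (\<integral>\<tau>. indicator {..T} \<tau> *\<^sub>R (B * ((1 + \<bar>\<tau>\<bar>)\<^sup>2 * R \<tau>)) \<partial>lborel)"
    unfolding set_lebesgue_integral_def
  proof (rule order_trans[OF integral_abs_bound integral_mono_AE])
    show "integrable lborel (\<lambda>\<tau>. \<bar>indicator {..t} \<tau> *\<^sub>R (R \<tau> * (E \<tau> t * f \<tau>))\<bar>)"
      using R_E_times_integrable[OF assms] unfolding set_integrable_def by (rule integrable_abs)
    show "integrable lborel (\<lambda>\<tau>. indicator {..T} \<tau> *\<^sub>R (B * ((1 + \<bar>\<tau>\<bar>)\<^sup>2 * R \<tau>)))"
      using set_integrable_mult_right[OF R_moment, of B] unfolding set_integrable_def by blast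
    show "AE \<tau> in lborel. \<bar>indicator {..t} \<tau> *\<^sub>R (R \<tau> * (E \<tau> t * f \<tau>))\<bar>
        \<le> indicator {..T} \<tau> *\<^sub>R (B * ((1 + \<bar>\<tau>\<bar>)\<^sup>2 * R \<tau>))"
      using R_nonneg E_times_growth[OF f, of t]
    proof eventually_elim
      case (elim \<tau>)
      show ?case
      proof (cases "\<tau> \<le> T")
        case True
        then have le: "R \<tau> * \<bar>E \<tau> t * f \<tau>\<bar> \<le> R \<tau> * (B * (1 + \<bar>\<tau>\<bar>)\<^sup>2)"
          using elim by (intro mult_left_mono) auto
        have "0 \<le> R \<tau> * (B * (1 + \<bar>\<tau>\<bar>)\<^sup>2)"
          using elim True by (intro order_trans[OF _ le]) simp
        with le show ?thesis
          using elim True by (auto simp: indicator_def abs_mult ac_simps)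
      qed (use \<open>t \<le> T\<close> in \<open>auto simp: indicator_def\<close>)
    qed
  qed
  also have "\<dots> = B * moment"
    unfolding moment_def by (simp add: set_lebesgue_integral_def mult.left_commute[of _ B])
  finally show ?thesis .
qed

lemma elongation_growth:
  "AE \<tau> in lborel. \<tau> \<le> T \<longrightarrow> \<bar>H \<tau> + G t\<bar> \<le> 2 * C * (1 + \<bar>\<tau>\<bar>)"
  using H_growth
proof eventually_elim
  case (elim \<tau>)
  have "C \<le> C * (1 + \<bar>\<tau>\<bar>)" using C_nonneg by (simp add: distrib_left)
  then show ?case using elim G_bound[of t] by auto
qed

lemma rate_elongation_growth:
  "AE \<tau> in lborel. \<tau> \<le> T \<longrightarrow>
    \<bar>rate \<tau> t * (H \<tau> + G t)\<bar> \<le> ((\<zeta> 0 + 2 * L * C) * (2 * C)) * (1 + \<bar>\<tau>\<bar>)\<^sup>2"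
  using rate_growth[of t] elongation_growth[of t]
proof eventually_elim
  case (elim \<tau>)
  show ?case
  proof
    assume "\<tau> \<le> T"
    then have "\<bar>rate \<tau> t\<bar> * \<bar>H \<tau> + G t\<bar> \<le> ((\<zeta> 0 + 2 * L * C) * (1 + \<bar>\<tau>\<bar>)) * (2 * C * (1 + \<bar>\<tau>\<bar>))"
      using elim \<zeta>_pos[of "H \<tau> + G t"] \<zeta>_pos[of 0] L_nonneg C_nonneg by (intro mult_mono) auto
    then show "\<bar>rate \<tau> t * (H \<tau> + G t)\<bar> \<le> ((\<zeta> 0 + 2 * L * C) * (2 * C)) * (1 + \<bar>\<tau>\<bar>)\<^sup>2"
      by (simp only: abs_mult power2_eq_square ac_simps)
  qed
qed

lemma coupling_bound:
  assumes "t \<le> T"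
  shows "\<bar>coupling t\<bar> \<le> 1 / \<epsilon> * ((\<zeta> 0 + 2 * L * C) * (2 * C) * moment)"
proof -
  have "\<bar>LBINT \<tau>:{..t}. R \<tau> * (E \<tau> t * (rate \<tau> t * (H \<tau> + G t)))\<bar> \<le> (\<zeta> 0 + 2 * L * C) * (2 * C) * moment"
    by (rule R_E_times_bound[OF _ rate_elongation_growth assms]) measurable
  then show ?thesis
    using \<epsilon>_pos by (simp add: coupling_def abs_mult divide_right_mono)
qed

text \<open>Needed in \<open>deriv_measurable_of_coupling\<close>, where the derivative of f is
  recovered from the force.\<close>

lemma coupling_measurable: "coupling \<in> borel_measurable borel"
proof -
  have [measurable]: "(\<lambda>x. E (snd x) (fst x)) \<in> borel_measurable (borel \<Otimes>\<^sub>M borel)"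
    using measurable_compose[OF measurable_pair_swap' E_measurable_pair] by (simp add: case_prod_beta')
  have "(\<lambda>t. LBINT \<tau>:{..t}. R \<tau> * (E \<tau> t * (rate \<tau> t * (H \<tau> + G t))))
      = (\<lambda>t. \<integral>\<tau>. (if \<tau> \<le> t then R \<tau> * (E (snd (t, \<tau>)) (fst (t, \<tau>)) * (rate \<tau> t * (H \<tau> + G t))) else 0) \<partial>lborel)"
    by (auto simp: set_lebesgue_integral_def fun_eq_iff intro!: Bochner_Integration.integral_cong)
  also have "\<dots> \<in> borel_measurable borel"
    by measurable
  finally show ?thesis
    unfolding coupling_def by measurable
qed

text \<open>Survival factors are positive, so the mass can vanish only if the initial density
  vanishes almost everywhere, which \<open>0 < m 0\<close> excludes. No cut-off is involved, so this
  also applies to a competing solution.\<close>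

lemma m_pos:
  assumes t: "t \<in> {0..T}" and m0: "0 < m 0"
  shows "0 < m t"
proof (rule ccontr)
  assume "\<not> 0 < m t"
  then have "m t = 0" using m_nonneg[OF t] by simp
  then have "(LBINT \<tau>:{..t}. R \<tau> * E \<tau> t) = 0"
    using \<epsilon>_pos m_eq[OF t] by simp
  moreover have nn: "AE \<tau> in lborel. 0 \<le> indicator {..t} \<tau> *\<^sub>R (R \<tau> * E \<tau> t)"
    using R_nonneg by eventually_elim (use t in \<open>auto simp: indicator_def less_imp_le[OF E_pos]\<close>)
  moreover have "integrable lborel (\<lambda>\<tau>. indicator {..t} \<tau> *\<^sub>R (R \<tau> * E \<tau> t))"
    using R_E_integrable[of "{..t}"] t unfolding set_integrable_def by auto
  ultimately have "AE \<tau> in lborel. indicator {..t} \<tau> *\<^sub>R (R \<tau> * E \<tau> t) = 0"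
    by (simp add: set_lebesgue_integral_def integral_nonneg_eq_0_iff_AE)
  then have "AE \<tau> in lborel. \<tau> \<le> 0 \<longrightarrow> R \<tau> = 0"
  proof eventually_elim
    case (elim \<tau>)
    then show ?case using t E_pos[of \<tau> t] by (auto simp: indicator_def)
  qed
  then have "AE \<tau> in lborel. indicator {..0} \<tau> *\<^sub>R (R \<tau> * E \<tau> 0) = 0"
    by eventually_elim (auto simp: indicator_def)
  then have "(LBINT \<tau>:{..0}. R \<tau> * E \<tau> 0) = 0"
    unfolding set_lebesgue_integral_def by (rule integral_eq_zero_AE)
  then have "m 0 = 0"
    using m_eq[of 0] T_pos by simp
  with m0 show False by simp
qed

end

section \<open>Comparison of two solutions\<close>

lemma abs_exp_minus_diff_le:
  fixes x y :: real
  assumes "0 \<le> x" "0 \<le> y"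
  shows "\<bar>exp (- x) - exp (- y)\<bar> \<le> \<bar>x - y\<bar>"
proof -
  have le: "1 - exp (- d) \<le> d" for d :: real
    using exp_ge_add_one_self[of "- d"] by linarith
  have *: "exp (- x) - exp (- y) \<le> y - x" if "0 \<le> x" "x \<le> y" for x y :: real
  proof -
    have "exp (- x) - exp (- y) = exp (- x) * (1 - exp (- (y - x)))"
      by (simp add: right_diff_distrib flip: exp_add)
    also have "\<dots> \<le> 1 * (1 - exp (- (y - x)))"
      using that by (intro mult_right_mono) auto
    also have "\<dots> \<le> y - x"
      using le[of "y - x"] by (simp only: mult_1)
    finally show ?thesis .
  qed
  show ?thesis
    using *[of x y] *[of y x] assms by (cases "x \<le> y") auto
qed

text \<open>The factor \<open>1 / k\<close> gained by integrating in time is the source of the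
  contraction.\<close>

lemma set_integral_exp_le:
  fixes k :: real
  assumes "0 < k" "0 \<le> c" "a \<le> t"
  shows "(LBINT r:{a..t}. c * exp (k * r)) \<le> c * exp (k * t) / k"
    and "set_integrable lborel {a..t} (\<lambda>r. c * exp (k * r))"
proof -
  show int: "set_integrable lborel {a..t} (\<lambda>r. c * exp (k * r))"
    unfolding set_integrable_def by (rule borel_integrable_compact) (auto intro!: continuous_intros)
  have "((\<lambda>r. c * exp (k * r)) has_integral c * exp (k * t) / k - c * exp (k * a) / k) {a..t}"
    by (rule fundamental_theorem_of_calculus)
      (use assms in \<open>auto intro!: derivative_eq_intros simp flip: has_real_derivative_iff_has_vector_derivative\<close>)
  then have "(LBINT r:{a..t}. c * exp (k * r)) = c * exp (k * t) / k - c * exp (k * a) / k"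
    using set_borel_integral_eq_integral(2)[OF int] by (simp only: integral_unique)
  then show "(LBINT r:{a..t}. c * exp (k * r)) \<le> c * exp (k * t) / k"
    using assms by simp
qed

lemma abs_diff_mult_left:
  fixes c x y :: real
  assumes "0 < c"
  shows "\<bar>c * x - c * y\<bar> = c * \<bar>x - y\<bar>"
  using assms by (simp add: abs_mult flip: right_diff_distrib)

text \<open>The common initial data appear as equality of \<open>H\<close> and \<open>R\<close> on
  labels \<open>\<tau> \<le> 0\<close>; on positive labels these functions depend on the solution
  through \<open>G\<close> and \<open>m\<close>. The common lower bound \<mu> makes division by the
  masses Lipschitz.\<close>

locale renewal_pair =
  A: renewal \<epsilon> T \<zeta>min L C \<beta>min \<beta>max \<zeta> \<beta> G H R m +
  B: renewal \<epsilon> T \<zeta>min L C \<beta>min \<beta>max \<zeta> \<beta> G' H' R' m'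
  for \<epsilon> T \<zeta>min L C \<beta>min \<beta>max :: real and \<zeta> \<beta> G H R m G' H' R' m' :: "real \<Rightarrow> real" +
  fixes f' g g' :: "real \<Rightarrow> real" and F \<mu> :: real
  assumes H_eq: "\<And>\<tau>. \<tau> \<le> 0 \<Longrightarrow> H \<tau> = H' \<tau>" and R_eq: "\<And>\<tau>. \<tau> \<le> 0 \<Longrightarrow> R \<tau> = R' \<tau>"
    and \<mu>_pos: "0 < \<mu>" and m_ge: "\<And>t. t \<in> {0..T} \<Longrightarrow> \<mu> \<le> m t \<and> \<mu> \<le> m' t"
    and f'_bound: "\<And>t. t \<in> {0<..<T} \<Longrightarrow> \<bar>f' t\<bar> \<le> F"
    and g_eq: "\<And>t. t \<in> {0<..<T} \<Longrightarrow> g t = 1 / m t * (\<epsilon> * f' t + A.coupling t)"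
    and g'_eq: "\<And>t. t \<in> {0<..<T} \<Longrightarrow> g' t = 1 / m' t * (\<epsilon> * f' t + B.coupling t)"
    and G_eq: "\<And>t. t \<in> {0..T} \<Longrightarrow> G t = 1 / \<epsilon> * (LBINT s:{0..t}. g s)"
    and G'_eq: "\<And>t. t \<in> {0..T} \<Longrightarrow> G' t = 1 / \<epsilon> * (LBINT s:{0..t}. g' s)"
    and g_integrable: "set_integrable lborel {0..T} g" "set_integrable lborel {0..T} g'"
begin

section \<open>Estimates for two solutions at distance at most N exp(k t)\<close>

context
  fixes k N :: real
  assumes k: "1 \<le> k" and N: "0 \<le> N"
    and G_close: "\<And>s. s \<in> {0..T} \<Longrightarrow> \<bar>G s - G' s\<bar> \<le> N * exp (k * s)"
    and m_close: "\<And>s. s \<in> {0..T} \<Longrightarrow> \<bar>m s - m' s\<bar> \<le> N * exp (k * s)"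
begin

text \<open>Besides the error of \<open>G\<close> at time \<open>r\<close>, a positive label carries
  through \<open>H \<tau> = - G \<tau>\<close> the error at its birth time, which the bound at time
  \<open>r\<close> dominates; hence the factor 2.\<close>

lemma elongation_close:
  assumes "\<tau> \<le> r" "r \<in> {0..T}"
  shows "\<bar>(H \<tau> + G r) - (H' \<tau> + G' r)\<bar> \<le> 2 * N * exp (k * r)"
proof -
  have "\<bar>H \<tau> - H' \<tau>\<bar> \<le> N * exp (k * r)"
  proof (cases "0 < \<tau>")
    case True
    then have "\<bar>H \<tau> - H' \<tau>\<bar> \<le> N * exp (k * \<tau>)"
      using G_close[of \<tau>] A.H_new[of \<tau>] B.H_new[of \<tau>] assms by (auto simp: abs_minus_commute)
    also have "\<dots> \<le> N * exp (k * r)"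
      using N k assms by (intro mult_left_mono) auto
    finally show ?thesis .
  qed (use H_eq N in auto)
  then show ?thesis using G_close[OF assms(2)] by linarith
qed

text \<open>The rates differ by at most a multiple of \<open>N * exp (k * r)\<close>, and the
  exponent integrates this over the lifetime, which gains \<open>1 / k\<close>.\<close>

lemma survival_close:
  assumes "\<tau> \<le> t" "t \<in> {0..T}"
  shows "\<bar>A.E \<tau> t - B.E \<tau> t\<bar> \<le> 2 * L * N / (\<epsilon> * k) * exp (k * t)"
proof -
  let ?I = "LBINT r:{max \<tau> 0..t}. A.rate \<tau> r" and ?J = "LBINT r:{max \<tau> 0..t}. B.rate \<tau> r"
  have nn: "0 \<le> ?I" "0 \<le> ?J"
    unfolding set_lebesgue_integral_def
    by (intro integral_nonneg_AE; auto simp: less_imp_le[OF A.\<zeta>_pos])+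
  have "?I - ?J = (LBINT r:{max \<tau> 0..t}. A.rate \<tau> r - B.rate \<tau> r)"
    by (rule set_integral_diff(2)[symmetric]) (rule A.rate_integrable B.rate_integrable)+
  also have "\<bar>\<dots>\<bar> \<le> (LBINT r:{max \<tau> 0..t}. \<bar>A.rate \<tau> r - B.rate \<tau> r\<bar>)"
    unfolding set_lebesgue_integral_def
    by (intro order_trans[OF integral_abs_bound]) (simp add: abs_mult)
  also have "\<dots> \<le> (LBINT r:{max \<tau> 0..t}. 2 * L * N * exp (k * r))"
  proof (rule set_integral_mono)
    show "set_integrable lborel {max \<tau> 0..t} (\<lambda>r. \<bar>A.rate \<tau> r - B.rate \<tau> r\<bar>)"
      by (intro set_integrable_abs set_integral_diff(1) A.rate_integrable B.rate_integrable)
    show "set_integrable lborel {max \<tau> 0..t} (\<lambda>r. 2 * L * N * exp (k * r))"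
      by (rule set_integral_exp_le(2)) (use k N A.L_nonneg assms in auto)
    fix r assume r: "r \<in> {max \<tau> 0..t}"
    have "\<bar>A.rate \<tau> r - B.rate \<tau> r\<bar> \<le> L * \<bar>(H \<tau> + G r) - (H' \<tau> + G' r)\<bar>"
      by (rule A.\<zeta>_diff)
    also have "\<dots> \<le> L * (2 * N * exp (k * r))"
      using A.L_nonneg r assms by (intro mult_left_mono elongation_close) auto
    finally show "\<bar>A.rate \<tau> r - B.rate \<tau> r\<bar> \<le> 2 * L * N * exp (k * r)"
      by (simp add: ac_simps)
  qed
  also have "\<dots> \<le> 2 * L * N * exp (k * t) / k"
    by (rule set_integral_exp_le(1)) (use k N A.L_nonneg assms in auto)
  finally have IJ: "\<bar>?I - ?J\<bar> \<le> 2 * L * N * exp (k * t) / k" .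
  have "\<bar>A.E \<tau> t - B.E \<tau> t\<bar> \<le> \<bar>1 / \<epsilon> * ?I - 1 / \<epsilon> * ?J\<bar>"
    unfolding survival_def by (rule abs_exp_minus_diff_le) (use nn A.\<epsilon>_pos in auto)
  also have "\<dots> = 1 / \<epsilon> * \<bar>?I - ?J\<bar>"
    by (rule abs_diff_mult_left) (use A.\<epsilon>_pos in simp)
  also have "\<dots> \<le> 1 / \<epsilon> * (2 * L * N * exp (k * t) / k)"
    using IJ A.\<epsilon>_pos by (intro mult_left_mono) auto
  finally show ?thesis by (simp add: ac_simps)
qed

text \<open>The first term comes from the survival factors, integrated against \<open>R\<close>; the
  second from the births on labels between 0 and \<open>T\<close>, where the weight is at most
  \<open>(1 + T)\<^sup>2\<close>.\<close>

definition density_const :: real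
  where "density_const = 2 * L / \<epsilon> * A.moment + \<beta>max * (1 + T)\<^sup>2"

text \<open>With the same \<open>f\<close> on both sides only survival and density vary. The
  survival difference brings \<open>1 / k\<close> from \<open>survival_close\<close>; the density
  difference lives on labels between 0 and \<open>t\<close>, where integrating
  \<open>exp (k * \<tau>)\<close> yields \<open>1 / k\<close> again.\<close>

lemma R_E_close:
  assumes f [measurable]: "f \<in> borel_measurable borel"
    and fB: "AE \<tau> in lborel. \<tau> \<le> T \<longrightarrow> \<bar>f \<tau>\<bar> \<le> D * (1 + \<bar>\<tau>\<bar>)\<^sup>2" and D: "0 \<le> D" and t: "t \<in> {0..T}"
  shows "\<bar>(LBINT \<tau>:{..t}. R \<tau> * (A.E \<tau> t * f \<tau>)) - (LBINT \<tau>:{..t}. R' \<tau> * (B.E \<tau> t * f \<tau>))\<bar>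
    \<le> D * density_const * (N * exp (k * t) / k)"
proof -
  let ?c = "2 * L * N / (\<epsilon> * k) * exp (k * t)"
  let ?v = "\<lambda>\<tau>. indicator {..T} \<tau> *\<^sub>R ((1 + \<bar>\<tau>\<bar>)\<^sup>2 * R \<tau>)"
  let ?b = "\<lambda>\<tau>. indicator {0..t} \<tau> *\<^sub>R (\<beta>max * N * exp (k * \<tau>))"
  have c: "0 \<le> ?c" using A.L_nonneg N A.\<epsilon>_pos k by auto
  have bint: "integrable lborel ?b" and bI: "integral\<^sup>L lborel ?b \<le> \<beta>max * N * exp (k * t) / k"
    using set_integral_exp_le[of k "\<beta>max * N" 0 t, unfolded set_integrable_def set_lebesgue_integral_def]
      k N t A.\<beta>max_pos by (simp_all del: real_scaleR_def)
  have vint: "integrable lborel ?v" and vI: "integral\<^sup>L lborel ?v = A.moment"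
    using A.R_moment by (simp_all add: set_integrable_def set_lebesgue_integral_def A.moment_def)
  have iA: "set_integrable lborel {..t} (\<lambda>\<tau>. R \<tau> * (A.E \<tau> t * f \<tau>))"
    by (rule A.R_E_times_integrable[OF f fB]) (use t in auto)
  have iB: "set_integrable lborel {..t} (\<lambda>\<tau>. R' \<tau> * (B.E \<tau> t * f \<tau>))"
    by (rule B.R_E_times_integrable[OF f fB]) (use t in auto)
  let ?d = "\<lambda>\<tau>. R \<tau> * (A.E \<tau> t * f \<tau>) - R' \<tau> * (B.E \<tau> t * f \<tau>)"
  have "\<bar>LBINT \<tau>:{..t}. ?d \<tau>\<bar> \<le> (\<integral>\<tau>. D * (?c * ?v \<tau> + (1 + T)\<^sup>2 * ?b \<tau>) \<partial>lborel)"
    unfolding set_lebesgue_integral_def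
  proof (rule order_trans[OF integral_abs_bound integral_mono_AE])
    show "integrable lborel (\<lambda>\<tau>. \<bar>indicator {..t} \<tau> *\<^sub>R ?d \<tau>\<bar>)"
      using set_integral_diff(1)[OF iA iB] unfolding set_integrable_def by (rule integrable_abs)
    show "integrable lborel (\<lambda>\<tau>. D * (?c * ?v \<tau> + (1 + T)\<^sup>2 * ?b \<tau>))"
      by (intro integrable_mult_right Bochner_Integration.integrable_add vint bint)
    show "AE \<tau> in lborel. \<bar>indicator {..t} \<tau> *\<^sub>R ?d \<tau>\<bar> \<le> D * (?c * ?v \<tau> + (1 + T)\<^sup>2 * ?b \<tau>)"
      using fB A.R_nonneg AE_lborel_singleton[of 0]
    proof eventually_elim
      case (elim \<tau>)
      show ?case
      proof (cases "\<tau> \<le> t")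
        case False
        have "0 \<le> D * (?c * ?v \<tau>)"
          by (rule mult_nonneg_nonneg[OF D mult_nonneg_nonneg[OF c]]) (use elim in \<open>auto simp: indicator_def\<close>)
        then show ?thesis using False t by (simp add: indicator_def)
      next
        case True
        then have \<tau>T: "\<tau> \<le> T" using t by auto
        let ?W = "(1 + \<bar>\<tau>\<bar>)\<^sup>2"
        have R0: "0 \<le> R \<tau>" using elim \<tau>T by blast
        have fW: "\<bar>f \<tau>\<bar> \<le> D * ?W" using elim \<tau>T by blast
        have RR: "\<bar>R \<tau> - R' \<tau>\<bar> * ?W \<le> (1 + T)\<^sup>2 * ?b \<tau>"
        proof (cases "0 < \<tau>")
          case new: True
          have "\<bar>R \<tau> - R' \<tau>\<bar> = \<beta> \<tau> * \<bar>m \<tau> - m' \<tau>\<bar>"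
          proof -
            have "R \<tau> - R' \<tau> = \<beta> \<tau> * (m' \<tau> - m \<tau>)"
              using A.R_new[OF new \<tau>T] B.R_new[OF new \<tau>T] by (simp add: algebra_simps)
            then show ?thesis
              using A.\<beta>_bounds[of \<tau>] A.\<beta>min_pos new by (simp add: abs_mult abs_minus_commute)
          qed
          also have "\<dots> \<le> \<beta>max * (N * exp (k * \<tau>))"
            using m_close[of \<tau>] A.\<beta>_bounds[of \<tau>] A.\<beta>min_pos new \<tau>T by (intro mult_mono) auto
          finally have "\<bar>R \<tau> - R' \<tau>\<bar> * ?W \<le> \<beta>max * (N * exp (k * \<tau>)) * (1 + T)\<^sup>2"
            using new \<tau>T A.\<beta>max_pos N by (intro mult_mono power_mono) auto
          then show ?thesis using new True by (simp add: ac_simps)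
        next
          case False
          then show ?thesis using R_eq[of \<tau>] A.\<beta>max_pos N by (simp add: indicator_def)
        qed
        have "?d \<tau> = (R \<tau> * (A.E \<tau> t - B.E \<tau> t) + (R \<tau> - R' \<tau>) * B.E \<tau> t) * f \<tau>"
          by (simp add: algebra_simps)
        then have "\<bar>?d \<tau>\<bar> = \<bar>R \<tau> * (A.E \<tau> t - B.E \<tau> t) + (R \<tau> - R' \<tau>) * B.E \<tau> t\<bar> * \<bar>f \<tau>\<bar>"
          by (simp add: abs_mult)
        also have "\<dots> \<le> (R \<tau> * ?c + \<bar>R \<tau> - R' \<tau>\<bar>) * (D * ?W)"
        proof (rule mult_mono)
          have "\<bar>R \<tau> * (A.E \<tau> t - B.E \<tau> t)\<bar> \<le> R \<tau> * ?c"
            using mult_left_mono[OF survival_close[OF True t] R0] by (simp only: abs_mult abs_of_nonneg[OF R0])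
          moreover have "\<bar>(R \<tau> - R' \<tau>) * B.E \<tau> t\<bar> \<le> \<bar>R \<tau> - R' \<tau>\<bar>"
            unfolding abs_mult using B.E_pos[of \<tau> t] B.E_le_1[of \<tau> t] by (intro mult_left_le) auto
          ultimately show "\<bar>R \<tau> * (A.E \<tau> t - B.E \<tau> t) + (R \<tau> - R' \<tau>) * B.E \<tau> t\<bar> \<le> R \<tau> * ?c + \<bar>R \<tau> - R' \<tau>\<bar>"
            by (rule order_trans[OF abs_triangle_ineq add_mono])
          show "0 \<le> R \<tau> * ?c + \<bar>R \<tau> - R' \<tau>\<bar>"
            by (intro add_nonneg_nonneg mult_nonneg_nonneg[OF R0 c]) simp
        qed (use fW in auto)
        also have "\<dots> = D * (?c * (?W * R \<tau>) + \<bar>R \<tau> - R' \<tau>\<bar> * ?W)"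
          by (simp add: algebra_simps)
        also have "\<dots> \<le> D * (?c * ?v \<tau> + (1 + T)\<^sup>2 * ?b \<tau>)"
        proof -
          have "?v \<tau> = ?W * R \<tau>" using \<tau>T by simp
          then show ?thesis using RR by (simp only: add_left_mono mult_left_mono[OF _ D])
        qed
        finally show ?thesis using True by simp
      qed
    qed
  qed
  also have "\<dots> = D * (?c * A.moment + (1 + T)\<^sup>2 * integral\<^sup>L lborel ?b)"
  proof -
    have "(\<integral>\<tau>. D * (c * v \<tau> + q * b \<tau>) \<partial>lborel) = D * (c * integral\<^sup>L lborel v + q * integral\<^sup>L lborel b)"
      if "integrable lborel v" "integrable lborel b" for v b :: "real \<Rightarrow> real" and c q
      using that by simp
    from this[OF vint bint] show ?thesis by (simp only: vI)
  qed
  also have "\<dots> \<le> D * (?c * A.moment + (1 + T)\<^sup>2 * (\<beta>max * N * exp (k * t) / k))"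
    using bI D by (intro mult_left_mono add_left_mono) auto
  also have "\<dots> = D * density_const * (N * exp (k * t) / k)"
    using k A.\<epsilon>_pos by (simp add: density_const_def field_simps)
  finally show ?thesis
    by (simp add: set_integral_diff(2)[OF iA iB])
qed

lemma m_contraction:
  assumes t: "t \<in> {0..T}"
  shows "\<bar>m t - m' t\<bar> \<le> density_const / \<epsilon> * (N * exp (k * t) / k)"
proof -
  have "\<bar>(LBINT \<tau>:{..t}. R \<tau> * (A.E \<tau> t * 1)) - (LBINT \<tau>:{..t}. R' \<tau> * (B.E \<tau> t * 1))\<bar>
      \<le> 1 * density_const * (N * exp (k * t) / k)"
    by (rule R_E_close[OF _ _ _ t]) (use A.one_le_weight in auto)
  then have "1 / \<epsilon> * \<bar>(LBINT \<tau>:{..t}. R \<tau> * A.E \<tau> t) - (LBINT \<tau>:{..t}. R' \<tau> * B.E \<tau> t)\<bar>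
      \<le> 1 / \<epsilon> * (density_const * (N * exp (k * t) / k))"
    using A.\<epsilon>_pos by (intro mult_left_mono) auto
  moreover have "\<bar>m t - m' t\<bar> = 1 / \<epsilon> * \<bar>(LBINT \<tau>:{..t}. R \<tau> * A.E \<tau> t) - (LBINT \<tau>:{..t}. R' \<tau> * B.E \<tau> t)\<bar>"
    unfolding A.m_eq[OF t] B.m_eq[OF t] by (rule abs_diff_mult_left) (use A.\<epsilon>_pos in simp)
  ultimately show ?thesis by simp
qed

definition coupling_const :: real
  where "coupling_const = 1 / \<epsilon> * (2 * (\<zeta> 0 + 4 * L * C) * A.moment
    + (\<zeta> 0 + 2 * L * C) * (2 * C) * density_const)"

text \<open>There is no factor \<open>1 / k\<close> here: the elongations at time \<open>t\<close>
  may differ by \<open>2 * N * exp (k * t)\<close> without any integration in time. It is recovered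
  when \<open>G_contraction\<close> integrates the force.\<close>

lemma coupling_close:
  assumes t: "t \<in> {0..T}"
  shows "\<bar>A.coupling t - B.coupling t\<bar> \<le> coupling_const * (N * exp (k * t))"
proof -
  let ?f = "\<lambda>\<tau>. A.rate \<tau> t * (H \<tau> + G t)" and ?f' = "\<lambda>\<tau>. B.rate \<tau> t * (H' \<tau> + G' t)"
  let ?D = "(\<zeta> 0 + 4 * L * C) * (2 * N * exp (k * t))"
  let ?D' = "(\<zeta> 0 + 2 * L * C) * (2 * C)"
  \<comment> \<open>The indicator reconciles \<open>elongation_close\<close>, which compares labels
    \<open>\<tau> \<le> t\<close>, with \<open>R_E_times_bound\<close>, which asks for a growth
    bound on all labels up to \<open>T\<close>.\<close>
  have fm: "(\<lambda>\<tau>. indicator {..t} \<tau> * (?f \<tau> - ?f' \<tau>)) \<in> borel_measurable borel"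
    and f'm: "?f' \<in> borel_measurable borel" and fm0: "?f \<in> borel_measurable borel"
    by measurable
  have D': "0 \<le> ?D'" using A.\<zeta>_pos[of 0] A.L_nonneg A.C_nonneg by auto
  have diff: "AE \<tau> in lborel. \<tau> \<le> T \<longrightarrow> \<bar>indicator {..t} \<tau> * (?f \<tau> - ?f' \<tau>)\<bar> \<le> ?D * (1 + \<bar>\<tau>\<bar>)\<^sup>2"
    using A.rate_growth[of t] B.elongation_growth[of t]
  proof eventually_elim
    case (elim \<tau>)
    show ?case
    proof
      assume \<tau>: "\<tau> \<le> T"
      let ?w = "H \<tau> + G t" and ?w' = "H' \<tau> + G' t"
      have D: "0 \<le> ?D" using A.\<zeta>_pos[of 0] A.L_nonneg A.C_nonneg N by auto
      show "\<bar>indicator {..t} \<tau> * (?f \<tau> - ?f' \<tau>)\<bar> \<le> ?D * (1 + \<bar>\<tau>\<bar>)\<^sup>2"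
      proof (cases "\<tau> \<le> t")
        case True
        have "?f \<tau> - ?f' \<tau> = A.rate \<tau> t * (?w - ?w') + (A.rate \<tau> t - B.rate \<tau> t) * ?w'"
          by (simp add: algebra_simps)
        then have "\<bar>?f \<tau> - ?f' \<tau>\<bar> \<le> \<bar>A.rate \<tau> t * (?w - ?w')\<bar> + \<bar>(A.rate \<tau> t - B.rate \<tau> t) * ?w'\<bar>"
          by linarith
        also have "\<dots> \<le> A.rate \<tau> t * \<bar>?w - ?w'\<bar> + (L * \<bar>?w - ?w'\<bar>) * \<bar>?w'\<bar>"
          using A.\<zeta>_pos[of ?w] A.\<zeta>_diff[of ?w ?w'] by (auto simp: abs_mult intro!: mult_right_mono)
        also have "\<dots> = (A.rate \<tau> t + L * \<bar>?w'\<bar>) * \<bar>?w - ?w'\<bar>"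
          by (simp add: algebra_simps)
        also have "\<dots> \<le> ((\<zeta> 0 + 2 * L * C) * (1 + \<bar>\<tau>\<bar>) + L * (2 * C * (1 + \<bar>\<tau>\<bar>))) * (2 * N * exp (k * t))"
          using elim \<tau> elongation_close[OF True t] A.L_nonneg A.C_nonneg A.\<zeta>_pos[of 0]
          by (intro mult_mono add_mono) auto
        also have "\<dots> = ?D * (1 + \<bar>\<tau>\<bar>)"
          by (simp add: algebra_simps)
        also have "\<dots> \<le> ?D * (1 + \<bar>\<tau>\<bar>)\<^sup>2"
          using D A.le_weight by (intro mult_left_mono) auto
        finally show ?thesis using True by simp
      qed (use D in auto)
    qed
  qed
  have ind: "(LBINT \<tau>:{..t}. R \<tau> * (A.E \<tau> t * (indicator {..t} \<tau> * (?f \<tau> - ?f' \<tau>))))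
      = (LBINT \<tau>:{..t}. R \<tau> * (A.E \<tau> t * ?f \<tau>) - R \<tau> * (A.E \<tau> t * ?f' \<tau>))"
    unfolding set_lebesgue_integral_def
    by (rule Bochner_Integration.integral_cong) (auto simp: indicator_def algebra_simps)
  have "\<bar>(LBINT \<tau>:{..t}. R \<tau> * (A.E \<tau> t * (indicator {..t} \<tau> * (?f \<tau> - ?f' \<tau>))))\<bar> \<le> ?D * A.moment"
    by (rule A.R_E_times_bound[OF fm diff]) (use t in auto)
  then have 1: "\<bar>(LBINT \<tau>:{..t}. R \<tau> * (A.E \<tau> t * ?f \<tau>)) - (LBINT \<tau>:{..t}. R \<tau> * (A.E \<tau> t * ?f' \<tau>))\<bar> \<le> ?D * A.moment"
    unfolding ind using t
    by (subst (asm) set_integral_diff(2))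
      (auto intro!: A.R_E_times_integrable[OF fm0 A.rate_elongation_growth]
        A.R_E_times_integrable[OF f'm B.rate_elongation_growth])
  have 2: "\<bar>(LBINT \<tau>:{..t}. R \<tau> * (A.E \<tau> t * ?f' \<tau>)) - (LBINT \<tau>:{..t}. R' \<tau> * (B.E \<tau> t * ?f' \<tau>))\<bar>
      \<le> ?D' * density_const * (N * exp (k * t) / k)"
    by (rule R_E_close[OF f'm B.rate_elongation_growth D' t])
  also have "\<dots> \<le> ?D' * density_const * (N * exp (k * t))"
  proof (rule mult_left_mono)
    show "N * exp (k * t) / k \<le> N * exp (k * t)"
      using divide_left_mono[of 1 k "N * exp (k * t)"] k N by simp
    have "0 \<le> density_const"
      using A.L_nonneg A.\<epsilon>_pos A.moment_nonneg A.\<beta>max_pos by (simp add: density_const_def)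
    then show "0 \<le> ?D' * density_const" using D' by simp
  qed
  finally have "\<bar>(LBINT \<tau>:{..t}. R \<tau> * (A.E \<tau> t * ?f \<tau>)) - (LBINT \<tau>:{..t}. R' \<tau> * (B.E \<tau> t * ?f' \<tau>))\<bar>
      \<le> ?D * A.moment + ?D' * density_const * (N * exp (k * t))"
    using 1 by linarith
  then have "1 / \<epsilon> * \<bar>(LBINT \<tau>:{..t}. R \<tau> * (A.E \<tau> t * ?f \<tau>)) - (LBINT \<tau>:{..t}. R' \<tau> * (B.E \<tau> t * ?f' \<tau>))\<bar>
      \<le> 1 / \<epsilon> * (?D * A.moment + ?D' * density_const * (N * exp (k * t)))"
    using A.\<epsilon>_pos by (intro mult_left_mono) auto
  also have "\<dots> = coupling_const * (N * exp (k * t))"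
    by (simp add: coupling_const_def algebra_simps add_divide_distrib)
  finally show ?thesis
    unfolding A.coupling_def B.coupling_def
    by (subst abs_diff_mult_left) (use A.\<epsilon>_pos in simp_all)
qed

definition force_const :: real
  where "force_const = coupling_const / \<mu>
    + (\<epsilon> * F + 1 / \<epsilon> * ((\<zeta> 0 + 2 * L * C) * (2 * C) * B.moment)) / (\<mu> * \<mu>)"

text \<open>In the difference of the quotients the common term with f' survives only as a factor of
  \<open>m' - m\<close>, so boundedness of f' is enough; \<mu> controls the denominators.\<close>

lemma force_close:
  assumes t: "t \<in> {0<..<T}"
  shows "\<bar>g t - g' t\<bar> \<le> force_const * (N * exp (k * t))"
proof -
  have t': "t \<in> {0..T}" using t by auto
  have m: "\<mu> \<le> m t" "\<mu> \<le> m' t" "0 < m t" "0 < m' t" using m_ge[OF t'] \<mu>_pos by auto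
  let ?S = "\<epsilon> * F + 1 / \<epsilon> * ((\<zeta> 0 + 2 * L * C) * (2 * C) * B.moment)"
  have "\<bar>\<epsilon> * f' t\<bar> \<le> \<epsilon> * F"
    using f'_bound[OF t] A.\<epsilon>_pos by (simp add: abs_mult)
  then have S: "\<bar>\<epsilon> * f' t + B.coupling t\<bar> \<le> ?S"
    using B.coupling_bound[of t] t by auto
  have eq: "g t - g' t = (A.coupling t - B.coupling t) / m t + (\<epsilon> * f' t + B.coupling t) * (m' t - m t) / (m t * m' t)"
  proof -
    have "1 / a * (p + x) - 1 / b * (p + y) = (x - y) / a + (p + y) * (b - a) / (a * b)"
      if "0 < a" "0 < b" for a b p x y :: real
      using that by (simp add: field_simps)
    from this[OF m(3,4)] show ?thesis
      unfolding g_eq[OF t] g'_eq[OF t] .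
  qed
  have "\<bar>g t - g' t\<bar> \<le> \<bar>(A.coupling t - B.coupling t) / m t\<bar>
      + \<bar>(\<epsilon> * f' t + B.coupling t) * (m' t - m t) / (m t * m' t)\<bar>"
    unfolding eq by (rule abs_triangle_ineq)
  also have "\<dots> = \<bar>A.coupling t - B.coupling t\<bar> / m t + (\<bar>\<epsilon> * f' t + B.coupling t\<bar> * \<bar>m' t - m t\<bar>) / (m t * m' t)"
    using m(3,4) by (simp only: abs_mult abs_divide abs_of_pos)
  also have "\<dots> \<le> coupling_const * (N * exp (k * t)) / \<mu> + (?S * (N * exp (k * t))) / (\<mu> * \<mu>)"
  proof (rule add_mono)
    have nn: "0 \<le> coupling_const * (N * exp (k * t))"
      by (rule order_trans[OF abs_ge_zero coupling_close[OF t']])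
    show "\<bar>A.coupling t - B.coupling t\<bar> / m t \<le> coupling_const * (N * exp (k * t)) / \<mu>"
      by (rule frac_le[OF nn coupling_close[OF t'] \<mu>_pos m(1)])
    have le: "\<bar>\<epsilon> * f' t + B.coupling t\<bar> * \<bar>m' t - m t\<bar> \<le> ?S * (N * exp (k * t))"
      using S m_close[OF t'] by (intro mult_mono) (auto simp: abs_minus_commute intro: order_trans[OF abs_ge_zero S])
    have nn': "0 \<le> ?S * (N * exp (k * t))"
      using order_trans[OF abs_ge_zero S] N by simp
    have \<mu>\<mu>: "\<mu> * \<mu> \<le> m t * m' t"
      using m \<mu>_pos by (intro mult_mono) auto
    show "(\<bar>\<epsilon> * f' t + B.coupling t\<bar> * \<bar>m' t - m t\<bar>) / (m t * m' t) \<le> (?S * (N * exp (k * t))) / (\<mu> * \<mu>)"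
      by (rule frac_le[OF nn' le _ \<mu>\<mu>]) (use \<mu>_pos in simp)
  qed
  also have "\<dots> = force_const * (N * exp (k * t))"
    by (simp add: force_const_def algebra_simps)
  finally show ?thesis .
qed

lemma G_contraction:
  assumes t: "t \<in> {0..T}"
  shows "\<bar>G t - G' t\<bar> \<le> force_const / \<epsilon> * (N * exp (k * t) / k)"
proof -
  have i: "set_integrable lborel {0..t} g" "set_integrable lborel {0..t} g'"
    by (rule set_integrable_subset[OF g_integrable(1)] set_integrable_subset[OF g_integrable(2)]; use t in auto)+
  \<comment> \<open>Integrating the bound requires a nonnegative constant; the sign of
    \<open>force_const * N\<close> is read off from \<open>force_close\<close> at one interior
    time.\<close>
  have "T / 2 \<in> {0<..<T}" using A.T_pos by auto
  from force_close[OF this] have nn0: "0 \<le> force_const * (N * exp (k * (T / 2)))"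
    by (rule order_trans[OF abs_ge_zero])
  then have "0 \<le> (force_const * N) * exp (k * (T / 2))"
    by (simp only: mult.assoc)
  then have nn: "0 \<le> force_const * N"
    by (metis exp_gt_zero mult_neg_pos not_le)
  have "\<bar>(LBINT s:{0..t}. g s) - (LBINT s:{0..t}. g' s)\<bar> = \<bar>LBINT s:{0..t}. g s - g' s\<bar>"
    using i by simp
  also have "\<dots> \<le> (LBINT s:{0..t}. \<bar>g s - g' s\<bar>)"
    unfolding set_lebesgue_integral_def
    by (intro order_trans[OF integral_abs_bound]) (simp add: abs_mult)
  also have "\<dots> \<le> (LBINT s:{0..t}. (force_const * N) * exp (k * s))"
  proof (rule set_integral_mono_AE)
    show "set_integrable lborel {0..t} (\<lambda>s. \<bar>g s - g' s\<bar>)"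
      by (intro set_integrable_abs set_integral_diff(1) i)
    show "set_integrable lborel {0..t} (\<lambda>s. (force_const * N) * exp (k * s))"
      by (rule set_integral_exp_le(2)) (use k nn t in auto)
    show "AE s\<in>{0..t} in lborel. \<bar>g s - g' s\<bar> \<le> (force_const * N) * exp (k * s)"
      using AE_lborel_singleton[of 0] AE_lborel_singleton[of T]
    proof eventually_elim
      case (elim s)
      show ?case using force_close[of s] elim t by (auto simp: mult.assoc)
    qed
  qed
  also have "\<dots> \<le> (force_const * N) * exp (k * t) / k"
    by (rule set_integral_exp_le(1)) (use k nn t in auto)
  finally have "1 / \<epsilon> * \<bar>(LBINT s:{0..t}. g s) - (LBINT s:{0..t}. g' s)\<bar> \<le> 1 / \<epsilon> * ((force_const * N) * exp (k * t) / k)"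
    using A.\<epsilon>_pos by (intro mult_left_mono) auto
  then show ?thesis
    unfolding G_eq[OF t] G'_eq[OF t]
    by (subst abs_diff_mult_left) (use A.\<epsilon>_pos in \<open>simp_all add: ac_simps\<close>)
qed

end

text \<open>Each contraction estimate presupposes both distances, so they are treated together as
  one maximum. The constants involve neither \<open>k\<close> nor \<open>N\<close>, as
  \<open>exponential_contraction_zero\<close> demands.\<close>

lemma unique:
  assumes t: "t \<in> {0..T}"
  shows "G t = G' t \<and> m t = m' t"
proof -
  let ?\<delta> = "\<lambda>t. max \<bar>G t - G' t\<bar> \<bar>m t - m' t\<bar>"
  have "?\<delta> t = 0"
  proof (rule exponential_contraction_zero[OF _ _ _ t])
    show "continuous_on {0..T} ?\<delta>"
      by (intro continuous_intros A.m_continuous B.m_continuous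
        continuous_on_subset[OF A.G_continuous] continuous_on_subset[OF B.G_continuous]) auto
    show "0 \<le> ?\<delta> t" for t by auto
    fix k N t assume *: "1 \<le> k" "0 \<le> N" "\<And>s. s \<in> {0..T} \<Longrightarrow> ?\<delta> s \<le> N * exp (k * s)" "t \<in> {0..T}"
    have close: "\<bar>G s - G' s\<bar> \<le> N * exp (k * s)" "\<bar>m s - m' s\<bar> \<le> N * exp (k * s)" if "s \<in> {0..T}" for s
      using *(3)[OF that] by auto
    have nn: "0 \<le> N * exp (k * t) / k" using * by simp
    have "\<bar>G t - G' t\<bar> \<le> force_const / \<epsilon> * (N * exp (k * t) / k)"
      by (rule G_contraction[OF *(1,2) _ _ *(4)]) (use close in auto)
    also have "\<dots> \<le> max (force_const / \<epsilon>) (density_const / \<epsilon>) * (N * exp (k * t) / k)"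
      by (rule mult_right_mono[OF max.cobounded1 nn])
    finally have "\<bar>G t - G' t\<bar> \<le> max (force_const / \<epsilon>) (density_const / \<epsilon>) * (N * exp (k * t) / k)" .
    moreover have "\<bar>m t - m' t\<bar> \<le> density_const / \<epsilon> * (N * exp (k * t) / k)"
      by (rule m_contraction[OF *(1,2) _ _ *(4)]) (use close in auto)
    then have "\<bar>m t - m' t\<bar> \<le> max (force_const / \<epsilon>) (density_const / \<epsilon>) * (N * exp (k * t) / k)"
      by (rule order_trans[OF _ mult_right_mono[OF max.cobounded2 nn]])
    ultimately show "?\<delta> t \<le> max (force_const / \<epsilon>) (density_const / \<epsilon>) / k * N * exp (k * t)"
      by (simp add: ac_simps)
  qed
  then show ?thesis by (auto simp: max_def split: if_splits)
qed

end

section \<open>From solutions to labels\<close>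

lemma integral_half_line_cong_label:
  assumes e: "0 < \<epsilon>" and F: "integrable half_line F" and K: "K \<in> borel_measurable borel"
    and eq: "AE \<tau> in lborel. \<tau> \<le> t \<longrightarrow> F ((t - \<tau>) / \<epsilon>) = K \<tau>"
  shows "(\<integral>a. F a \<partial>half_line) = 1 / \<epsilon> * (LBINT \<tau>:{..t}. K \<tau>)"
proof -
  have "(LBINT \<tau>:{..t}. F ((t - \<tau>) / \<epsilon>)) = (LBINT \<tau>:{..t}. K \<tau>)"
    unfolding set_lebesgue_integral_def
  proof (rule integral_cong_AE)
    show "(\<lambda>\<tau>. indicator {..t} \<tau> *\<^sub>R F ((t - \<tau>) / \<epsilon>)) \<in> borel_measurable lborel"
      using F unfolding integral_half_line_label(1)[OF e, of _ t] set_integrable_def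
      by (rule borel_measurable_integrable)
    show "(\<lambda>\<tau>. indicator {..t} \<tau> *\<^sub>R K \<tau>) \<in> borel_measurable lborel"
      using K by measurable
    show "AE \<tau> in lborel. indicator {..t} \<tau> *\<^sub>R F ((t - \<tau>) / \<epsilon>) = indicator {..t} \<tau> *\<^sub>R K \<tau>"
      using eq by eventually_elim (auto simp: indicator_def)
  qed
  then show ?thesis
    by (simp add: integral_half_line_label(2)[OF e, of _ t])
qed

section \<open>Restriction to a shorter time interval\<close>

lemma C_L1_mono:
  assumes "\<rho> \<in> C_L1 T" "T' \<le> T"
  shows "\<rho> \<in> C_L1 T'"
  using assms unfolding C_L1_def
  by (auto intro!: tendsto_within_subset[of _ _ _ "{0..T}" "{0..T'}"])

lemma X_space_mono:
  assumes u: "u \<in> X_space T" and T': "T' \<le> T"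
  shows "u \<in> X_space T'"
proof -
  have "case_prod u \<in> borel_measurable (borel_on ({0<..<T'} \<times> {0..}))"
    by (rule measurable_restrict_mono[where A="{0<..<T} \<times> {0..}"])
      (use assms in \<open>auto simp: X_space_def Linf_loc_def\<close>)
  moreover have "case_prod u \<in> Linf (borel_on K)" if "compact K" "K \<subseteq> {0<..<T'} \<times> {0..}" for K
  proof -
    have "K \<subseteq> {0<..<T} \<times> {0..}" using that(2) T' by auto
    then show ?thesis using u that(1) by (auto simp: X_space_def Linf_loc_def)
  qed
  moreover have "X_norm T' u \<le> X_norm T u"
    unfolding X_norm_def by (rule SUP_subset_mono) (use T' in auto)
  ultimately show ?thesis
    using u by (auto simp: X_space_def Linf_loc_def)
qed

text \<open>The formulas at a time \<open>t\<close> use the force only between 0 and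
  \<open>t\<close>, so agreement of the two forces on \<open>{0..T'}\<close> suffices.\<close>

lemma characteristic_solution_mono:
  assumes sol: "characteristic_solution \<epsilon> \<zeta> \<beta> \<rho>I vI T g \<rho> w" and T': "T' \<le> T" and e: "0 < \<epsilon>"
    and g: "\<And>s. s \<in> {0..T'} \<Longrightarrow> g s = g' s"
  shows "characteristic_solution \<epsilon> \<zeta> \<beta> \<rho>I vI T' g' \<rho> w"
  unfolding characteristic_solution_def
proof (intro conjI ballI)
  show "\<rho> \<in> C_L1 T'" "w \<in> X_space T'"
    using sol C_L1_mono X_space_mono T' by (auto simp: characteristic_solution_def)
  have "integrable (borel_on {0<..<T}) g"
    using sol by (auto simp: characteristic_solution_def)
  then have "set_integrable lborel {0<..<T'} g"
    unfolding integrable_restrict_space[of "{0<..<T}" lborel, simplified] set_integrable_def[symmetric]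
    by (rule set_integrable_subset) (use T' in auto)
  then have "integrable (borel_on {0<..<T'}) g"
    by (simp add: set_integrable_def integrable_restrict_space)
  then show "integrable (borel_on {0<..<T'}) g'"
    by (rule Bochner_Integration.integrable_cong[THEN iffD1, rotated -1]) (auto intro: g)
  fix t assume t: "t \<in> {0..T'}"
  have I: "(LBINT s:{c..t}. g s) = (LBINT s:{c..t}. g' s)" if "0 \<le> c" for c
    by (rule set_lebesgue_integral_cong) (use that t g in auto)
  have "0 \<le> t - \<epsilon> * a" if "a < t / \<epsilon>" for a
    using that e by (simp add: pos_less_divide_eq mult.commute)
  note I' = I[OF this] I[of 0, simplified]
  have "t \<in> {0..T}" using t T' by auto
  with sol have "AE a in half_line.
      \<rho> t a = (if a < t / \<epsilon> then \<beta> (t - \<epsilon> * a) * (1 - mu0 \<rho> (t - \<epsilon> * a)) *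
              exp (- (LBINT s:{0..a}. \<zeta> (w (t - \<epsilon> * (a - s)) s)))
         else \<rho>I (a - t / \<epsilon>) * exp (- (1 / \<epsilon> * (LBINT s:{0..t}. \<zeta> (w s (a + (s - t) / \<epsilon>)))))) \<and>
      w t a = (if a < t / \<epsilon> then 1 / \<epsilon> * (LBINT s:{t - \<epsilon> * a..t}. g s)
         else vI (a - t / \<epsilon>) + 1 / \<epsilon> * (LBINT s:{0..t}. g s))"
    unfolding characteristic_solution_def by blast
  then show "AE a in half_line.
      \<rho> t a = (if a < t / \<epsilon> then \<beta> (t - \<epsilon> * a) * (1 - mu0 \<rho> (t - \<epsilon> * a)) *
              exp (- (LBINT s:{0..a}. \<zeta> (w (t - \<epsilon> * (a - s)) s)))
         else \<rho>I (a - t / \<epsilon>) * exp (- (1 / \<epsilon> * (LBINT s:{0..t}. \<zeta> (w s (a + (s - t) / \<epsilon>)))))) \<and>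
      w t a = (if a < t / \<epsilon> then 1 / \<epsilon> * (LBINT s:{t - \<epsilon> * a..t}. g' s)
         else vI (a - t / \<epsilon>) + 1 / \<epsilon> * (LBINT s:{0..t}. g' s))"
    by eventually_elim (auto simp: I')
qed

section \<open>Solutions of the model under its standing assumptions\<close>

locale model =
  fixes \<epsilon> \<zeta>min L \<beta>min \<beta>max :: real and \<zeta> \<beta> \<rho>I vI :: "real \<Rightarrow> real"
  assumes e: "0 < \<epsilon>" and lip: "L-lipschitz_on UNIV \<zeta>" and \<zeta>min: "0 < \<zeta>min" "\<And>u. \<zeta>min \<le> \<zeta> u"
    and A2: "assumption_A2 \<rho>I" and A3: "assumption_A3 \<beta> \<beta>min \<beta>max" and vI: "vI \<in> Linf_weighted"
begin

lemma \<zeta>_continuous: "continuous_on UNIV \<zeta>"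
  using lip by (rule lipschitz_on_continuous_on)

lemma \<zeta>_measurable [measurable]: "\<zeta> \<in> borel_measurable borel"
  using \<zeta>_continuous by (rule borel_measurable_continuous_onI)

lemma \<rho>I_measurable: "\<rho>I \<in> borel_measurable half_line"
  and \<rho>I_nonneg: "AE a in half_line. 0 \<le> \<rho>I a" and \<rho>I_integrable: "integrable half_line \<rho>I"
  using A2 by (auto simp: assumption_A2_def Linf_def)

lemma mu0_initial:
  assumes sol: "characteristic_solution \<epsilon> \<zeta> \<beta> \<rho>I vI T g \<rho> w" and T: "0 \<le> T"
  shows "mu0 \<rho> 0 = (\<integral>a. \<rho>I a \<partial>half_line)"
  unfolding mu0_def
proof (rule integral_cong_AE)
  have T0: "0 \<in> {0..T}" using T by simp
  show "\<rho> 0 \<in> borel_measurable half_line"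
    using sol T0 by (auto simp: characteristic_solution_def C_L1_def)
  show "\<rho>I \<in> borel_measurable half_line" by (rule \<rho>I_measurable)
  have 0: "(LBINT s:{0..0::real}. f s) = 0" for f :: "real \<Rightarrow> real"
  proof -
    have "(LBINT s:{0..0::real}. f s) = (LBINT s:{}. f s)"
      by (rule set_integral_discrete_difference[where X="{0}"]) auto
    then show ?thesis by (simp add: set_lebesgue_integral_def)
  qed
  from bspec[OF conjunct2[OF conjunct2[OF conjunct2[OF sol[unfolded characteristic_solution_def]]]] T0]
  show "AE a in half_line. \<rho> 0 a = \<rho>I a"
    using AE_space by eventually_elim (auto simp: 0[simplified])
qed

text \<open>Stated for all large \<open>C\<close> so that two solutions can be given the same
  constant, as \<open>renewal_pair\<close> requires.\<close>

lemma renewal_of_solution: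
  assumes sol: "characteristic_solution \<epsilon> \<zeta> \<beta> \<rho>I vI T g \<rho> w" and T: "0 < T"
  shows "\<exists>C0. \<forall>C\<ge>C0. renewal \<epsilon> T \<zeta>min L C \<beta>min \<beta>max \<zeta> \<beta> (primitive \<epsilon> T g)
    (label_offset \<epsilon> T g vI) (label_density \<epsilon> T \<beta> \<rho>I (mu0 \<rho>)) (mu0 \<rho>)"
proof -
  let ?G = "primitive \<epsilon> T g" and ?H = "label_offset \<epsilon> T g vI" and ?R = "label_density \<epsilon> T \<beta> \<rho>I (mu0 \<rho>)"
  have g: "integrable (borel_on {0<..<T}) g" and \<rho>: "\<rho> \<in> C_L1 T"
    using sol by (auto simp: characteristic_solution_def)
  have \<beta>: "continuous_on {0..} \<beta>" "0 < \<beta>min" "\<And>t. 0 \<le> t \<Longrightarrow> \<beta>min \<le> \<beta> t \<and> \<beta> t \<le> \<beta>max"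
    using A3 by (auto simp: assumption_A3_def)
  obtain B1 where B1: "0 \<le> B1" "\<And>t. \<bar>?G t\<bar> \<le> B1"
    using primitive_bounded[OF e g] by blast
  obtain B2 where B2: "0 \<le> B2" "AE a in half_line. \<bar>vI a\<bar> \<le> B2 * (1 + a)"
    using Linf_weighted_growth(2)[OF vI] by blast
  have Hm: "?H \<in> borel_measurable borel"
    by (rule label_offset_measurable[OF e g Linf_weighted_growth(1)[OF vI]])
  have Rm: "?R \<in> borel_measurable borel"
    by (rule label_density_measurable[OF e \<rho>I_measurable mu0_continuous_on[OF \<rho>] \<beta>(1)])
  \<comment> \<open>On initial labels the weight is \<open>(1 + \<epsilon> * a)\<^sup>2\<close> in
    terms of the initial age, which expands into the mass and the two moments of (A2).\<close>
  have old: "set_integrable lborel {..0} (\<lambda>\<tau>. (1 + \<bar>\<tau>\<bar>)\<^sup>2 * ?R \<tau>)"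
  proof -
    have "integrable half_line (\<lambda>a. a * \<rho>I a)" "integrable half_line (\<lambda>a. a\<^sup>2 * \<rho>I a)"
      using A2 by (auto simp: assumption_A2_def)
    then have "integrable half_line (\<lambda>a. \<rho>I a + 2 * \<epsilon> * (a * \<rho>I a) + \<epsilon>\<^sup>2 * (a\<^sup>2 * \<rho>I a))"
      using \<rho>I_integrable by simp
    also have "(\<lambda>a. \<rho>I a + 2 * \<epsilon> * (a * \<rho>I a) + \<epsilon>\<^sup>2 * (a\<^sup>2 * \<rho>I a)) = (\<lambda>a. (1 + \<epsilon> * a)\<^sup>2 * \<rho>I a)"
      by (auto simp: power2_eq_square algebra_simps)
    finally have "set_integrable lborel {..0} (\<lambda>\<tau>. (1 + \<epsilon> * ((0 - \<tau>) / \<epsilon>))\<^sup>2 * \<rho>I ((0 - \<tau>) / \<epsilon>))"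
      by (simp only: integral_half_line_label(1)[OF e, of _ 0])
    then show ?thesis
      by (rule set_integrable_cong[THEN iffD1, rotated -1]) (use e in \<open>auto simp: label_density_def\<close>)
  qed
  have new: "set_integrable lborel {0<..T} (\<lambda>\<tau>. (1 + \<bar>\<tau>\<bar>)\<^sup>2 * ?R \<tau>)"
  proof -
    have "set_integrable lborel {0..T} (\<lambda>\<tau>. (1 + \<bar>\<tau>\<bar>)\<^sup>2 * (\<beta> \<tau> * (1 - mu0 \<rho> \<tau>)))"
      unfolding set_integrable_def
      by (rule borel_integrable_compact)
        (auto intro!: continuous_intros mu0_continuous_on[OF \<rho>] continuous_on_subset[OF \<beta>(1)])
    then have "set_integrable lborel {0<..T} (\<lambda>\<tau>. (1 + \<bar>\<tau>\<bar>)\<^sup>2 * (\<beta> \<tau> * (1 - mu0 \<rho> \<tau>)))"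
      by (rule set_integrable_subset) auto
    then show ?thesis
      by (rule set_integrable_cong[THEN iffD1, rotated -1]) (auto simp: label_density_def)
  qed
  have "{..0} \<union> {0<..T} = {..T}" using T by auto
  with set_integrable_Un[OF old new] have Rmom: "set_integrable lborel {..T} (\<lambda>\<tau>. (1 + \<bar>\<tau>\<bar>)\<^sup>2 * ?R \<tau>)"
    by simp
  \<comment> \<open>\<open>B2\<close> measures growth in the initial age
    \<open>- \<tau> / \<epsilon>\<close>; the factor \<open>1 + 1 / \<epsilon>\<close> converts it
    into growth in the label.\<close>
  have H_growth: "AE \<tau> in lborel. \<tau> \<le> T \<longrightarrow> \<bar>?H \<tau>\<bar> \<le> C * (1 + \<bar>\<tau>\<bar>)"
    if C: "B1 \<le> C" "B2 * (1 + 1 / \<epsilon>) \<le> C" for C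
    using B2(2)[unfolded AE_half_line_label[OF e, of _ 0]]
  proof eventually_elim
    case (elim \<tau>)
    show ?case
    proof (cases "0 < \<tau>")
      case True
      then have "\<bar>?H \<tau>\<bar> \<le> C * 1"
        using B1(2)[of \<tau>] C by (simp add: label_offset_def)
      also have "\<dots> \<le> C * (1 + \<bar>\<tau>\<bar>)"
        using B1 C by (intro mult_left_mono) auto
      finally show ?thesis by simp
    next
      case False
      then have "\<bar>?H \<tau>\<bar> \<le> B2 * (1 + - \<tau> / \<epsilon>)"
        using elim by (simp add: label_offset_def)
      also have "\<dots> \<le> B2 * ((1 + 1 / \<epsilon>) * (1 + \<bar>\<tau>\<bar>))"
      proof (rule mult_left_mono[OF _ B2(1)])
        have "(1 + 1 / \<epsilon>) * (1 + \<bar>\<tau>\<bar>) = (1 + - \<tau> / \<epsilon>) + (1 / \<epsilon> - \<tau>)"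
          using False by (simp add: algebra_simps diff_divide_distrib)
        moreover have "0 \<le> 1 / \<epsilon>" using e by simp
        ultimately show "1 + - \<tau> / \<epsilon> \<le> (1 + 1 / \<epsilon>) * (1 + \<bar>\<tau>\<bar>)"
          using False by linarith
      qed
      also have "\<dots> \<le> C * (1 + \<bar>\<tau>\<bar>)"
        using C by (simp add: mult.assoc[symmetric] mult_right_mono)
      finally show ?thesis by simp
    qed
  qed
  have R_initial: "AE \<tau> in lborel. \<tau> \<le> 0 \<longrightarrow> 0 \<le> ?R \<tau>"
    using \<rho>I_nonneg[unfolded AE_half_line_label[OF e, of _ 0]]
    by eventually_elim (auto simp: label_density_def)
  have Em: "(\<lambda>\<tau>. survival \<epsilon> \<zeta> ?H ?G \<tau> t) \<in> borel_measurable borel" for t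
  proof -
    note [measurable] = Hm borel_measurable_continuous_onI[OF primitive_continuous[OF e g]]
    have *: "(\<lambda>\<tau>. LBINT r:{max \<tau> 0..t}. \<zeta> (?H \<tau> + ?G r))
        = (\<lambda>\<tau>. \<integral>r. (if max \<tau> 0 \<le> r \<and> r \<le> t then \<zeta> (?H \<tau> + ?G r) else 0) \<partial>lborel)"
      by (auto simp: set_lebesgue_integral_def fun_eq_iff intro!: Bochner_Integration.integral_cong)
    have "(\<lambda>\<tau>. LBINT r:{max \<tau> 0..t}. \<zeta> (?H \<tau> + ?G r)) \<in> borel_measurable borel"
      unfolding * by measurable
    then show ?thesis unfolding survival_def by measurable
  qed
  have m_eq: "mu0 \<rho> t = 1 / \<epsilon> * (LBINT \<tau>:{..t}. ?R \<tau> * survival \<epsilon> \<zeta> ?H ?G \<tau> t)" if t: "t \<in> {0..T}" for t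
    unfolding mu0_def[of \<rho> t]
  proof (rule integral_half_line_cong_label[OF e])
    show "integrable half_line (\<rho> t)" using \<rho> t by (auto simp: C_L1_def)
    show "AE \<tau> in lborel. \<tau> \<le> t \<longrightarrow> \<rho> t ((t - \<tau>) / \<epsilon>) = ?R \<tau> * survival \<epsilon> \<zeta> ?H ?G \<tau> t"
      using characteristic_solution_label[OF e \<zeta>_continuous vI sol t] by eventually_elim auto
  qed (use Rm Em in measurable)
  have m0: "mu0 \<rho> 0 < 1"
    using mu0_initial[OF sol] T A2 by (simp add: assumption_A2_def)
  have "renewal \<epsilon> T \<zeta>min L C \<beta>min \<beta>max \<zeta> \<beta> ?G ?H ?R (mu0 \<rho>)"
    if C: "B1 \<le> C" "B2 * (1 + 1 / \<epsilon>) \<le> C" for C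
  proof
    show "\<bar>?G t\<bar> \<le> C" for t using B1(2)[of t] C by simp
  qed (use e T lip \<zeta>min primitive_continuous[OF e g] primitive_0[OF e g] Hm H_growth[OF C] Rm Rmom R_initial \<beta>
      mu0_continuous_on[OF \<rho>] m0 m_eq in \<open>auto simp: label_offset_def label_density_def\<close>)
  then show ?thesis
    by (intro exI[of _ "max B1 (B2 * (1 + 1 / \<epsilon>))"]) auto
qed

lemma coupling_label:
  assumes sol: "characteristic_solution \<epsilon> \<zeta> \<beta> \<rho>I vI T g \<rho> w" and t: "t \<in> {0..T}"
    and int: "integrable half_line (\<lambda>a. \<zeta> (w t a) * w t a * \<rho> t a)"
    and ren: "renewal \<epsilon> T \<zeta>min L C \<beta>min \<beta>max \<zeta> \<beta> (primitive \<epsilon> T g)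
      (label_offset \<epsilon> T g vI) (label_density \<epsilon> T \<beta> \<rho>I (mu0 \<rho>)) (mu0 \<rho>)"
  shows "(\<integral>a. \<zeta> (w t a) * w t a * \<rho> t a \<partial>half_line)
    = renewal.coupling \<epsilon> \<zeta> (primitive \<epsilon> T g) (label_offset \<epsilon> T g vI) (label_density \<epsilon> T \<beta> \<rho>I (mu0 \<rho>)) t"
proof -
  interpret renewal \<epsilon> T \<zeta>min L C \<beta>min \<beta>max \<zeta> \<beta> "primitive \<epsilon> T g" "label_offset \<epsilon> T g vI"
    "label_density \<epsilon> T \<beta> \<rho>I (mu0 \<rho>)" "mu0 \<rho>"
    by (rule ren)
  show ?thesis
    unfolding coupling_def
  proof (rule integral_half_line_cong_label[OF e int])
    show "AE \<tau> in lborel. \<tau> \<le> t \<longrightarrow> \<zeta> (w t ((t - \<tau>) / \<epsilon>)) * w t ((t - \<tau>) / \<epsilon>) * \<rho> t ((t - \<tau>) / \<epsilon>)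
        = label_density \<epsilon> T \<beta> \<rho>I (mu0 \<rho>) \<tau> * (E \<tau> t * (rate \<tau> t * (label_offset \<epsilon> T g vI \<tau> + primitive \<epsilon> T g t)))"
      using characteristic_solution_label[OF e \<zeta>_continuous vI sol t] by eventually_elim (auto simp: ac_simps)
  qed measurable
qed

text \<open>Of the masses only nonvanishing is given. Positivity on all of \<open>{0..T}\<close>
  comes from \<open>m_pos\<close>, and compactness then provides the common lower bound \<mu> on
  which the comparison rests.\<close>

lemma coupled_unique:
  assumes S: "solves_coupled \<epsilon> \<zeta> \<beta> f \<rho>I vI T \<rho> w" and S': "solves_coupled \<epsilon> \<zeta> \<beta> f \<rho>I vI T \<rho>' w'"
    and T: "0 < T" and f: "\<And>t. t \<in> {0<..<T} \<Longrightarrow> \<bar>deriv f t\<bar> \<le> F" and t: "t \<in> {0..T}"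
  shows "AE a in half_line. \<rho>' t a = \<rho> t a \<and> w' t a = w t a"
proof -
  define g where "g t = 1 / mu0 \<rho> t * coupling_force \<epsilon> \<zeta> f \<rho> w t" for t
  define g' where "g' t = 1 / mu0 \<rho>' t * coupling_force \<epsilon> \<zeta> f \<rho>' w' t" for t
  have sol: "characteristic_solution \<epsilon> \<zeta> \<beta> \<rho>I vI T g \<rho> w"
    and sol': "characteristic_solution \<epsilon> \<zeta> \<beta> \<rho>I vI T g' \<rho>' w'"
    and int: "\<And>t. t \<in> {0..T} \<Longrightarrow> integrable half_line (\<lambda>a. \<zeta> (w t a) * w t a * \<rho> t a)"
      "\<And>t. t \<in> {0..T} \<Longrightarrow> integrable half_line (\<lambda>a. \<zeta> (w' t a) * w' t a * \<rho>' t a)"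
    using S S' by (auto simp: solves_coupled_def g_def[abs_def] g'_def[abs_def])
  have gi: "integrable (borel_on {0<..<T}) g" "integrable (borel_on {0<..<T}) g'"
    using sol sol' by (auto simp: characteristic_solution_def)
  let ?G = "primitive \<epsilon> T g" and ?H = "label_offset \<epsilon> T g vI" and ?R = "label_density \<epsilon> T \<beta> \<rho>I (mu0 \<rho>)"
  let ?G' = "primitive \<epsilon> T g'" and ?H' = "label_offset \<epsilon> T g' vI" and ?R' = "label_density \<epsilon> T \<beta> \<rho>I (mu0 \<rho>')"
  obtain C1 where C1: "\<And>C. C1 \<le> C \<Longrightarrow> renewal \<epsilon> T \<zeta>min L C \<beta>min \<beta>max \<zeta> \<beta> ?G ?H ?R (mu0 \<rho>)"
    using renewal_of_solution[OF sol T] by blast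
  obtain C2 where C2: "\<And>C. C2 \<le> C \<Longrightarrow> renewal \<epsilon> T \<zeta>min L C \<beta>min \<beta>max \<zeta> \<beta> ?G' ?H' ?R' (mu0 \<rho>')"
    using renewal_of_solution[OF sol' T] by blast
  define C where "C = max C1 C2"
  interpret A: renewal \<epsilon> T \<zeta>min L C \<beta>min \<beta>max \<zeta> \<beta> ?G ?H ?R "mu0 \<rho>"
    by (rule C1) (simp add: C_def)
  interpret B: renewal \<epsilon> T \<zeta>min L C \<beta>min \<beta>max \<zeta> \<beta> ?G' ?H' ?R' "mu0 \<rho>'"
    by (rule C2) (simp add: C_def)
  have pos: "0 < mu0 \<rho> t" "0 < mu0 \<rho>' t" if "t \<in> {0..T}" for t
    using A.m_pos[OF that] B.m_pos[OF that] mu0_initial[OF sol] mu0_initial[OF sol'] T A2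
    by (auto simp: assumption_A2_def)
  obtain t1 where t1: "t1 \<in> {0..T}" "\<And>t. t \<in> {0..T} \<Longrightarrow> mu0 \<rho> t1 \<le> mu0 \<rho> t"
    using continuous_attains_inf[OF _ _ A.m_continuous] T by auto
  obtain t2 where t2: "t2 \<in> {0..T}" "\<And>t. t \<in> {0..T} \<Longrightarrow> mu0 \<rho>' t2 \<le> mu0 \<rho>' t"
    using continuous_attains_inf[OF _ _ B.m_continuous] T by auto
  define \<mu> where "\<mu> = min (mu0 \<rho> t1) (mu0 \<rho>' t2)"
  interpret renewal_pair \<epsilon> T \<zeta>min L C \<beta>min \<beta>max \<zeta> \<beta> ?G ?H ?R "mu0 \<rho>" ?G' ?H' ?R' "mu0 \<rho>'" "deriv f" g g' F \<mu>
  proof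
    show "?H \<tau> = ?H' \<tau>" "?R \<tau> = ?R' \<tau>" if "\<tau> \<le> 0" for \<tau>
      using that by (auto simp: label_offset_def label_density_def)
    show "0 < \<mu>" using pos(1)[OF t1(1)] pos(2)[OF t2(1)] by (simp add: \<mu>_def)
    show "\<mu> \<le> mu0 \<rho> t \<and> \<mu> \<le> mu0 \<rho>' t" if "t \<in> {0..T}" for t
      using t1(2)[OF that] t2(2)[OF that] by (auto simp: \<mu>_def)
    show "\<bar>deriv f t\<bar> \<le> F" if "t \<in> {0<..<T}" for t
      using f that .
    show "g t = 1 / mu0 \<rho> t * (\<epsilon> * deriv f t + A.coupling t)" if "t \<in> {0<..<T}" for t
      using coupling_label[OF sol _ int(1) A.renewal_axioms, of t] that by (simp add: g_def coupling_force_def)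
    show "g' t = 1 / mu0 \<rho>' t * (\<epsilon> * deriv f t + B.coupling t)" if "t \<in> {0<..<T}" for t
      using coupling_label[OF sol' _ int(2) B.renewal_axioms, of t] that by (simp add: g'_def coupling_force_def)
    show "?G t = 1 / \<epsilon> * (LBINT s:{0..t}. g s)" if "t \<in> {0..T}" for t
      using primitive_diff(1)[OF e gi(1), of 0 t] primitive_0[OF e gi(1)] that by simp
    show "?G' t = 1 / \<epsilon> * (LBINT s:{0..t}. g' s)" if "t \<in> {0..T}" for t
      using primitive_diff(1)[OF e gi(2), of 0 t] primitive_0[OF e gi(2)] that by simp
    show "set_integrable lborel {0..T} g" "set_integrable lborel {0..T} g'"
      using primitive_diff(2)[OF e gi(1), of 0 T] primitive_diff(2)[OF e gi(2), of 0 T] T by auto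
  qed
  \<comment> \<open>Equality of the primitives and masses propagates back: offsets and densities
    agree on labels up to \<open>T\<close>, then the survival factors, then the solutions.\<close>
  have HR: "?H' \<tau> = ?H \<tau>" "?R' \<tau> = ?R \<tau>" if "\<tau> \<le> T" for \<tau>
    using unique[of \<tau>] that by (auto simp: label_offset_def label_density_def)
  have "survival \<epsilon> \<zeta> ?H' ?G' \<tau> t = survival \<epsilon> \<zeta> ?H ?G \<tau> t" if "\<tau> \<le> t" for \<tau>
  proof -
    have "(LBINT r:{max \<tau> 0..t}. \<zeta> (?H' \<tau> + ?G' r)) = (LBINT r:{max \<tau> 0..t}. \<zeta> (?H \<tau> + ?G r))"
      by (rule set_lebesgue_integral_cong) (use unique t that HR in auto)
    then show ?thesis by (simp add: survival_def)
  qed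
  note eqs = this HR unique[OF t]
  show ?thesis
    unfolding AE_half_line_label[OF e, of _ t]
    using characteristic_solution_label[OF e \<zeta>_continuous vI sol t]
      characteristic_solution_label[OF e \<zeta>_continuous vI sol' t]
    by eventually_elim (use eqs t in auto)
qed

end


text \<open>The force equation is solved for f', all other terms being measurable; with this,
  \<open>Linf_norm_bounded\<close> applies to the derivative of f.\<close>

lemma deriv_measurable_of_coupling:
  fixes \<epsilon> T l :: real and g c m f' :: "real \<Rightarrow> real"
  assumes "0 < \<epsilon>" "integrable (borel_on {0<..<T}) g" "c \<in> borel_measurable borel" "continuous_on {0..T} m"
    and g: "\<And>t. t \<in> {0<..<T} \<Longrightarrow> g t = 1 / max (m t) l * (\<epsilon> * f' t + c t)" and l: "0 < l"
  shows "f' \<in> borel_measurable (borel_on {0<..<T})"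
proof -
  have "m \<in> borel_measurable (restrict_space borel {0<..<T})"
    by (intro borel_measurable_continuous_on_restrict continuous_on_subset[OF assms(4)]) auto
  then have [measurable]: "m \<in> borel_measurable (borel_on {0<..<T})"
    by (subst measurable_cong_sets[OF sets_restrict_space_cong[OF sets_lborel] refl])
  have [measurable]: "g \<in> borel_measurable (borel_on {0<..<T})"
    using assms(2) by (rule borel_measurable_integrable)
  have [measurable]: "c \<in> borel_measurable (borel_on {0<..<T})"
    by (rule measurable_restrict_space1) (use assms(3) in simp)
  have "(\<lambda>t. (g t * max (m t) l - c t) / \<epsilon>) \<in> borel_measurable (borel_on {0<..<T})"
    by measurable
  also have "?this \<longleftrightarrow> f' \<in> borel_measurable (borel_on {0<..<T})"
  proof (rule measurable_cong)
    fix t assume "t \<in> space (borel_on {0<..<T})"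
    then have t: "t \<in> {0<..<T}" by simp
    have "0 < max (m t) l" using l by simp
    then show "(g t * max (m t) l - c t) / \<epsilon> = f' t"
      using assms(1) by (simp add: g[OF t])
  qed
  finally show ?thesis .
qed

section \<open>Constants of the cut-off problem and return to the coupled system\<close>

theorem theorem5p1:
  fixes \<epsilon> \<zeta>min \<zeta>Lip \<beta>min \<beta>max Tbar \<mu>low \<gamma>2 \<gamma>3 \<zeta>bar T :: real
    and \<zeta> f \<beta> \<rho>I vI :: "real \<Rightarrow> real"
    and \<rho> w :: "real \<Rightarrow> real \<Rightarrow> real"
  assumes "0 < \<epsilon>" and "0 < Tbar"
    and "assumption_A1 \<zeta> \<zeta>min \<zeta>Lip"
    and "\<exists>L. L-lipschitz_on {0<..<Tbar} f"
    and "assumption_A2 \<rho>I"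
    and "assumption_A3 \<beta> \<beta>min \<beta>max"
    and "vI \<in> Linf_weighted"
    and "0 < \<mu>low" and "\<mu>low < (\<integral>a. \<rho>I a \<partial>half_line)"
    and "solves_cutoff \<epsilon> \<zeta> \<beta> f \<rho>I vI \<mu>low Tbar \<rho> w"
    and "0 < \<gamma>2"
    and "\<forall>t\<in>{0..Tbar}. (\<integral>a. \<zeta> (w t a) * \<bar>w t a\<bar> * \<rho> t a \<partial>half_line) \<le> \<gamma>2 / \<mu>low"
    and "\<gamma>3 = \<zeta>Lip * (\<epsilon> * real_of_ereal (Linf_norm (borel_on {0<..<Tbar}) (deriv f)) + \<gamma>2)"
    and "\<zeta>bar = \<zeta> 0 + (\<integral>a. \<zeta> (vI a) * \<rho>I a \<partial>half_line) / (\<integral>a. \<rho>I a \<partial>half_line)"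
    and "T = \<epsilon> / \<gamma>3 * (\<beta>min * \<mu>low - (\<beta>min + \<zeta>bar) * \<mu>low\<^sup>2)"
  shows "(\<forall>t\<in>{0<..<min T Tbar}. \<mu>low < mu0 \<rho> t) \<and>
    (0 < min T Tbar \<longrightarrow> unique_solution_coupled \<epsilon> \<zeta> \<beta> f \<rho>I vI (min T Tbar) \<rho> w)"
proof -
  let ?I = "\<integral>a. \<rho>I a \<partial>half_line"
  note e = assms(1) and Tbar = assms(2) and \<mu> = assms(8,9) and cut = assms(10) and \<gamma>2 = assms(11,12)
  have lip: "\<zeta>Lip-lipschitz_on UNIV \<zeta>" and \<zeta>min: "0 < \<zeta>min" "\<And>u. \<zeta>min \<le> \<zeta> u" and \<zeta>Lip: "0 < \<zeta>Lip"
    using assms(3) by (auto simp: assumption_A1_def intro: lipschitz_on_AE_deriv_bound)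
  interpret model \<epsilon> \<zeta>min \<zeta>Lip \<beta>min \<beta>max \<zeta> \<beta> \<rho>I vI
    by standard (use e lip \<zeta>min assms(5,6,7) in auto)
  define g where "g t = 1 / max (mu0 \<rho> t) \<mu>low * coupling_force \<epsilon> \<zeta> f \<rho> w t" for t
  have sol: "characteristic_solution \<epsilon> \<zeta> \<beta> \<rho>I vI Tbar g \<rho> w"
    and int: "\<And>t. t \<in> {0..Tbar} \<Longrightarrow> integrable half_line (\<lambda>a. \<zeta> (w t a) * w t a * \<rho> t a)"
    using cut by (auto simp: solves_cutoff_def g_def[abs_def])
  have gi: "integrable (borel_on {0<..<Tbar}) g"
    using sol by (auto simp: characteristic_solution_def)
  let ?G = "primitive \<epsilon> Tbar g" and ?H = "label_offset \<epsilon> Tbar g vI" and ?R = "label_density \<epsilon> Tbar \<beta> \<rho>I (mu0 \<rho>)"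
  obtain C where "renewal \<epsilon> Tbar \<zeta>min \<zeta>Lip C \<beta>min \<beta>max \<zeta> \<beta> ?G ?H ?R (mu0 \<rho>)"
    using renewal_of_solution[OF sol Tbar] by blast
  then interpret renewal \<epsilon> Tbar \<zeta>min \<zeta>Lip C \<beta>min \<beta>max \<zeta> \<beta> ?G ?H ?R "mu0 \<rho>" .
  have I: "0 < ?I" "?I < 1"
    using assms(5) by (auto simp: assumption_A2_def)
  have mu00: "mu0 \<rho> 0 = ?I"
    using mu0_initial[OF sol] Tbar by simp
  have cf: "coupling_force \<epsilon> \<zeta> f \<rho> w t = \<epsilon> * deriv f t + coupling t" if "t \<in> {0..Tbar}" for t
    using coupling_label[OF sol that int[OF that] renewal_axioms] by (simp add: coupling_force_def)
  \<comment> \<open>\<open>F\<close> is a crude bound valid at every time: it makes the essential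
    supremum \<open>Fn\<close> finite and serves in the uniqueness part, where any bound will do.
    The sharp constant \<gamma>3 is built from \<open>Fn\<close>.\<close>
  obtain F where F: "\<And>t. t \<in> {0<..<Tbar} \<Longrightarrow> \<bar>deriv f t\<bar> \<le> F"
    using assms(4) lipschitz_on_bounded_deriv[OF _ open_greaterThanLessThan] by metis
  define Fn where "Fn = real_of_ereal (Linf_norm (borel_on {0<..<Tbar}) (deriv f))"
  have dm: "deriv f \<in> borel_measurable (borel_on {0<..<Tbar})"
    by (rule deriv_measurable_of_coupling[OF e gi coupling_measurable m_continuous _ \<mu>(1)])
      (use cf in \<open>auto simp: g_def\<close>)
  have "emeasure (borel_on {0<..<Tbar}) (space (borel_on {0<..<Tbar})) \<noteq> 0"
    using Tbar by (simp add: emeasure_restrict_space)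
  note Fn = Linf_norm_bounded[OF dm _ this, of F, folded Fn_def]
  have Fn_bound: "AE t in borel_on {0<..<Tbar}. \<bar>deriv f t\<bar> \<le> Fn" and Fn_nonneg: "0 \<le> Fn"
    by (rule Fn; use F in simp)+
  have \<gamma>3: "\<gamma>3 = \<zeta>Lip * (\<epsilon> * Fn + \<gamma>2)" "0 < \<gamma>3"
    using assms(13) \<zeta>Lip e Fn_nonneg \<gamma>2(1) by (auto simp: Fn_def intro!: mult_pos_pos add_nonneg_pos)
  have coupling_le: "\<bar>coupling t\<bar> \<le> \<gamma>2 / \<mu>low" if t: "t \<in> {0..Tbar}" for t
  proof -
    \<comment> \<open>The hypothesis bounds an integral with \<rho> itself in the integrand, so
      nonnegativity of \<rho> is needed to control the absolute value of the coupling.\<close>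
    have "AE \<tau> in lborel. \<tau> \<le> t \<longrightarrow> 0 \<le> \<rho> t ((t - \<tau>) / \<epsilon>)"
      using R_nonneg characteristic_solution_label[OF e \<zeta>_continuous vI sol t]
      by eventually_elim (use t in \<open>auto simp: less_imp_le[OF E_pos]\<close>)
    then have \<rho>_nonneg: "AE a in half_line. 0 \<le> \<rho> t a"
      by (simp only: AE_half_line_label[OF e, of _ t])
    have \<rho>_int: "integrable half_line (\<rho> t)"
      using sol t by (auto simp: characteristic_solution_def C_L1_def)
    have "coupling t = (\<integral>a. \<zeta> (w t a) * w t a * \<rho> t a \<partial>half_line)"
      using coupling_label[OF sol t int[OF t] renewal_axioms] by simp
    also have "\<bar>\<dots>\<bar> \<le> (\<integral>a. \<bar>\<zeta> (w t a) * w t a * \<rho> t a\<bar> \<partial>half_line)"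
      by (rule integral_abs_bound)
    also have "\<dots> = (\<integral>a. \<zeta> (w t a) * \<bar>w t a\<bar> * \<rho> t a \<partial>half_line)"
    proof (rule integral_cong_AE)
      have abs_m: "(\<lambda>a. \<bar>\<zeta> (w t a) * w t a * \<rho> t a\<bar>) \<in> borel_measurable half_line"
        using int[OF t] by (intro borel_measurable_integrable) simp
      then show "(\<lambda>a. \<bar>\<zeta> (w t a) * w t a * \<rho> t a\<bar>) \<in> borel_measurable half_line" .
      \<comment> \<open>Multiplying by the sign of \<rho> recovers the integrand from the integrable
        product and avoids a separate argument for the measurability of \<open>w t\<close>.\<close>
      have "(\<lambda>a. \<bar>\<zeta> (w t a) * w t a * \<rho> t a\<bar> * sgn (\<rho> t a)) \<in> borel_measurable half_line"
        using abs_m borel_measurable_integrable[OF \<rho>_int] by measurable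
      moreover have "(\<lambda>a. \<bar>\<zeta> (w t a) * w t a * \<rho> t a\<bar> * sgn (\<rho> t a)) = (\<lambda>a. \<zeta> (w t a) * \<bar>w t a\<bar> * \<rho> t a)"
        using \<zeta>_pos by (auto simp: fun_eq_iff abs_mult sgn_if less_imp_le)
      ultimately show "(\<lambda>a. \<zeta> (w t a) * \<bar>w t a\<bar> * \<rho> t a) \<in> borel_measurable half_line"
        by simp
      show "AE a in half_line. \<bar>\<zeta> (w t a) * w t a * \<rho> t a\<bar> = \<zeta> (w t a) * \<bar>w t a\<bar> * \<rho> t a"
        using \<rho>_nonneg by eventually_elim (use \<zeta>_pos in \<open>auto simp: abs_mult less_imp_le\<close>)
    qed
    also have "\<dots> \<le> \<gamma>2 / \<mu>low"
      using \<gamma>2(2) t by blast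
    finally show ?thesis .
  qed
  have \<mu>1: "\<mu>low < 1" using \<mu> I by simp
  have "AE t in borel_on {0<..<Tbar}. \<bar>g t\<bar> \<le> (\<epsilon> * Fn + \<gamma>2) / \<mu>low\<^sup>2"
    using Fn_bound AE_space
  proof eventually_elim
    case (elim t)
    then have t: "t \<in> {0..Tbar}" by auto
    \<comment> \<open>Since \<mu>low < 1, both terms can be put over \<mu>low; dividing by the
      cut-off mass supplies the second power. This explains the plain sum in \<gamma>3.\<close>
    have "\<epsilon> * Fn * \<mu>low \<le> \<epsilon> * Fn * 1"
      using e Fn_nonneg \<mu>1 by (intro mult_left_mono) auto
    moreover have "\<gamma>2 = \<gamma>2 / \<mu>low * \<mu>low"
      using \<mu> by simp
    ultimately have "(\<epsilon> * Fn + \<gamma>2 / \<mu>low) * \<mu>low \<le> \<epsilon> * Fn + \<gamma>2"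
      by (simp add: distrib_right)
    then have *: "\<epsilon> * Fn + \<gamma>2 / \<mu>low \<le> (\<epsilon> * Fn + \<gamma>2) / \<mu>low"
      using \<mu> by (simp add: pos_le_divide_eq)
    have "\<bar>\<epsilon> * deriv f t\<bar> \<le> \<epsilon> * Fn"
      using elim(1) e by (simp add: abs_mult)
    then have "\<bar>\<epsilon> * deriv f t + coupling t\<bar> \<le> \<epsilon> * Fn + \<gamma>2 / \<mu>low"
      using coupling_le[OF t] by linarith
    then have "\<bar>g t\<bar> \<le> 1 / \<mu>low * ((\<epsilon> * Fn + \<gamma>2) / \<mu>low)"
      unfolding g_def cf[OF t] abs_mult
      using \<mu> * by (intro mult_mono) (auto simp: frac_le)
    then show ?case by (simp add: power2_eq_square)
  qed
  note G_lipschitz = primitive_lipschitz[OF e gi this]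
  define K where "K = \<gamma>3 / (\<epsilon> * \<mu>low\<^sup>2)"
  have rate_lipschitz: "\<bar>rate \<tau> r - rate \<tau> s\<bar> \<le> K * \<bar>r - s\<bar>" if "r \<in> {0..Tbar}" "s \<in> {0..Tbar}" for \<tau> r s
  proof -
    have "\<bar>rate \<tau> r - rate \<tau> s\<bar> \<le> \<zeta>Lip * \<bar>?G r - ?G s\<bar>"
      using \<zeta>_diff[of "?H \<tau> + ?G r" "?H \<tau> + ?G s"] by simp
    also have "\<dots> \<le> \<zeta>Lip * ((\<epsilon> * Fn + \<gamma>2) / \<mu>low\<^sup>2 / \<epsilon> * \<bar>r - s\<bar>)"
      using G_lipschitz[OF that(2,1)] \<zeta>Lip by (intro mult_left_mono) auto
    also have "\<dots> = K * \<bar>r - s\<bar>"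
      by (simp add: K_def \<gamma>3(1) ac_simps)
    finally show ?thesis .
  qed
  define q where "q = (\<integral>a. \<zeta> (vI a) * \<rho>I a \<partial>half_line) / ?I"
  have "0 \<le> (\<integral>a. \<zeta> (vI a) * \<rho>I a \<partial>half_line)"
  proof (rule integral_nonneg_AE)
    show "AE a in half_line. 0 \<le> \<zeta> (vI a) * \<rho>I a"
      using \<rho>I_nonneg by eventually_elim (simp add: less_imp_le[OF \<zeta>_pos])
  qed
  then have q: "0 \<le> q" using I by (simp add: q_def)
  have initial: "(LBINT \<tau>:{..0}. ?R \<tau> * \<zeta> (?H \<tau>)) = q * (LBINT \<tau>:{..0}. ?R \<tau>)"
  proof -
    have "(LBINT \<tau>:{..0}. ?R \<tau>) = (LBINT \<tau>:{..0}. \<rho>I ((0 - \<tau>) / \<epsilon>))"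
      by (rule set_lebesgue_integral_cong) (auto simp: label_density_def)
    then have 1: "?I = 1 / \<epsilon> * (LBINT \<tau>:{..0}. ?R \<tau>)"
      by (simp only: integral_half_line_label(2)[OF e, of _ 0])
    have "(LBINT \<tau>:{..0}. ?R \<tau> * \<zeta> (?H \<tau>)) = (LBINT \<tau>:{..0}. \<zeta> (vI ((0 - \<tau>) / \<epsilon>)) * \<rho>I ((0 - \<tau>) / \<epsilon>))"
      by (rule set_lebesgue_integral_cong) (auto simp: label_density_def label_offset_def)
    then have 2: "(\<integral>a. \<zeta> (vI a) * \<rho>I a \<partial>half_line) = 1 / \<epsilon> * (LBINT \<tau>:{..0}. ?R \<tau> * \<zeta> (?H \<tau>))"
      by (simp only: integral_half_line_label(2)[OF e, of _ 0])
    have "(\<integral>a. \<zeta> (vI a) * \<rho>I a \<partial>half_line) = q * ?I"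
      using I by (simp add: q_def)
    then show ?thesis
      unfolding 1 2 using e by (simp add: field_simps)
  qed
  have greater: "\<mu>low < mu0 \<rho> t" if "t \<in> {0<..<min T Tbar}" for t
  proof (rule m_greater[OF rate_lipschitz _ q initial \<mu>(1)])
    show "t \<in> {0..Tbar}" using that by auto
    show "\<mu>low < mu0 \<rho> 0" using mu00 \<mu> by simp
    have "\<gamma>3 / \<epsilon> * t < \<gamma>3 / \<epsilon> * T"
      using that \<gamma>3(2) e by (intro mult_strict_left_mono) auto
    also have "\<gamma>3 / \<epsilon> * T = \<beta>min * \<mu>low - (\<beta>min + \<zeta>bar) * \<mu>low\<^sup>2"
      using \<gamma>3(2) e by (simp add: assms(15))
    also have "\<gamma>3 / \<epsilon> * t = K * t * \<mu>low * \<mu>low"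
      using \<mu> e by (simp add: K_def power2_eq_square)
    also have "\<zeta>bar = \<zeta> 0 + q"
      by (simp add: assms(14) q_def)
    finally have "((\<zeta> 0 + q + K * t) * \<mu>low) * \<mu>low < (\<beta>min * (1 - \<mu>low)) * \<mu>low"
      by (simp add: power2_eq_square algebra_simps)
    then show "(\<zeta> 0 + q + K * t) * \<mu>low < \<beta>min * (1 - \<mu>low)"
      using \<mu>(1) by simp
  qed
  moreover have "unique_solution_coupled \<epsilon> \<zeta> \<beta> f \<rho>I vI (min T Tbar) \<rho> w" if pos: "0 < min T Tbar"
  proof -
    let ?T = "min T Tbar"
    \<comment> \<open>The strict bound holds on the open interval, but the two forces must agree at
      the endpoints as well; there the closed inequality is enough for the maximum to equal the
      mass.\<close>
    have ge: "\<mu>low \<le> mu0 \<rho> s" if "s \<in> {0..?T}" for s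
    proof (rule continuous_ge_on_closure[of "{0<..<?T}" "mu0 \<rho>"])
      show "continuous_on (closure {0<..<?T}) (mu0 \<rho>)"
        using pos by (intro continuous_on_subset[OF m_continuous]) (auto simp: closure_greaterThanLessThan)
      show "s \<in> closure {0<..<?T}" using that pos by (simp add: closure_greaterThanLessThan)
    qed (use greater in \<open>auto intro: less_imp_le\<close>)
    have "characteristic_solution \<epsilon> \<zeta> \<beta> \<rho>I vI ?T (\<lambda>t. 1 / mu0 \<rho> t * coupling_force \<epsilon> \<zeta> f \<rho> w t) \<rho> w"
    proof (rule characteristic_solution_mono[OF sol _ e])
      show "g s = 1 / mu0 \<rho> s * coupling_force \<epsilon> \<zeta> f \<rho> w s" if "s \<in> {0..?T}" for s
        using ge[OF that] by (simp add: g_def max_absorb1)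
    qed simp
    then have S: "solves_coupled \<epsilon> \<zeta> \<beta> f \<rho>I vI ?T \<rho> w"
      unfolding solves_coupled_def
    proof (intro conjI ballI)
      show "integrable half_line (\<lambda>a. \<zeta> (w t a) * w t a * \<rho> t a)" if "t \<in> {0..?T}" for t
        using int[of t] that by simp
      show "mu0 \<rho> t \<noteq> 0" if "t \<in> {0<..<?T}" for t
        using greater[OF that] \<mu>(1) by simp
    qed
    show ?thesis
      unfolding unique_solution_coupled_def
    proof (intro conjI allI impI ballI S)
      fix \<rho>' w' t assume S': "solves_coupled \<epsilon> \<zeta> \<beta> f \<rho>I vI ?T \<rho>' w'" and t: "t \<in> {0..?T}"
      show "AE a in half_line. \<rho>' t a = \<rho> t a \<and> w' t a = w t a"
        by (rule coupled_unique[OF S S' pos _ t]) (use F in auto)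
    qed
  qed
  ultimately show ?thesis by blast
qed

end
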